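(* Let $\alpha<1$, $\alpha\neq0$, $\beta=\frac{\alpha}{1-\alpha}$, and let $\tau>\max\{4T\|\sigma^{-1}\|_F^2,\ 2T(4\beta^2-2\beta)\|\sigma^{-1}\|_F^2\}$. Let $\mathbb{P}_0$ be a probability measure on $\mathbb{R}^d$ for which there is $\gamma_0>0$ with $\mathbb{E}_{\mathbb{P}_0}[\exp(\gamma^2\|B\|_2^2)]<\infty$ for every $\gamma<\gamma_0$, where $$\frac{\gamma_0^2}{\|\sigma^{-1}\|_F^2}>T\max\Big\{\tfrac12\Big(\beta^2-\beta+2+\sqrt{(\beta^2-\beta+2)^2+8(\beta^2+\beta)}\Big),\ 8,\ \frac{\tau\cdot2T(4\beta^2-2\beta)}{\tau-2T(4\beta^2-2\beta)\|\sigma^{-1}\|_F^2}\Big\}.$$ Define $$\mathcal{J}(\mathbb{Q})=\int_{\mathbb{R}^d}\big(\mathbb{E}_{\mathbb{Q}}[L_T(B,z)]\big)^{\frac1{1-\alpha}}\varphi_T(z)dz,\qquad H(b):=\frac1{1-\alpha}\int_{\mathbb{R}^d}\nabla_bL_T(b,y)\,\mathbb{E}_{\mathbb{P}_0}[L_T(B,y)]^{\frac{\alpha}{1-\alpha}}\varphi_T(y)dy,$$ $\|H\|_{L^2_2(\mathbb{P}_0)}:=(\mathbb{E}_{\mathbb{P}_0}\|H(B)\|_2^2)^{1/2}$, and $\mathcal{U}_{\delta}=\{\mathbb{Q}:D_{c_\tau}(\mathbb{Q},\mathbb{P}_0)\le\delta\}$ with cost $c_\tau(x,y)=e^{\tau\|x-y\|_2^2}-1$.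 Then, if $\alpha\in(0,1)$, as $\delta\to0$ an asymptotically optimal perturbation is the deterministic pushforward by $b\mapsto b+\Delta^*_\delta(b)$ with $\Delta^*_\delta(b)=-\sqrt{\delta/\tau}\,H(b)/\|H\|_{L^2_2(\mathbb{P}_0)}+o(\sqrt\delta)$, and $$\inf_{\mathbb{Q}\in\mathcal{U}_\delta}\mathcal{J}(\mathbb{Q})=\mathcal{J}(\mathbb{P}_0)-\sqrt{\delta/\tau}\,\|H\|_{L^2_2(\mathbb{P}_0)}+o(\sqrt\delta).$$ If $\alpha<0$, as $\delta\to0$ an asymptotically optimal perturbation is the deterministic pushforward with $\Delta^*_\delta(b)=\sqrt{\delta/\tau}\,H(b)/\|H\|_{L^2_2(\mathbb{P}_0)}+o(\sqrt\delta)$, and $$\sup_{\mathbb{Q}\in\mathcal{U}_\delta}\mathcal{J}(\mathbb{Q})=\mathcal{J}(\mathbb{P}_0)+\sqrt{\delta/\tau}\,\|H\|_{L^2_2(\mathbb{P}_0)}+o(\sqrt\delta).$$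
   Context: Fix $d\ge1$, $T>0$, $r>0$ and an invertible $d\times d$ matrix $\sigma$; $\|\cdot\|_F$ is the Frobenius norm; $\mathbf1=(1,\dots,1)^\top$. $L_T(b,y)=\exp(\langle\sigma^{-1}(b-r\mathbf1),y\rangle-\tfrac12\|\sigma^{-1}(b-r\mathbf1)\|^2T)$ and $\varphi_T$ is the density of $\mathcal N(0,TI_d)$. $\mathbb{Q}$ ranges over Borel probability measures on $\mathbb{R}^d$ (laws of the drift $B$). $D_{c}(\mu,\nu)=\inf$ over couplings of $\mu,\nu$ of the expected cost. This functional arises from power utility $U(x)=x^\alpha/\alpha$. *)

theory Defs
  imports "HOL-Probability.Probability" "HOL-Library.Landau_Symbols"
begin

definition frob :: "real^'n^'m \<Rightarrow> real" where
  "frob A = sqrt (\<Sum>i\<in>UNIV. \<Sum>j\<in>UNIV. (A$i$j)^2)"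

definition LT :: "real \<Rightarrow> real \<Rightarrow> real^'d^'d \<Rightarrow> real^'d \<Rightarrow> real^'d \<Rightarrow> real" where
  "LT T r \<sigma> b y =
     (let m = matrix_inv \<sigma> *v (b - (\<chi> i. r)) in exp (m \<bullet> y - (norm m)^2 * T / 2))"

definition phiT :: "real \<Rightarrow> real^'d \<Rightarrow> real" where
  "phiT T z = (2 * pi * T) powr (- real CARD('d) / 2) * exp (- ((norm z)^2) / (2 * T))"

definition grad :: "('a::real_inner \<Rightarrow> real) \<Rightarrow> 'a \<Rightarrow> 'a" where
  "grad f x = (THE D. (f has_derivative (\<lambda>h. D \<bullet> h)) (at x))"

definition EQ :: "real \<Rightarrow> real \<Rightarrow> real^'d^'d \<Rightarrow> (real^'d) measure \<Rightarrow> real^'d \<Rightarrow> ennreal" where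
  "EQ T r \<sigma> Q z = (\<integral>\<^sup>+ b. ennreal (LT T r \<sigma> b z) \<partial>Q)"

(* x^p for x in [0,\<infinity>], p > 0 *)
definition enn_powr :: "ennreal \<Rightarrow> real \<Rightarrow> ennreal" where
  "enn_powr x p = (if x = \<infinity> then \<infinity> else ennreal (enn2real x powr p))"

definition Jfun :: "real \<Rightarrow> real \<Rightarrow> real^'d^'d \<Rightarrow> real \<Rightarrow> (real^'d) measure \<Rightarrow> ennreal" where
  "Jfun T r \<sigma> \<alpha> Q =
     (\<integral>\<^sup>+ z. enn_powr (EQ T r \<sigma> Q z) (1 / (1 - \<alpha>)) * ennreal (phiT T z) \<partial>lborel)"

definition Hfun :: "real \<Rightarrow> real \<Rightarrow> real^'d^'d \<Rightarrow> real \<Rightarrow> (real^'d) measure \<Rightarrow> real^'d \<Rightarrow> real^'d" where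
  "Hfun T r \<sigma> \<alpha> P0 b = (1 / (1 - \<alpha>)) *\<^sub>R
     (\<integral> y. ((\<integral> b'. LT T r \<sigma> b' y \<partial>P0) powr (\<alpha> / (1 - \<alpha>)) * phiT T y)
              *\<^sub>R grad (\<lambda>b'. LT T r \<sigma> b' y) b \<partial>lborel)"

definition HnormL2 :: "real \<Rightarrow> real \<Rightarrow> real^'d^'d \<Rightarrow> real \<Rightarrow> (real^'d) measure \<Rightarrow> real" where
  "HnormL2 T r \<sigma> \<alpha> P0 = sqrt (\<integral> b. (norm (Hfun T r \<sigma> \<alpha> P0 b))^2 \<partial>P0)"

definition couplings :: "'a::euclidean_space measure \<Rightarrow> 'a measure \<Rightarrow> ('a \<times> 'a) measure set" where
  "couplings \<mu> \<nu> = {\<pi>. prob_space \<pi> \<and> sets \<pi> = sets (borel \<Otimes>\<^sub>M borel)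
                       \<and> distr \<pi> borel fst = \<mu> \<and> distr \<pi> borel snd = \<nu>}"

definition Dc :: "('a::euclidean_space \<Rightarrow> 'a \<Rightarrow> real) \<Rightarrow> 'a measure \<Rightarrow> 'a measure \<Rightarrow> ennreal" where
  "Dc c \<mu> \<nu> = (INF \<pi>\<in>couplings \<mu> \<nu>. \<integral>\<^sup>+ p. ennreal (c (fst p) (snd p)) \<partial>\<pi>)"

definition ctau :: "real \<Rightarrow> 'a::euclidean_space \<Rightarrow> 'a \<Rightarrow> real" where
  "ctau \<tau> x y = exp (\<tau> * (norm (x - y))^2) - 1"

definition Uset :: "real \<Rightarrow> 'a::euclidean_space measure \<Rightarrow> real \<Rightarrow> 'a measure set" where
  "Uset \<tau> P0 \<delta> = {Q. prob_space Q \<and> sets Q = sets borel \<and> Dc (ctau \<tau>) Q P0 \<le> ennreal \<delta>}"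

end

theory Submission
  imports Defs
begin

text \<open>
  Write \<beta> = \<alpha> / (1 - \<alpha>), let G be the mixture likelihood under P0, and let h be the first variation of the
  functional J at P0, whose gradient is H.  A likelihood times the Gaussian density is a shifted Gaussian
  density, so h(b) averages G powr \<beta> over a Gaussian centred at an affine function of b.

  For \<alpha> > 0 the power is convex, which bounds J(Q) - J(P0) below by the change of the mean of h.  As G is
  log-convex, h is convex as well, and its subgradient inequality along a coupling followed by
  Cauchy-Schwarz yields the lower bound without any error term.  For \<alpha> < 0 the power is concave; now
  G powr \<beta> grows at most exponentially, and a second order Taylor bound for h leaves an error of order
  \<delta> powr (2/3).

  Both bounds are attained by moving mass along a truncation of H: for a bounded, compactly supported
  direction J can be differentiated by dominated convergence, and the truncation level is let tend to
  infinity slowly with \<delta>.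
\<close>

section \<open>Gaussian integrals and elementary bounds\<close>

text \<open>The obstacle for \<alpha> > 0 is integrability: \<open>G P0\<close> may grow like the
  exponential of a quadratic, so even finiteness of J at P0 has to be earned. Jensen's inequality
  and completion of the square reduce it to a finite mean of exp (\<kappa> T |mpr B|^2) under P0,
  which fixes the size of \<gamma>0. For \<alpha> < 0 exponential moments of P0 take this role. The
  speed sqrt (\<delta> / \<tau>) stems from exp (\<tau> |v|^2) - 1 \<ge> \<tau> |v|^2, which turns
  the transport budget into an L2 bound on displacements. The exponential cost has a second use: it
  pays for the exponential growth of the Taylor remainder. Moving along H itself is ruled out, as
  its exponential cost may be infinite. Truncated directions of L2 norm strictly below 1 leave room
  for the factor by which the exponential cost exceeds the quadratic one. What is differentiated
  along them is a tangent expression based at the perturbed mixture, which bounds J from the side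
  opposite to a tangent based at \<open>G P0\<close>.\<close>

lemma norm_matrix_vector_mult_le_frob: "norm (A *v x) \<le> frob A * norm x"
proof -
  have "(norm (A *v x))^2 = (\<Sum>i\<in>UNIV. (A$i \<bullet> x)^2)"
    unfolding power2_norm_eq_inner inner_vec_def[of "A *v x"] matrix_vector_mul_component by (simp add: power2_eq_square)
  also have "\<dots> \<le> (\<Sum>i\<in>UNIV. (norm (A$i))^2 * (norm x)^2)"
    by (intro sum_mono) (metis Cauchy_Schwarz_ineq power2_norm_eq_inner)
  also have "\<dots> = (frob A)^2 * (norm x)^2"
    unfolding power2_norm_eq_inner[of "A $ _"] inner_vec_def
    by (simp add: frob_def sum_nonneg sum_distrib_right power2_eq_square)
  finally have "(norm (A *v x))^2 \<le> (frob A * norm x)^2"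
    by (simp add: power_mult_distrib)
  then show ?thesis
    by (rule power2_le_imp_le) (auto simp: frob_def intro!: mult_nonneg_nonneg sum_nonneg)
qed

text \<open>The integrand factors over the coordinates, and each factor is a multiple of a normal
  density of variance 1 / (2 c).\<close>

lemma nn_integral_gaussian_finite:
  fixes c :: real
  assumes "c > 0"
  shows "(\<integral>\<^sup>+x. ennreal (exp (- c * (norm (x::'a::euclidean_space))^2)) \<partial>lborel) < \<infinity>"
proof -
  define s where "s = sqrt (1 / (2*c))"
  have s: "s > 0" "s^2 = 1/(2*c)" using assms by (auto simp: s_def)
  have 1: "ennreal (exp (- c * x^2)) = ennreal (sqrt (2 * pi * s^2)) * ennreal (normal_density 0 s x)" for x :: real
    using s assms by (simp add: normal_density_def flip: ennreal_mult)
  have fin: "(\<integral>\<^sup>+x. ennreal (exp (- c * x^2)) \<partial>lborel) < \<infinity>"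
    unfolding 1 using s by (subst nn_integral_cmult) (auto simp: nn_integral_eq_integral ennreal_mult_less_top)
  have "(\<integral>\<^sup>+x. ennreal (exp (- c * (norm (x::'a))^2)) \<partial>lborel)
      = (\<integral>\<^sup>+x. (\<Prod>b\<in>Basis. ennreal (exp (- c * ((x::'a) \<bullet> b)^2))) \<partial>lborel)"
    unfolding power2_norm_eq_inner by (subst euclidean_inner)
      (simp add: prod_ennreal exp_sum[symmetric] sum_distrib_left sum_negf power2_eq_square)
  also have "\<dots> = (\<Prod>b\<in>(Basis::'a set). (\<integral>\<^sup>+x. ennreal (exp (- c * x^2)) \<partial>lborel))"
    by (subst nn_integral_lborel_prod) auto
  also have "\<dots> < \<infinity>" using fin by (simp add: power_less_top_ennreal)
  finally show ?thesis .
qed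

lemma nn_integral_lborel_shift:
  fixes f :: "'a::euclidean_space \<Rightarrow> ennreal"
  assumes [measurable]: "f \<in> borel_measurable borel"
  shows "(\<integral>\<^sup>+x. f (x + a) \<partial>lborel) = (\<integral>\<^sup>+x. f x \<partial>lborel)"
proof -
  have "(\<integral>\<^sup>+x. f x \<partial>lborel) = (\<integral>\<^sup>+x. f x \<partial>distr lborel borel ((+) a))"
    by (simp add: lborel_distr_plus)
  also have "\<dots> = (\<integral>\<^sup>+x. f (a + x) \<partial>lborel)" by (subst nn_integral_distr) auto
  finally show ?thesis by (simp add: add.commute)
qed

text \<open>Completing the square and translating. The factor
  \<open>exp ((norm a)^2 / (4*c))\<close> is what later decides which Gaussian moment of P0 is
  required.\<close>

lemma nn_integral_gaussian_linear:
  fixes a :: "'a::euclidean_space" and c :: real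
  assumes "c > 0"
  shows "(\<integral>\<^sup>+x. ennreal (exp (- c * (norm x)^2 + a \<bullet> x)) \<partial>lborel)
    = ennreal (exp ((norm a)^2 / (4*c))) * (\<integral>\<^sup>+x. ennreal (exp (- c * (norm (x::'a))^2)) \<partial>lborel)"
proof -
  have *: "- c * (norm x)^2 + a \<bullet> x = (norm a)^2 / (4*c) + - c * (norm (x + (-(1/(2*c))) *\<^sub>R a))^2" for x
    using assms unfolding power2_norm_eq_inner
    by (simp add: inner_simps inner_commute field_simps)
  have "(\<integral>\<^sup>+x. ennreal (exp (- c * (norm x)^2 + a \<bullet> x)) \<partial>lborel)
     = (\<integral>\<^sup>+x. ennreal (exp ((norm a)^2 / (4*c))) * ennreal (exp (- c * (norm (x + (-(1/(2*c))) *\<^sub>R a))^2)) \<partial>lborel)"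
    by (intro nn_integral_cong) (simp only: * exp_add ennreal_mult exp_ge_zero)
  also have "\<dots> = ennreal (exp ((norm a)^2 / (4*c))) * (\<integral>\<^sup>+x. ennreal (exp (- c * (norm (x + (-(1/(2*c))) *\<^sub>R a))^2)) \<partial>lborel)"
    by (subst nn_integral_cmult) auto
  also have "(\<integral>\<^sup>+x. ennreal (exp (- c * (norm (x + (-(1/(2*c))) *\<^sub>R a))^2)) \<partial>lborel) = (\<integral>\<^sup>+x. ennreal (exp (- c * (norm (x::'a))^2)) \<partial>lborel)"
    by (rule nn_integral_lborel_shift) auto
  finally show ?thesis .
qed

text \<open>The expanded square of 2 e x - C. It absorbs a linear exponent into an arbitrarily small
  part of a quadratic one.\<close>

lemma linear_le_quadratic:
  fixes C e x :: real
  assumes "e > 0"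
  shows "C * x \<le> e * x^2 + C^2 / (4*e)"
proof -
  have "0 \<le> (2*e*x - C)^2 / (4*e)" using assms by simp
  also have "\<dots> = e * x^2 + C^2 / (4*e) - C*x"
    using assms by (simp add: power2_eq_square field_simps)
  finally show ?thesis by simp
qed

lemma abs_exp_minus_one_le: "\<bar>exp x - 1\<bar> \<le> \<bar>x\<bar> * exp \<bar>x\<bar>" for x :: real
proof (cases "x \<ge> 0")
  case True
  have "exp x * (1 - x) \<le> exp x * exp (-x)"
    using exp_ge_add_one_self[of "-x"] by (intro mult_left_mono) auto
  then show ?thesis using True by (simp add: algebra_simps exp_minus)
next
  case False
  have "1 + x \<le> exp x" by (rule exp_ge_add_one_self)
  moreover have "-x * 1 \<le> -x * exp(-x)" using False by (intro mult_left_mono) auto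
  ultimately have "1 - exp x \<le> -x * exp (-x)" by linarith
  then show ?thesis using False by simp
qed

lemma abs_exp_minus_one_minus_le: "\<bar>exp x - 1 - x\<bar> \<le> x^2 * exp \<bar>x\<bar>" for x :: real
proof -
  have 0: "exp x - 1 - x \<ge> 0" using exp_ge_add_one_self[of x] by linarith
  show ?thesis
  proof (cases "x \<ge> 0")
    case True
    have "exp x * (1 - x) \<le> 1"
      using exp_ge_add_one_self[of "-x"] mult_left_mono[of "1 - x" "exp (-x)" "exp x"] by (simp add: exp_minus)
    then have "exp x - 1 \<le> x * exp x" by (simp add: algebra_simps)
    then have "x * (exp x - 1) \<le> x * (x * exp x)" using True by (intro mult_left_mono) auto
    moreover have "exp x - 1 - x \<le> x * (exp x - 1)"
      using \<open>exp x * (1 - x) \<le> 1\<close> by (simp add: algebra_simps)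
    ultimately show ?thesis using True 0 by (simp add: power2_eq_square algebra_simps)
  next
    case False
    have "exp x * (1 - x) \<le> 1"
      using exp_ge_add_one_self[of "-x"] mult_left_mono[of "1 - x" "exp (-x)" "exp x"] by (simp add: exp_minus)
    then have "(exp x - 1) * (1 - x) \<le> x" by (simp add: algebra_simps)
    then have "(exp x - 1 - x) * (1 - x) \<le> x^2" by (simp add: algebra_simps power2_eq_square)
    moreover have "(exp x - 1 - x) * 1 \<le> (exp x - 1 - x) * (1 - x)" using 0 False by (intro mult_left_mono) auto
    moreover have "x^2 * 1 \<le> x^2 * exp \<bar>x\<bar>" by (intro mult_left_mono) auto
    ultimately show ?thesis using 0 by simp
  qed
qed

section \<open>The likelihood ratio\<close>

locale drift_model =
  fixes T r \<alpha> \<beta> :: real and \<sigma> :: "real^'d^'d" and P0 :: "(real^'d) measure"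
  assumes T_pos: "T > 0" and alpha: "\<alpha> < 1" and beta_eq: "\<beta> = \<alpha> / (1 - \<alpha>)"
    and P0_prob: "prob_space P0" and P0_sets [measurable_cong]: "sets P0 = sets borel"
begin

abbreviation lin :: "real^'d \<Rightarrow> real^'d" where "lin v \<equiv> matrix_inv \<sigma> *v v"

abbreviation adj :: "real^'d \<Rightarrow> real^'d" where "adj v \<equiv> v v* matrix_inv \<sigma>"

abbreviation nrm :: real where "nrm \<equiv> frob (matrix_inv \<sigma>)"

text \<open>The market price of risk.\<close>
definition mpr :: "real^'d \<Rightarrow> real^'d" where
  "mpr b = lin (b - (\<chi> i. r))"

text \<open>Centre of the Gaussian density, with covariance T times the identity, that likelihood
  times \<open>\<phi>\<close> forms in z.\<close>

abbreviation mean :: "real^'d \<Rightarrow> real^'d" where "mean b \<equiv> T *\<^sub>R mpr b"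

abbreviation L :: "real^'d \<Rightarrow> real^'d \<Rightarrow> real" where "L \<equiv> LT T r \<sigma>"

abbreviation \<phi> :: "real^'d \<Rightarrow> real" where "\<phi> \<equiv> phiT T"

abbreviation J :: "(real^'d) measure \<Rightarrow> ennreal" where "J \<equiv> Jfun T r \<sigma> \<alpha>"

abbreviation N :: real where "N \<equiv> HnormL2 T r \<sigma> \<alpha> P0"

text \<open>Real-valued counterpart of \<open>EQ\<close>. Nothing is lost: for fixed z the
  likelihood is bounded in b, so the integral is finite for every probability measure.\<close>

definition G :: "(real^'d) measure \<Rightarrow> real^'d \<Rightarrow> real" where
  "G Q z = (\<integral>b. L b z \<partial>Q)"

lemma beta: "1 / (1 - \<alpha>) = 1 + \<beta>" "1 + \<beta> > 0"
  using alpha by (auto simp: beta_eq field_simps)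

lemma nrm_nonneg: "nrm \<ge> 0"
  by (simp add: frob_def sum_nonneg)

lemma mpr_add: "mpr (b + v) = mpr b + lin v"
  by (simp add: mpr_def algebra_simps matrix_vector_right_distrib matrix_vector_mult_diff_distrib)

lemma norm_lin_le: "norm (lin v) \<le> nrm * norm v"
  by (rule norm_matrix_vector_mult_le_frob)

lemma inner_adj: "adj x \<bullet> v = x \<bullet> lin v"
  by (rule dot_lmul_matrix)

lemma norm_adj_le: "norm (adj x) \<le> nrm * norm x"
proof (cases "adj x = 0")
  case False
  have "norm (adj x) * norm (adj x) = x \<bullet> lin (adj x)"
    using inner_adj[of x "adj x"] by (simp add: power2_norm_eq_inner[symmetric] power2_eq_square)
  also have "\<dots> \<le> norm x * norm (lin (adj x))" by (rule norm_cauchy_schwarz)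
  also have "\<dots> \<le> norm x * (nrm * norm (adj x))"
    by (intro mult_left_mono norm_lin_le) auto
  finally have "norm (adj x) * norm (adj x) \<le> (nrm * norm x) * norm (adj x)" by (simp add: mult_ac)
  then show ?thesis by (rule mult_right_le_imp_le) (use False in simp)
qed (simp add: nrm_nonneg)

lemma norm_mpr_le: "norm (mpr b) \<le> norm (mpr 0) + nrm * norm b"
  using norm_triangle_ineq[of "mpr 0" "lin b"] norm_lin_le[of b] mpr_add[of 0 b] by simp

lemma lin_measurable [measurable]: "lin \<in> borel_measurable borel"
  by (intro borel_measurable_continuous_onI linear_continuous_on) (simp add: linear_conv_bounded_linear[symmetric])

lemma adj_measurable [measurable]: "adj \<in> borel_measurable borel"
proof -
  have "adj = (*v) (transpose (matrix_inv \<sigma>))" by (simp add: fun_eq_iff transpose_matrix_vector)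
  also have "\<dots> \<in> borel_measurable borel"
    by (intro borel_measurable_continuous_onI linear_continuous_on) (simp add: linear_conv_bounded_linear[symmetric])
  finally show ?thesis .
qed

lemma mpr_measurable [measurable]: "mpr \<in> borel_measurable borel"
  unfolding mpr_def by measurable

lemma L_eq: "L b z = exp (mpr b \<bullet> z - (norm (mpr b))^2 * T / 2)"
  by (simp add: LT_def mpr_def Let_def)

lemma L_pos: "L b z > 0" by (simp add: L_eq)

lemma L_measurable [measurable]:
  assumes [measurable]: "f \<in> borel_measurable M" "g \<in> borel_measurable M"
  shows "(\<lambda>x. L (f x) (g x)) \<in> borel_measurable M"
  unfolding L_eq by measurable

lemma phi_measurable [measurable]: "\<phi> \<in> borel_measurable borel"
  unfolding phiT_def by measurable

lemma phi_pos: "\<phi> z > 0"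
  using T_pos by (simp add: phiT_def)

text \<open>A shift of the drift multiplies the likelihood by a factor that sees b only through z -
  mean b. After recentring the Gaussian, increments therefore have the same form at every base
  point.\<close>

lemma L_add: "L (b + v) z = L b z * exp (lin v \<bullet> (z - mean b) - T * (norm (lin v))^2 / 2)"
  unfolding L_eq mpr_add exp_add[symmetric] power2_norm_eq_inner
  by (simp add: inner_simps inner_commute algebra_simps add_divide_distrib)

lemma L_le_exp: "L b z \<le> exp (norm (mpr b) * norm z)"
proof -
  have "0 \<le> (norm (mpr b))^2 * T / 2" using T_pos by simp
  with norm_cauchy_schwarz[of "mpr b" z] show ?thesis unfolding L_eq exp_le_cancel_iff by linarith
qed

lemma L_ge_exp: "exp (- (norm (mpr b) * norm z + (norm (mpr b))^2 * T / 2)) \<le> L b z"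
  using Cauchy_Schwarz_ineq2[of "mpr b" z] by (simp add: L_eq)

text \<open>Maximises the exponent over \<open>mpr b\<close>. Uniformity in b makes the likelihood
  integrable in b under every drift law.\<close>

lemma L_le_gaussian: "L b z \<le> exp ((norm z)^2 / (2 * T))"
proof -
  have "norm (mpr b) * norm z \<le> (norm (mpr b))^2 * T / 2 + (norm z)^2 / (2 * T)"
    using linear_le_quadratic[of "T/2" "norm z" "norm (mpr b)"] T_pos by (simp add: mult_ac)
  with norm_cauchy_schwarz[of "mpr b" z] show ?thesis by (simp add: L_eq)
qed

lemma L_times_phi: "L b z * \<phi> z = \<phi> (z - mean b)"
proof -
  have "mpr b \<bullet> z - (norm (mpr b))^2 * T / 2 + - ((norm z)^2) / (2 * T) = - ((norm (z - mean b))^2) / (2 * T)"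
    unfolding power2_norm_eq_inner using T_pos
    by (simp add: inner_simps inner_commute field_simps)
  then show ?thesis by (simp add: L_eq phiT_def flip: exp_add)
qed

text \<open>Cameron-Martin shift: substituting u = z - mean b moves the dependence on b out of the
  density and into the argument of f.\<close>

lemma nn_integral_L_phi:
  assumes [measurable]: "f \<in> borel_measurable borel"
  shows "(\<integral>\<^sup>+z. f z * ennreal (L b z * \<phi> z) \<partial>lborel) = (\<integral>\<^sup>+u. f (u + mean b) * ennreal (\<phi> u) \<partial>lborel)"
proof -
  have "(\<integral>\<^sup>+z. f z * ennreal (L b z * \<phi> z) \<partial>lborel)
     = (\<integral>\<^sup>+z. (f z * ennreal (\<phi> (z - mean b))) \<partial>lborel)" by (simp add: L_times_phi)
  also have "\<dots> = (\<integral>\<^sup>+z. (f (z + mean b) * ennreal (\<phi> (z + mean b - mean b))) \<partial>lborel)"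
    by (rule nn_integral_lborel_shift[symmetric]) simp
  finally show ?thesis by simp
qed

text \<open>The gap \<open>1 / (2 * T) - c\<close> absorbs the linear exponent, whatever C is. The
  rate c is kept free because a later estimate needs a specific value below
  \<open>1 / (2 * T)\<close>.\<close>

lemma phi_exp_le:
  assumes "0 \<le> c" "c < 1 / (2 * T)"
  obtains K where "K > 0" "\<And>u. \<phi> u * exp (C * norm u) \<le> K * exp (- c * (norm u)^2)"
proof
  define e where "e = 1 / (2 * T) - c"
  have e: "e > 0" using assms by (simp add: e_def)
  let ?k = "(2 * pi * T) powr (- real CARD('d) / 2)"
  show "?k * exp (C^2 / (4 * e)) > 0" using T_pos by simp
  fix u :: "real^'d"
  have "C * norm u + - ((norm u)^2) / (2 * T) \<le> C^2 / (4 * e) + - c * (norm u)^2"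
    using linear_le_quadratic[OF e, of C "norm u"] by (simp add: e_def algebra_simps)
  then have "exp (C * norm u + - ((norm u)^2) / (2 * T)) \<le> exp (C^2 / (4 * e) + - c * (norm u)^2)" by simp
  then have "?k * exp (C * norm u + - ((norm u)^2) / (2 * T)) \<le> ?k * exp (C^2 / (4 * e) + - c * (norm u)^2)"
    by (rule mult_left_mono) simp
  then show "\<phi> u * exp (C * norm u) \<le> ?k * exp (C^2 / (4 * e)) * exp (- c * (norm u)^2)"
    unfolding phiT_def exp_add by (simp add: mult_ac)
qed

lemma nn_integral_phi_exp_finite: "(\<integral>\<^sup>+u. ennreal (exp (C * norm u) * \<phi> u) \<partial>lborel) < \<infinity>"
proof -
  define c where "c = 1 / (4 * T)"
  have c: "0 < c" "c < 1 / (2 * T)" using T_pos by (auto simp: c_def field_simps)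
  obtain K where K: "K > 0" "\<And>u. \<phi> u * exp (C * norm u) \<le> K * exp (- c * (norm u)^2)"
    using phi_exp_le[of c C] c by auto
  have "(\<integral>\<^sup>+u. ennreal (exp (C * norm u) * \<phi> u) \<partial>lborel) \<le> (\<integral>\<^sup>+u. ennreal K * ennreal (exp (- c * (norm (u::real^'d))^2)) \<partial>lborel)"
    using K by (intro nn_integral_mono) (auto simp: mult.commute simp flip: ennreal_mult intro!: ennreal_leI)
  also have "\<dots> = ennreal K * (\<integral>\<^sup>+u. ennreal (exp (- c * (norm (u::real^'d))^2)) \<partial>lborel)"
    by (rule nn_integral_cmult) auto
  also have "\<dots> < \<infinity>" using nn_integral_gaussian_finite[OF c(1)] by (auto simp: ennreal_mult_less_top)
  finally show ?thesis .
qed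

section \<open>The mixture likelihood of a drift law\<close>

lemma integrable_L:
  assumes "prob_space Q" and [measurable_cong]: "sets Q = sets borel"
  shows "integrable Q (\<lambda>b. L b z)"
proof -
  interpret prob_space Q by fact
  show ?thesis
    by (rule integrable_const_bound[where B="exp ((norm z)^2 / (2 * T))"])
       (use L_le_gaussian L_pos in \<open>auto intro!: AE_I2 simp: abs_of_pos\<close>)
qed

lemma G_measurable [measurable]:
  assumes "prob_space Q" and [measurable_cong]: "sets Q = sets borel"
  shows "G Q \<in> borel_measurable borel"
proof -
  interpret prob_space Q by fact
  show ?thesis unfolding G_def by measurable
qed

lemma nn_integral_L:
  assumes "prob_space Q" "sets Q = sets borel"
  shows "(\<integral>\<^sup>+b. ennreal (L b z) \<partial>Q) = ennreal (G Q z)"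
  unfolding G_def by (rule nn_integral_eq_integral[OF integrable_L[OF assms]]) (simp add: less_imp_le[OF L_pos])

lemma G_pos:
  assumes "prob_space Q" "sets Q = sets borel"
  shows "G Q z > 0"
proof -
  interpret prob_space Q by fact
  note assms(2)[measurable_cong]
  have "\<not> (AE b in Q. L b z \<le> 0)"
    using L_pos by (simp add: not_le[symmetric] del: not_le)
  moreover have "(\<integral>\<^sup>+b. ennreal (L b z) \<partial>Q) = 0 \<longleftrightarrow> (AE b in Q. ennreal (L b z) = 0)"
    by (rule nn_integral_0_iff_AE) measurable
  ultimately have "(\<integral>\<^sup>+b. ennreal (L b z) \<partial>Q) \<noteq> 0"
    by (simp add: ennreal_eq_0_iff)
  then show ?thesis by (simp add: nn_integral_L[OF assms] ennreal_eq_0_iff)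
qed

lemma Jfun_eq:
  assumes "prob_space Q" "sets Q = sets borel"
  shows "J Q = (\<integral>\<^sup>+z. ennreal (G Q z powr (1 + \<beta>) * \<phi> z) \<partial>lborel)"
  unfolding Jfun_def EQ_def nn_integral_L[OF assms] enn_powr_def
  using G_pos[OF assms] phi_pos
  by (intro nn_integral_cong) (simp add: beta ennreal_mult less_imp_le)

section \<open>Gradient of the likelihood in the drift\<close>

lemma L_has_derivative:
  "((\<lambda>b. L b z) has_derivative (\<lambda>v. (L b z *\<^sub>R adj (z - mean b)) \<bullet> v)) (at b)"
proof -
  have m: "(mpr has_derivative lin) (at b)"
    unfolding mpr_def matrix_vector_mult_diff_distrib
    by (auto intro!: derivative_eq_intros bounded_linear.has_derivative[of lin]
        simp: linear_conv_bounded_linear[symmetric])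
  show ?thesis unfolding L_eq[abs_def] power2_norm_eq_inner
    by (auto intro!: derivative_eq_intros m simp: fun_eq_iff inner_adj)
      (simp add: inner_simps inner_commute[of _ z] inner_commute[of "lin _" "mpr b"] algebra_simps)
qed

text \<open>\<open>grad\<close> picks its vector by definite description, so uniqueness of the
  Frechet derivative is needed besides its existence.\<close>

lemma grad_L: "grad (\<lambda>b. L b z) b = L b z *\<^sub>R adj (z - mean b)"
  unfolding grad_def
proof (rule the_equality)
  show "((\<lambda>b. L b z) has_derivative (\<lambda>v. (L b z *\<^sub>R adj (z - mean b)) \<bullet> v)) (at b)"
    by (rule L_has_derivative)
next
  fix D assume "((\<lambda>b. L b z) has_derivative (\<lambda>v. D \<bullet> v)) (at b)"
  from has_derivative_unique[OF this L_has_derivative]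
  show "D = L b z *\<^sub>R adj (z - mean b)"
    by (subst vector_eq_ldot[symmetric]) (auto simp: fun_eq_iff inner_commute)
qed

end

section \<open>The first variation and its gradient\<close>

lemma nn_integral_finite_if_square_finite:
  fixes f :: "'a \<Rightarrow> ennreal"
  assumes "finite_measure M" and [measurable]: "f \<in> borel_measurable M"
    and fin: "(\<integral>\<^sup>+x. (f x)^2 \<partial>M) < \<infinity>"
  shows "(\<integral>\<^sup>+x. f x \<partial>M) < \<infinity>"
proof -
  interpret finite_measure M by fact
  have "y \<le> 1 + y^2" for y :: ennreal
  proof (cases "y \<le> 1")
    case False
    then have "y * 1 \<le> y * y" by (intro mult_left_mono) auto
    then show ?thesis by (simp add: power2_eq_square) (metis add.commute add_increasing2 zero_le)
  qed (simp add: add_increasing2)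
  then have "(\<integral>\<^sup>+x. f x \<partial>M) \<le> (\<integral>\<^sup>+x. 1 + (f x)^2 \<partial>M)" by (intro nn_integral_mono) auto
  also have "\<dots> = emeasure M (space M) + (\<integral>\<^sup>+x. (f x)^2 \<partial>M)" by (subst nn_integral_add) auto
  also have "\<dots> < \<infinity>" using fin by (simp add: less_top[symmetric])
  finally show ?thesis .
qed

context drift_model
begin

text \<open>Up to the factor 1 + \<beta>, the derivative of x powr (1 + \<beta>) at x = G P0
  z.\<close>

definition w :: "real^'d \<Rightarrow> real" where
  "w z = G P0 z powr \<beta>"

text \<open>Weighted mass of \<open>w\<close> under the Gaussian centred at \<open>mean b\<close>.
  The factor \<open>exp (c * norm u)\<close> leaves room for what derivatives and Taylor remainders
  contribute.\<close>

abbreviation moment :: "real \<Rightarrow> real^'d \<Rightarrow> ennreal" where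
  "moment c b \<equiv> \<integral>\<^sup>+u. ennreal (exp (c * norm u) * (w (u + mean b) * \<phi> u)) \<partial>lborel"

abbreviation H :: "real^'d \<Rightarrow> real^'d" where "H \<equiv> Hfun T r \<sigma> \<alpha> P0"

lemmas integrable_L_P0 = integrable_L[OF P0_prob P0_sets]

lemmas G_P0_pos = G_pos[OF P0_prob P0_sets]

lemma G_P0_measurable [measurable]: "G P0 \<in> borel_measurable borel"
  by (rule G_measurable[OF P0_prob P0_sets])

lemma w_measurable [measurable]: "w \<in> borel_measurable borel"
  unfolding w_def by measurable

lemma w_pos: "w z > 0"
  using G_P0_pos[of z] by (simp add: w_def)

text \<open>The factor t on the right is the point: after division by t the bound is free of t, so
  it dominates all difference quotients at once, uniformly over bounded b and v.\<close>

lemma abs_L_diff_le: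
  assumes RK: "R \<ge> 0" "K \<ge> 0"
  obtains C c where "C \<ge> 0" "c \<ge> 0"
    "\<And>b v z t. norm b \<le> R \<Longrightarrow> norm v \<le> K \<Longrightarrow> 0 \<le> t \<Longrightarrow> t \<le> 1 \<Longrightarrow>
      \<bar>L (b + t *\<^sub>R v) z - L b z\<bar> \<le> t * (C * exp (c * norm z))"
proof
  define M where "M = norm (mpr 0) + nrm * R"
  define k where "k = nrm * K"
  define e where "e = k * T * M + T * k^2 / 2"
  have nn: "M \<ge> 0" "k \<ge> 0" "e \<ge> 0" using RK T_pos nrm_nonneg by (auto simp: M_def k_def e_def)
  \<comment> \<open>With \<open>E = k * norm z + e\<close>, one \<open>exp E\<close> pays for the
    linear factor E, a second one for \<open>exp \<bar>s\<bar>\<close>, and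
    \<open>exp (M * norm z)\<close> for the likelihood itself; these are the constants that
    result.\<close>
  show "exp (2 * e) \<ge> 0" "M + 2 * k \<ge> 0" using nn by auto
  fix b v z :: "real^'d" and t :: real assume a: "norm b \<le> R" "norm v \<le> K" "0 \<le> t" "t \<le> 1"
  have M: "norm (mpr b) \<le> M"
    using norm_mpr_le[of b] mult_left_mono[OF a(1) nrm_nonneg] by (simp add: M_def)
  have k: "norm (lin v) \<le> k"
    using norm_lin_le[of v] mult_left_mono[OF a(2) nrm_nonneg] by (simp add: k_def)
  define E where "E = k * norm z + e"
  have E: "E \<ge> 0" using nn by (simp add: E_def)
  define s where "s = lin (t *\<^sub>R v) \<bullet> (z - mean b) - T * (norm (lin (t *\<^sub>R v)))^2 / 2"
  have lin: "lin (t *\<^sub>R v) = t *\<^sub>R lin v" by (simp add: matrix_vector_mult_scaleR)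
  have "\<bar>lin v \<bullet> (z - mean b)\<bar> \<le> norm (lin v) * norm (z - mean b)" by (rule Cauchy_Schwarz_ineq2)
  also have "\<dots> \<le> k * (norm z + T * M)"
  proof (intro mult_mono k nn)
    have "norm (z - mean b) \<le> norm z + norm (mean b)" by (rule norm_triangle_ineq4)
    also have "\<dots> \<le> norm z + T * M" using T_pos M by simp
    finally show "norm (z - mean b) \<le> norm z + T * M" .
  qed simp
  finally have 1: "\<bar>lin v \<bullet> (z - mean b)\<bar> \<le> k * (norm z + T * M)" .
  have 2: "T * (t * norm (lin v))^2 / 2 \<le> t * (T * k^2 / 2)"
  proof -
    have "(t * norm (lin v))^2 = t^2 * (norm (lin v))^2" by (simp add: power_mult_distrib)
    also have "\<dots> \<le> t * k^2" using a k nn by (intro mult_mono power_mono) (auto simp: power2_eq_square mult_left_le)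
    finally show ?thesis using T_pos by simp
  qed
  have "\<bar>s\<bar> \<le> t * \<bar>lin v \<bullet> (z - mean b)\<bar> + T * (t * norm (lin v))^2 / 2"
  proof -
    have "s = t * (lin v \<bullet> (z - mean b)) - T * (t * norm (lin v))^2 / 2"
      by (simp add: s_def lin a)
    moreover have "T * (t * norm (lin v))^2 / 2 \<ge> 0" using T_pos by simp
    moreover have "\<bar>t * (lin v \<bullet> (z - mean b))\<bar> = t * \<bar>lin v \<bullet> (z - mean b)\<bar>" using a by (simp add: abs_mult)
    ultimately show ?thesis by linarith
  qed
  also have "\<dots> \<le> t * (k * (norm z + T * M)) + t * (T * k^2 / 2)"
    using 1 2 a by (intro add_mono mult_left_mono) auto
  also have "\<dots> = t * E" by (simp add: E_def e_def algebra_simps)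
  finally have s: "\<bar>s\<bar> \<le> t * E" .
  also have "\<dots> \<le> E" using a E by (simp add: mult_left_le_one_le)
  finally have s': "\<bar>s\<bar> \<le> E" .
  have "\<bar>L (b + t *\<^sub>R v) z - L b z\<bar> = L b z * \<bar>exp s - 1\<bar>"
  proof -
    have "L (b + t *\<^sub>R v) z - L b z = L b z * (exp s - 1)"
      unfolding L_add s_def[symmetric] by (simp add: algebra_simps)
    then show ?thesis using L_pos[of b z] by (simp add: abs_mult)
  qed
  also have "\<dots> \<le> exp (M * norm z) * (t * exp (2 * E))"
  proof (intro mult_mono)
    show "L b z \<le> exp (M * norm z)"
      using L_le_exp[of b z] mult_right_mono[OF M norm_ge_zero[of z]] by (meson exp_le_cancel_iff order_trans)
    have "\<bar>exp s - 1\<bar> \<le> \<bar>s\<bar> * exp \<bar>s\<bar>" by (rule abs_exp_minus_one_le)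
    also have "\<dots> \<le> (t * E) * exp E" using s s' a E by (intro mult_mono) auto
    also have "\<dots> \<le> (t * exp E) * exp E" using a E exp_ge_add_one_self[of E]
      by (intro mult_right_mono mult_left_mono) linarith+
    also have "\<dots> = t * exp (2 * E)" by (simp add: mult_exp_exp)
    finally show "\<bar>exp s - 1\<bar> \<le> t * exp (2 * E)" .
  qed auto
  also have "\<dots> = t * (exp (2 * e) * exp ((M + 2 * k) * norm z))"
    by (simp add: mult_exp_exp E_def algebra_simps)
  finally show "\<bar>L (b + t *\<^sub>R v) z - L b z\<bar> \<le> t * (exp (2 * e) * exp ((M + 2 * k) * norm z))" .
qed

lemma L_diff_quotient_tendsto:
  "((\<lambda>t. (L (b + t *\<^sub>R v) z - L b z) / t) \<longlongrightarrow> L b z * ((z - mean b) \<bullet> lin v)) (at_right 0)"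
proof -
  have "((\<lambda>t. L (b + t *\<^sub>R v) z) has_derivative (\<lambda>t. (L b z *\<^sub>R adj (z - mean b)) \<bullet> (t *\<^sub>R v))) (at 0)"
    using L_has_derivative[of z "b + 0 *\<^sub>R v"]
    by (intro has_derivative_compose[where f="\<lambda>t. b + t *\<^sub>R v" and g="\<lambda>b. L b z"])
      (auto intro!: derivative_eq_intros)
  then have "((\<lambda>t. L (b + t *\<^sub>R v) z) has_field_derivative (L b z * ((z - mean b) \<bullet> lin v))) (at 0)"
    unfolding has_field_derivative_def by (rule has_derivative_eq_rhs) (auto simp: fun_eq_iff inner_adj)
  then have "((\<lambda>t. (L (b + t *\<^sub>R v) z - L b z) / t) \<longlongrightarrow> L b z * ((z - mean b) \<bullet> lin v)) (at 0)"
    by (simp add: DERIV_def)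
  then show ?thesis by (rule filterlim_mono) (auto simp: at_within_le_at)
qed

lemma abs_grad_L_le: "L b z * norm (z - mean b) \<le> exp (T * norm (mpr b)) * exp ((norm (mpr b) + 1) * norm z)"
proof -
  have "norm (z - mean b) \<le> norm z + T * norm (mpr b)"
    using norm_triangle_ineq4[of z "mean b"] T_pos by simp
  also have "\<dots> \<le> exp (norm z + T * norm (mpr b))"
    using exp_ge_add_one_self[of "norm z + T * norm (mpr b)"] by linarith
  finally have "L b z * norm (z - mean b) \<le> exp (norm (mpr b) * norm z) * exp (norm z + T * norm (mpr b))"
    by (intro mult_mono L_le_exp) auto
  then show ?thesis by (simp add: mult_exp_exp algebra_simps)
qed

end

text \<open>Both signs of \<beta> share what follows from these two facts. The first lets
  derivatives pass under the integral in z; the second makes H square integrable, so that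
  \<open>N\<close> is a genuine L2 norm.\<close>

locale regular_drift_model = drift_model T r \<alpha> \<beta> \<sigma> P0
  for T r \<alpha> \<beta> :: real and \<sigma> :: "real^'d^'d" and P0 :: "(real^'d) measure" +
  assumes w_phi_exp: "\<And>C. (\<integral>\<^sup>+z. ennreal (exp (C * norm z) * (w z * \<phi> z)) \<partial>lborel) < \<infinity>"
    and w_phi_square: "(\<integral>\<^sup>+b. (moment 1 b)^2 \<partial>P0) < \<infinity>"
begin

definition \<omega> :: "real^'d \<Rightarrow> real" where "\<omega> z = w z * \<phi> z"

text \<open>Up to the factor 1 + \<beta>, this is the first variation of J at P0.\<close>
definition pot :: "real^'d \<Rightarrow> real" where "pot b = (\<integral>z. L b z * \<omega> z \<partial>lborel)"

lemma \<omega>_measurable [measurable]: "\<omega> \<in> borel_measurable borel"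
  unfolding \<omega>_def by measurable

lemma \<omega>_pos: "\<omega> z > 0"
  by (simp add: \<omega>_def w_pos phi_pos)

lemma integrable_exp_\<omega>: "integrable lborel (\<lambda>z. exp (C * norm z) * \<omega> z)"
  using w_phi_exp[of C] \<omega>_pos
  by (intro integrableI_nonneg) (auto simp: \<omega>_def less_imp_le)

lemma integrable_times_\<omega>:
  fixes f :: "real^'d \<Rightarrow> real"
  assumes [measurable]: "f \<in> borel_measurable borel" and "\<And>z. \<bar>f z\<bar> \<le> C * exp (c * norm z)"
  shows "integrable lborel (\<lambda>z. f z * \<omega> z)"
proof (rule Bochner_Integration.integrable_bound)
  show "integrable lborel (\<lambda>z. C * (exp (c * norm z) * \<omega> z))" by (intro integrable_mult_right integrable_exp_\<omega>)
  show "AE z in lborel. norm (f z * \<omega> z) \<le> norm (C * (exp (c * norm z) * \<omega> z))"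
  proof (intro AE_I2)
    fix z
    have "norm (f z * \<omega> z) \<le> C * exp (c * norm z) * \<omega> z"
      using assms(2)[of z] \<omega>_pos[of z] by (simp add: abs_mult abs_of_pos)
    then show "norm (f z * \<omega> z) \<le> norm (C * (exp (c * norm z) * \<omega> z))" by (simp add: mult.assoc)
  qed
qed measurable

lemma integrable_L_\<omega>: "integrable lborel (\<lambda>z. L b z * \<omega> z)"
  by (rule integrable_times_\<omega>[where C=1 and c="norm (mpr b)"]) (use L_le_exp L_pos in \<open>auto simp: abs_of_pos\<close>)

lemma nn_integral_L_\<omega>: "(\<integral>\<^sup>+z. ennreal (L b z * \<omega> z) \<partial>lborel) = ennreal (pot b)"
  unfolding pot_def using L_pos \<omega>_pos by (intro nn_integral_eq_integral integrable_L_\<omega>) (auto simp: less_imp_le)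

text \<open>In this form b enters only through the affine shift \<open>mean b\<close> in the
  argument of \<open>w\<close>, so convexity of \<open>w\<close> carries over to
  \<open>pot\<close>.\<close>

lemma pot_shift: "ennreal (pot b) = (\<integral>\<^sup>+u. ennreal (w (u + mean b) * \<phi> u) \<partial>lborel)"
proof -
  have "ennreal (pot b) = (\<integral>\<^sup>+z. ennreal (w z) * ennreal (L b z * \<phi> z) \<partial>lborel)"
    unfolding nn_integral_L_\<omega>[symmetric] \<omega>_def
    using w_pos phi_pos L_pos by (intro nn_integral_cong) (simp add: ennreal_mult[symmetric] less_imp_le mult_ac)
  also have "\<dots> = (\<integral>\<^sup>+u. ennreal (w (u + mean b)) * ennreal (\<phi> u) \<partial>lborel)"
    by (rule nn_integral_L_phi) simp
  finally show ?thesis using w_pos phi_pos by (simp add: ennreal_mult less_imp_le)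
qed

lemma pot_measurable [measurable]: "pot \<in> borel_measurable borel"
  unfolding pot_def by measurable

lemma pot_nonneg: "pot b \<ge> 0"
  unfolding pot_def using L_pos \<omega>_pos by (intro integral_nonneg_AE) (auto simp: less_imp_le)

lemma H_eq: "H b = (1 + \<beta>) *\<^sub>R (\<integral>z. (L b z * \<omega> z) *\<^sub>R adj (z - mean b) \<partial>lborel)"
  unfolding Hfun_def grad_L G_def[symmetric] beta_eq[symmetric] w_def[symmetric] beta \<omega>_def
  by (simp add: mult_ac)

lemma H_measurable [measurable]: "H \<in> borel_measurable borel"
  unfolding H_eq[abs_def] by measurable

lemma integrable_grad: "integrable lborel (\<lambda>z. (L b z * \<omega> z) *\<^sub>R adj (z - mean b))"
proof (rule Bochner_Integration.integrable_bound)
  show "integrable lborel (\<lambda>z. (nrm * (L b z * norm (z - mean b))) * \<omega> z)"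
  proof (rule integrable_times_\<omega>)
    fix z show "\<bar>nrm * (L b z * norm (z - mean b))\<bar> \<le> (nrm * exp (T * norm (mpr b))) * exp ((norm (mpr b) + 1) * norm z)"
      using mult_left_mono[OF abs_grad_L_le[of b z] nrm_nonneg] L_pos[of b z] nrm_nonneg
      by (simp add: abs_mult abs_of_pos mult.assoc)
  qed measurable
  show "AE z in lborel. norm ((L b z * \<omega> z) *\<^sub>R adj (z - mean b)) \<le> norm ((nrm * (L b z * norm (z - mean b))) * \<omega> z)"
  proof (intro AE_I2)
    fix z
    have "L b z * \<omega> z * norm (adj (z - mean b)) \<le> L b z * \<omega> z * (nrm * norm (z - mean b))"
      using L_pos[of b z] \<omega>_pos[of z] by (intro mult_left_mono norm_adj_le) auto
    then show "norm ((L b z * \<omega> z) *\<^sub>R adj (z - mean b)) \<le> norm ((nrm * (L b z * norm (z - mean b))) * \<omega> z)"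
      using L_pos[of b z] \<omega>_pos[of z] nrm_nonneg by (simp add: abs_mult abs_of_pos mult_ac)
  qed
qed measurable

lemma H_inner: "H b \<bullet> v = (1 + \<beta>) * (\<integral>z. L b z * ((z - mean b) \<bullet> lin v) * \<omega> z \<partial>lborel)"
  unfolding H_eq inner_scaleR_left integral_inner_left[OF integrable_grad, symmetric]
  by (simp add: inner_adj mult_ac)

text \<open>Dominated convergence identifies H as the gradient of (1 + \<beta>) times
  \<open>pot\<close> along rays. A one-sided limit is enough for the subgradient inequality.\<close>

lemma pot_diff_quotient_tendsto:
  "((\<lambda>t. (pot (b + t *\<^sub>R v) - pot b) / t) \<longlongrightarrow> (H b \<bullet> v) / (1 + \<beta>)) (at_right 0)"
proof (rule tendsto_at_right_sequentially[of 0 1])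
  fix S :: "nat \<Rightarrow> real" assume S: "\<And>n. 0 < S n" "\<And>n. S n < 1" "S \<longlonglongrightarrow> 0"
  have S': "filterlim S (at_right 0) sequentially"
    using S by (intro filterlim_at_withinI) (auto intro!: always_eventually)
  obtain C c where C: "C \<ge> 0" "c \<ge> 0" "\<And>z t. 0 \<le> t \<Longrightarrow> t \<le> 1 \<Longrightarrow>
      \<bar>L (b + t *\<^sub>R v) z - L b z\<bar> \<le> t * (C * exp (c * norm z))"
    using abs_L_diff_le[of "norm b" "norm v"] by (metis norm_ge_zero order_refl)
  have "(\<lambda>n. (\<integral>z. ((L (b + S n *\<^sub>R v) z - L b z) / S n) * \<omega> z \<partial>lborel)) \<longlonglongrightarrow> (\<integral>z. L b z * ((z - mean b) \<bullet> lin v) * \<omega> z \<partial>lborel)"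
  proof (rule integral_dominated_convergence)
    show "integrable lborel (\<lambda>z. C * exp (c * norm z) * \<omega> z)"
      by (rule integrable_times_\<omega>[of _ C c]) (use C in auto)
    show "AE z in lborel. (\<lambda>n. ((L (b + S n *\<^sub>R v) z - L b z) / S n) * \<omega> z) \<longlonglongrightarrow> L b z * ((z - mean b) \<bullet> lin v) * \<omega> z"
      by (intro AE_I2 tendsto_mult_right filterlim_compose[OF L_diff_quotient_tendsto S'])
    fix n
    show "AE z in lborel. norm (((L (b + S n *\<^sub>R v) z - L b z) / S n) * \<omega> z) \<le> C * exp (c * norm z) * \<omega> z"
    proof (intro AE_I2)
      fix z
      have *: "\<bar>(L (b + S n *\<^sub>R v) z - L b z) / S n\<bar> \<le> C * exp (c * norm z)"
        using C(3)[of "S n" z] S(1,2)[of n] by (simp add: abs_divide divide_le_eq mult.commute)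
      then show "norm (((L (b + S n *\<^sub>R v) z - L b z) / S n) * \<omega> z) \<le> C * exp (c * norm z) * \<omega> z"
        using mult_right_mono[OF * less_imp_le[OF \<omega>_pos[of z]]] \<omega>_pos[of z] by (simp add: abs_mult)
    qed
  qed measurable
  moreover have "(\<integral>z. ((L (b + S n *\<^sub>R v) z - L b z) / S n) * \<omega> z \<partial>lborel) = (pot (b + S n *\<^sub>R v) - pot b) / S n" for n
    unfolding pot_def by (subst Bochner_Integration.integral_diff[OF integrable_L_\<omega> integrable_L_\<omega>, symmetric])
      (simp add: algebra_simps flip: integral_divide_zero)
  moreover have "(H b \<bullet> v) / (1 + \<beta>) = (\<integral>z. L b z * ((z - mean b) \<bullet> lin v) * \<omega> z \<partial>lborel)"
    using beta(2) by (simp add: H_inner)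
  ultimately show "(\<lambda>n. (pot (b + S n *\<^sub>R v) - pot b) / S n) \<longlonglongrightarrow> (H b \<bullet> v) / (1 + \<beta>)"
    by (simp only:)
qed simp

text \<open>This is \<open>moment 1\<close> under a name of its own: 1 \<le> exp (norm u) lets it
  dominate \<open>pot\<close>, and norm u \<le> exp (norm u) lets it dominate the norm of H up to a
  constant.\<close>

definition majorant :: "real^'d \<Rightarrow> ennreal" where
  "majorant b = (\<integral>\<^sup>+u. ennreal (exp (norm u) * (w (u + mean b) * \<phi> u)) \<partial>lborel)"

lemma majorant_measurable [measurable]: "majorant \<in> borel_measurable borel"
  unfolding majorant_def by measurable

lemma majorant_square: "(\<integral>\<^sup>+b. (majorant b)^2 \<partial>P0) < \<infinity>"
  using w_phi_square by (simp add: majorant_def)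

lemma majorant_finite: "(\<integral>\<^sup>+b. majorant b \<partial>P0) < \<infinity>"
  by (rule nn_integral_finite_if_square_finite[OF prob_space.axioms(1)[OF P0_prob] _ majorant_square]) measurable

lemma pot_le_majorant: "ennreal (pot b) \<le> majorant b"
  unfolding pot_shift majorant_def
proof (intro nn_integral_mono ennreal_leI)
  fix u
  have "1 * (w (u + mean b) * \<phi> u) \<le> exp (norm u) * (w (u + mean b) * \<phi> u)"
    using w_pos[of "u + mean b"] phi_pos[of u] by (intro mult_right_mono) auto
  then show "w (u + mean b) * \<phi> u \<le> exp (norm u) * (w (u + mean b) * \<phi> u)" by simp
qed

lemma norm_H_le_majorant: "ennreal (norm (H b)) \<le> ennreal ((1 + \<beta>) * nrm) * majorant b"
proof -
  have "ennreal (norm (\<integral>z. (L b z * \<omega> z) *\<^sub>R adj (z - mean b) \<partial>lborel))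
      \<le> (\<integral>\<^sup>+z. ennreal (norm ((L b z * \<omega> z) *\<^sub>R adj (z - mean b))) \<partial>lborel)"
    by (rule integral_norm_bound_ennreal[OF integrable_grad])
  also have "\<dots> \<le> (\<integral>\<^sup>+z. (ennreal nrm * ennreal (norm (z - mean b) * w z)) * ennreal (L b z * \<phi> z) \<partial>lborel)"
  proof (rule nn_integral_mono)
    fix z
    have "L b z * \<omega> z * norm (adj (z - mean b)) \<le> L b z * \<omega> z * (nrm * norm (z - mean b))"
      using L_pos[of b z] \<omega>_pos[of z] by (intro mult_left_mono norm_adj_le) auto
    then show "ennreal (norm ((L b z * \<omega> z) *\<^sub>R adj (z - mean b))) \<le> (ennreal nrm * ennreal (norm (z - mean b) * w z)) * ennreal (L b z * \<phi> z)"
      using L_pos[of b z] \<omega>_pos[of z] nrm_nonneg w_pos[of z] phi_pos[of z]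
      by (simp add: abs_mult abs_of_pos mult_ac \<omega>_def flip: ennreal_mult)
  qed
  also have "\<dots> = (\<integral>\<^sup>+u. (ennreal nrm * ennreal (norm u * w (u + mean b))) * ennreal (\<phi> u) \<partial>lborel)"
    by (subst nn_integral_L_phi) auto
  also have "\<dots> \<le> (\<integral>\<^sup>+u. ennreal nrm * ennreal (exp (norm u) * (w (u + mean b) * \<phi> u)) \<partial>lborel)"
  proof (rule nn_integral_mono)
    fix u :: "real^'d"
    have "norm u \<le> exp (norm u)" using exp_ge_add_one_self[of "norm u"] by linarith
    then have "norm u * (w (u + mean b) * \<phi> u) \<le> exp (norm u) * (w (u + mean b) * \<phi> u)"
      using w_pos[of "u + mean b"] phi_pos[of u] by (intro mult_right_mono) auto
    then show "(ennreal nrm * ennreal (norm u * w (u + mean b))) * ennreal (\<phi> u) \<le> ennreal nrm * ennreal (exp (norm u) * (w (u + mean b) * \<phi> u))"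
      using w_pos[of "u + mean b"] phi_pos[of u] nrm_nonneg
      by (simp add: ennreal_mult[symmetric] mult.assoc less_imp_le mult_left_mono)
  qed
  also have "\<dots> = ennreal nrm * majorant b" unfolding majorant_def by (rule nn_integral_cmult) measurable
  finally have "ennreal (1 + \<beta>) * ennreal (norm (\<integral>z. (L b z * \<omega> z) *\<^sub>R adj (z - mean b) \<partial>lborel))
     \<le> ennreal (1 + \<beta>) * (ennreal nrm * majorant b)" by (rule mult_left_mono) simp
  then show ?thesis using beta(2) nrm_nonneg by (simp add: H_eq ennreal_mult mult.assoc less_imp_le)
qed

lemma H_square_integrable: "integrable P0 (\<lambda>b. (norm (H b))^2)"
proof (rule integrableI_bounded)
  have "(\<integral>\<^sup>+b. ennreal (norm ((norm (H b))^2)) \<partial>P0) \<le> (\<integral>\<^sup>+b. (ennreal ((1 + \<beta>) * nrm))^2 * (majorant b)^2 \<partial>P0)"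
  proof (rule nn_integral_mono)
    fix b
    have "(ennreal (norm (H b)))^2 \<le> (ennreal ((1 + \<beta>) * nrm) * majorant b)^2"
      by (rule power_mono[OF norm_H_le_majorant]) simp
    then show "ennreal (norm ((norm (H b))^2)) \<le> (ennreal ((1 + \<beta>) * nrm))^2 * (majorant b)^2"
      by (simp add: ennreal_power[symmetric] power_mult_distrib)
  qed
  also have "\<dots> = (ennreal ((1 + \<beta>) * nrm))^2 * (\<integral>\<^sup>+b. (majorant b)^2 \<partial>P0)"
    by (rule nn_integral_cmult) measurable
  also have "\<dots> < \<infinity>" using majorant_square by (auto simp: ennreal_mult_less_top power_less_top_ennreal)
  finally show "(\<integral>\<^sup>+b. ennreal (norm ((norm (H b))^2)) \<partial>P0) < \<infinity>" .
qed measurable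

lemma pot_integrable: "integrable P0 pot"
proof (rule integrableI_bounded)
  have "(\<integral>\<^sup>+b. ennreal (norm (pot b)) \<partial>P0) \<le> (\<integral>\<^sup>+b. majorant b \<partial>P0)"
    using pot_le_majorant pot_nonneg by (intro nn_integral_mono) simp
  then show "(\<integral>\<^sup>+b. ennreal (norm (pot b)) \<partial>P0) < \<infinity>" using majorant_finite by (rule le_less_trans)
qed measurable

text \<open>Tonelli: the left side is linear in Q, hence the mean of a function of the drift
  alone.\<close>

lemma nn_integral_G_\<omega>:
  assumes "prob_space Q" and Q [measurable_cong]: "sets Q = sets borel"
  shows "(\<integral>\<^sup>+z. ennreal (G Q z * \<omega> z) \<partial>lborel) = (\<integral>\<^sup>+b. ennreal (pot b) \<partial>Q)"
proof -
  interpret prob_space Q by fact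
  interpret pair_sigma_finite Q lborel ..
  have "(\<integral>\<^sup>+z. ennreal (G Q z * \<omega> z) \<partial>lborel) = (\<integral>\<^sup>+z. (\<integral>\<^sup>+b. ennreal (L b z * \<omega> z) \<partial>Q) \<partial>lborel)"
    using L_pos \<omega>_pos G_pos[OF assms]
    by (intro nn_integral_cong) (simp add: ennreal_mult less_imp_le nn_integral_multc nn_integral_L[OF assms])
  also have "\<dots> = (\<integral>\<^sup>+b. (\<integral>\<^sup>+z. ennreal (L b z * \<omega> z) \<partial>lborel) \<partial>Q)"
    by (rule Fubini') measurable
  finally show ?thesis by (simp add: nn_integral_L_\<omega>)
qed

text \<open>The power x powr (1 + \<beta>) splits into x times the weight \<open>w\<close>, so J at
  P0 is itself a mean of \<open>pot\<close>, and in particular finite.\<close>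

lemma Jfun_P0: "J P0 = ennreal (\<integral>b. pot b \<partial>P0)"
proof -
  have "J P0 = (\<integral>\<^sup>+z. ennreal (G P0 z * \<omega> z) \<partial>lborel)"
    unfolding Jfun_eq[OF P0_prob P0_sets] \<omega>_def w_def using G_P0_pos
    by (simp add: powr_add mult_ac less_imp_le)
  also have "\<dots> = (\<integral>\<^sup>+b. ennreal (pot b) \<partial>P0)" by (rule nn_integral_G_\<omega>[OF P0_prob P0_sets])
  also have "\<dots> = ennreal (\<integral>b. pot b \<partial>P0)" using pot_nonneg by (intro nn_integral_eq_integral pot_integrable) auto
  finally show ?thesis .
qed

end

section \<open>Lower bound for nonnegative exponents\<close>

text \<open>The integral of (t f - g)^2 is a nonnegative quadratic in t, which bounds its
  discriminant.\<close>

lemma integral_Cauchy_Schwarz: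
  fixes f g :: "'a \<Rightarrow> real"
  assumes [measurable]: "f \<in> borel_measurable M" "g \<in> borel_measurable M"
    and f: "integrable M (\<lambda>x. (f x)^2)" and g: "integrable M (\<lambda>x. (g x)^2)"
  shows "integrable M (\<lambda>x. f x * g x)"
    and "\<bar>\<integral>x. f x * g x \<partial>M\<bar> \<le> sqrt (\<integral>x. (f x)^2 \<partial>M) * sqrt (\<integral>x. (g x)^2 \<partial>M)"
proof -
  have bd: "\<bar>f x * g x\<bar> \<le> (f x)^2 + (g x)^2" for x
  proof -
    have "0 \<le> (\<bar>f x\<bar> - \<bar>g x\<bar>)^2 + (f x)^2 + (g x)^2" by simp
    then show ?thesis by (simp add: power2_diff abs_mult)
  qed
  show fg: "integrable M (\<lambda>x. f x * g x)"
    by (rule Bochner_Integration.integrable_bound[OF Bochner_Integration.integrable_add[OF f g]])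
       (use bd in \<open>auto intro!: AE_I2\<close>)
  define a b c where "a = (\<integral>x. (f x)^2 \<partial>M)" and "b = (\<integral>x. (g x)^2 \<partial>M)" and "c = (\<integral>x. f x * g x \<partial>M)"
  have nn: "a \<ge> 0" "b \<ge> 0" by (auto simp: a_def b_def)
  have q: "0 \<le> t^2 * a - 2 * t * c + b" for t
  proof -
    have "0 \<le> (\<integral>x. (t * f x - g x)^2 \<partial>M)" by simp
    also have "\<dots> = (\<integral>x. t^2 * (f x)^2 - 2 * t * (f x * g x) + (g x)^2 \<partial>M)"
      by (intro Bochner_Integration.integral_cong) (auto simp: power2_eq_square algebra_simps)
    also have "\<dots> = t^2 * a - 2 * t * c + b" using f g fg by (simp add: a_def b_def c_def)
    finally show ?thesis .
  qed
  have "c^2 \<le> a * b"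
  proof (cases "a = 0")
    case True
    have "c = 0"
    proof (rule ccontr)
      assume "c \<noteq> 0"
      \<comment> \<open>For a = 0 the quadratic degenerates to a linear function of t, and at this t
        its value is -1.\<close>
      with q[of "(b + 1) / (2 * c)"] True show False by simp
    qed
    with True show ?thesis by simp
  next
    case False
    with q[of "c / a"] have "0 \<le> b - c^2 / a" by (simp add: power2_eq_square field_simps)
    with False nn show ?thesis by (simp add: field_simps)
  qed
  then have "\<bar>c\<bar> \<le> sqrt (a * b)" by (metis real_sqrt_le_iff real_sqrt_abs)
  then show "\<bar>\<integral>x. f x * g x \<partial>M\<bar> \<le> sqrt (\<integral>x. (f x)^2 \<partial>M) * sqrt (\<integral>x. (g x)^2 \<partial>M)"
    by (simp add: a_def b_def c_def real_sqrt_mult)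
qed

text \<open>Equivalent to x / 2 \<le> sinh (x / 2). It leaves half of the exponent of the transport
  cost free to absorb exponential growth.\<close>

lemma le_exp_minus_one: "x * exp (x / 2) \<le> exp x - 1" if "x \<ge> 0" for x :: real
proof -
  have "x / 2 \<le> sinh (x / 2)"
  proof (cases "x = 0")
    case False
    have "\<exists>\<xi>. 0 < \<xi> \<and> \<xi> < x / 2 \<and> sinh (x / 2) - sinh 0 = (x / 2 - 0) * cosh \<xi>"
      using that False by (intro MVT2) (auto intro!: derivative_eq_intros)
    then obtain \<xi> where "sinh (x / 2) = x / 2 * cosh \<xi>" by auto
    then show ?thesis using that cosh_real_ge_1[of \<xi>] by (simp add: mult_le_cancel_left1)
  qed simp
  then have "x \<le> exp (x / 2) - exp (- (x / 2))" by (simp add: sinh_def)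
  then have "x * exp (x / 2) \<le> (exp (x / 2) - exp (- (x / 2))) * exp (x / 2)" by (intro mult_right_mono) auto
  also have "\<dots> = exp x - 1" by (simp add: algebra_simps mult_exp_exp)
  finally show ?thesis .
qed

text \<open>The tangent of the convex x powr (1 + \<beta>) at g lies below the graph. The form
  without subtraction can be integrated in \<open>ennreal\<close>, and Young's inequality with
  weights 1 / (1 + \<beta>) and \<beta> / (1 + \<beta>) proves it, including \<beta> = 0.\<close>

lemma powr_tangent_le:
  fixes x g \<beta> :: real
  assumes pos: "x > 0" "g > 0" and \<beta>: "\<beta> \<ge> 0"
  shows "(1 + \<beta>) * (x * g powr \<beta>) \<le> x powr (1 + \<beta>) + \<beta> * g powr (1 + \<beta>)"
proof -
  have "(x powr (1 + \<beta>)) powr (1 / (1 + \<beta>)) * (g powr (1 + \<beta>)) powr (\<beta> / (1 + \<beta>))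
      \<le> 1 / (1 + \<beta>) * x powr (1 + \<beta>) + \<beta> / (1 + \<beta>) * g powr (1 + \<beta>)"
    using pos \<beta> by (intro Youngs_inequality_0) (auto simp: field_simps)
  then have "x * g powr \<beta> \<le> (x powr (1 + \<beta>) + \<beta> * g powr (1 + \<beta>)) / (1 + \<beta>)"
    using pos \<beta> by (simp add: powr_powr add_divide_distrib)
  then show ?thesis using \<beta> by (simp add: field_simps)
qed

section \<open>Couplings and their transport cost\<close>

lemma couplingsD:
  assumes "\<pi> \<in> couplings \<mu> \<nu>"
  shows "prob_space \<pi>" "sets \<pi> = sets (borel \<Otimes>\<^sub>M borel)" "distr \<pi> borel fst = \<mu>" "distr \<pi> borel snd = \<nu>"
  using assms by (auto simp: couplings_def)

abbreviation cost :: "real \<Rightarrow> ('a::euclidean_space \<times> 'a) measure \<Rightarrow> ennreal" where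
  "cost \<tau> \<pi> \<equiv> \<integral>\<^sup>+p. ennreal (ctau \<tau> (fst p) (snd p)) \<partial>\<pi>"

text \<open>The inequality exp y - 1 \<ge> y turns the exponential budget into an L2 budget; this is
  the origin of the ratio \<delta> / \<tau>.\<close>

lemma coupling_second_moment:
  fixes \<pi> :: "('a::euclidean_space \<times> 'a) measure"
  assumes "\<tau> > 0" "\<eta> \<ge> 0" and sets_\<pi> [measurable_cong]: "sets \<pi> = sets (borel \<Otimes>\<^sub>M borel)"
    and cost: "cost \<tau> \<pi> \<le> ennreal \<eta>"
  shows "integrable \<pi> (\<lambda>p. (norm (fst p - snd p))^2)" "(\<integral>p. (norm (fst p - snd p))^2 \<partial>\<pi>) \<le> \<eta> / \<tau>"
proof -
  have "ennreal \<tau> * (\<integral>\<^sup>+p. ennreal ((norm (fst p - snd p))^2) \<partial>\<pi>) = (\<integral>\<^sup>+p. ennreal (\<tau> * (norm (fst p - snd p))^2) \<partial>\<pi>)"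
    using assms(1) by (subst nn_integral_cmult[symmetric]) (auto simp: ennreal_mult)
  also have "\<dots> \<le> cost \<tau> \<pi>"
  proof (intro nn_integral_mono ennreal_leI)
    fix p :: "'a \<times> 'a"
    show "\<tau> * (norm (fst p - snd p))^2 \<le> ctau \<tau> (fst p) (snd p)"
      using exp_ge_add_one_self[of "\<tau> * (norm (fst p - snd p))^2"] unfolding ctau_def by linarith
  qed
  also note cost
  finally have 1: "ennreal \<tau> * (\<integral>\<^sup>+p. ennreal ((norm (fst p - snd p))^2) \<partial>\<pi>) \<le> ennreal \<eta>" .
  then have fin: "(\<integral>\<^sup>+p. ennreal ((norm (fst p - snd p))^2) \<partial>\<pi>) < \<infinity>"
    using assms(1) by (auto simp: ennreal_mult_less_top less_top[symmetric] top_unique ennreal_mult_eq_top_iff)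
  show i: "integrable \<pi> (\<lambda>p. (norm (fst p - snd p))^2)"
    by (rule integrableI_nonneg) (use fin in auto)
  from 1 have "\<tau> * (\<integral>p. (norm (fst p - snd p))^2 \<partial>\<pi>) \<le> \<eta>"
    using assms(1,2) by (simp add: nn_integral_eq_integral[OF i] ennreal_mult[symmetric])
  then show "(\<integral>p. (norm (fst p - snd p))^2 \<partial>\<pi>) \<le> \<eta> / \<tau>"
    using assms(1) by (simp add: field_simps)
qed

text \<open>Existence of an optimal coupling is avoided by enlarging the budget to some \<eta> >
  \<delta>; its users let \<eta> tend to \<delta> afterwards.\<close>

lemma UsetE:
  assumes "Q \<in> Uset \<tau> P \<delta>" "\<delta> \<ge> 0" "\<eta> > \<delta>"
  obtains \<pi> where "\<pi> \<in> couplings Q P" "cost \<tau> \<pi> \<le> ennreal \<eta>"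
proof -
  have "Dc (ctau \<tau>) Q P < ennreal \<eta>"
    using assms by (auto simp: Uset_def intro!: le_less_trans[of _ "ennreal \<delta>"] ennreal_lessI)
  then show ?thesis using that unfolding Dc_def INF_less_iff by (meson less_imp_le)
qed

section \<open>Convexity of the weight and of the first variation\<close>

context drift_model
begin

text \<open>Hoelder's inequality, as the likelihood is log-affine in z. It is obtained by
  normalising both factors and integrating Young's inequality pointwise.\<close>

lemma G_log_convex:
  assumes t: "0 \<le> t" "t \<le> 1"
  shows "G P0 ((1 - t) *\<^sub>R x + t *\<^sub>R y) \<le> G P0 x powr (1 - t) * G P0 y powr t"
proof -
  note int = integrable_L_P0
  define a c where "a = G P0 x" and "c = G P0 y"
  have pos: "a > 0" "c > 0" by (auto simp: a_def c_def G_P0_pos)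
  define q where "q = a powr (1 - t) * c powr t"
  have "q > 0" using pos by (simp add: q_def)
  have le: "L b ((1 - t) *\<^sub>R x + t *\<^sub>R y) \<le> q * ((1 - t) / a * L b x + t / c * L b y)" for b
  proof -
    have "L b ((1 - t) *\<^sub>R x + t *\<^sub>R y) = L b x powr (1 - t) * L b y powr t"
      unfolding L_eq exp_powr_real mult_exp_exp by (simp add: inner_simps field_simps)
    also have "\<dots> = q * ((L b x / a) powr (1 - t) * (L b y / c) powr t)"
      using pos L_pos[of b] by (simp add: q_def powr_divide less_imp_le)
    also have "\<dots> \<le> q * ((1 - t) * (L b x / a) + t * (L b y / c))"
      using pos L_pos[of b] t \<open>q > 0\<close> by (intro mult_left_mono Youngs_inequality_0) auto
    finally show ?thesis by simp
  qed
  have "G P0 ((1 - t) *\<^sub>R x + t *\<^sub>R y) \<le> (\<integral>b. q * ((1 - t) / a * L b x + t / c * L b y) \<partial>P0)"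
    unfolding G_def by (intro integral_mono int) (use le int in auto)
  also have "\<dots> = q * ((1 - t) / a * a + t / c * c)"
    using int by (simp add: a_def c_def G_def)
  also have "\<dots> = q" using pos by simp
  finally show ?thesis by (simp add: q_def a_def c_def)
qed

text \<open>A nonnegative power keeps log-convexity, and a weighted geometric mean lies below the
  arithmetic one.\<close>

lemma w_convex:
  assumes t: "0 \<le> t" "t \<le> 1" and "\<beta> \<ge> 0"
  shows "w ((1 - t) *\<^sub>R x + t *\<^sub>R y) \<le> (1 - t) * w x + t * w y"
proof -
  have pos: "G P0 z > 0" for z by (rule G_P0_pos)
  have "w ((1 - t) *\<^sub>R x + t *\<^sub>R y) \<le> (G P0 x powr (1 - t) * G P0 y powr t) powr \<beta>"
    unfolding w_def using pos assms by (intro powr_mono2 G_log_convex) (auto simp: less_imp_le)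
  also have "\<dots> = w x powr (1 - t) * w y powr t"
    using pos unfolding w_def by (simp add: powr_mult powr_powr mult_ac less_imp_le)
  also have "\<dots> \<le> (1 - t) * w x + t * w y"
    using t w_pos by (intro Youngs_inequality_0) auto
  finally show ?thesis .
qed

end

context regular_drift_model
begin

lemma pot_convex:
  assumes t: "0 \<le> t" "t \<le> 1" and "\<beta> \<ge> 0"
  shows "pot (b + t *\<^sub>R v) \<le> (1 - t) * pot b + t * pot (b + v)"
proof -
  have "ennreal (pot (b + t *\<^sub>R v)) = (\<integral>\<^sup>+u. ennreal (w (u + mean (b + t *\<^sub>R v)) * \<phi> u) \<partial>lborel)"
    by (rule pot_shift)
  also have "\<dots> \<le> (\<integral>\<^sup>+u. ennreal (1 - t) * ennreal (w (u + mean b) * \<phi> u)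
      + ennreal t * ennreal (w (u + mean (b + v)) * \<phi> u) \<partial>lborel)"
  proof (rule nn_integral_mono)
    fix u :: "real^'d"
    have eq: "u + mean (b + t *\<^sub>R v) = (1 - t) *\<^sub>R (u + mean b) + t *\<^sub>R (u + mean (b + v))"
      by (simp add: mpr_add matrix_vector_mult_scaleR algebra_simps)
    have "w (u + mean (b + t *\<^sub>R v)) * \<phi> u \<le> ((1 - t) * w (u + mean b) + t * w (u + mean (b + v))) * \<phi> u"
      unfolding eq using phi_pos[of u] by (intro mult_right_mono w_convex assms) auto
    then have "w (u + mean (b + t *\<^sub>R v)) * \<phi> u \<le> (1 - t) * (w (u + mean b) * \<phi> u) + t * (w (u + mean (b + v)) * \<phi> u)"
      by (simp add: algebra_simps)
    then show "ennreal (w (u + mean (b + t *\<^sub>R v)) * \<phi> u) \<le> ennreal (1 - t) * ennreal (w (u + mean b) * \<phi> u)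
      + ennreal t * ennreal (w (u + mean (b + v)) * \<phi> u)"
      using t w_pos phi_pos by (simp add: ennreal_mult[symmetric] ennreal_plus[symmetric] less_imp_le del: ennreal_plus)
  qed
  also have "\<dots> = ennreal (1 - t) * ennreal (pot b) + ennreal t * ennreal (pot (b + v))"
    unfolding pot_shift by (subst nn_integral_add) (auto simp: nn_integral_cmult)
  also have "\<dots> = ennreal ((1 - t) * pot b + t * pot (b + v))"
    using t pot_nonneg by (simp add: ennreal_mult)
  finally show ?thesis using t pot_nonneg by (subst (asm) ennreal_le_iff) (auto intro!: add_nonneg_nonneg)
qed

text \<open>By convexity the difference quotients for 0 < t < 1 stay below the one at t = 1, and so
  does their limit.\<close>

lemma pot_subgradient:
  assumes "\<beta> \<ge> 0"
  shows "pot b + (H b \<bullet> v) / (1 + \<beta>) \<le> pot (b + v)"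
proof -
  have "(H b \<bullet> v) / (1 + \<beta>) \<le> pot (b + v) - pot b"
  proof (rule tendsto_upperbound[OF pot_diff_quotient_tendsto])
    show "\<forall>\<^sub>F t in at_right 0. (pot (b + t *\<^sub>R v) - pot b) / t \<le> pot (b + v) - pot b"
      using eventually_at_right_real[of 0 1]
    proof (rule eventually_mono)
      fix t :: real assume "t \<in> {0<..<1}"
      with pot_convex[of t b v] assms show "(pot (b + t *\<^sub>R v) - pot b) / t \<le> pot (b + v) - pot b"
        by (simp add: field_simps)
    qed simp
  qed simp
  then show ?thesis by simp
qed

section \<open>First-order terms along a coupling\<close>

lemma HnormL2_nonneg: "N \<ge> 0"
  by (simp add: HnormL2_def)

text \<open>Bounds the linear term of both expansions: Cauchy-Schwarz in L2 of the coupling, whose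
  second marginal P0 turns the norm of H into \<open>N\<close>.\<close>

lemma coupling_H:
  assumes \<tau>: "\<tau> > 0" "\<eta> \<ge> 0" and \<pi>: "\<pi> \<in> couplings Q P0"
    and cost: "cost \<tau> \<pi> \<le> ennreal \<eta>"
  shows "integrable \<pi> (\<lambda>p. H (snd p) \<bullet> (fst p - snd p))"
    and "\<bar>\<integral>p. H (snd p) \<bullet> (fst p - snd p) \<partial>\<pi>\<bar> \<le> N * sqrt (\<eta> / \<tau>)"
proof -
  note \<pi>' = couplingsD[OF \<pi>]
  note \<pi>'(2)[measurable_cong]
  have H2: "integrable \<pi> (\<lambda>p. (norm (H (snd p)))^2)"
    using H_square_integrable by (intro integrable_distr[of snd \<pi> borel]) (simp_all add: \<pi>'(4))
  have H2': "(\<integral>p. (norm (H (snd p)))^2 \<partial>\<pi>) = (\<integral>b. (norm (H b))^2 \<partial>P0)"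
  proof -
    have "(\<integral>b. (norm (H b))^2 \<partial>P0) = (\<integral>b. (norm (H b))^2 \<partial>distr \<pi> borel snd)" by (simp only: \<pi>'(4))
    also have "\<dots> = (\<integral>p. (norm (H (snd p)))^2 \<partial>\<pi>)" by (rule integral_distr) auto
    finally show ?thesis by simp
  qed
  note V = coupling_second_moment[OF \<tau> \<pi>'(2) cost]
  have CS: "integrable \<pi> (\<lambda>p. norm (H (snd p)) * norm (fst p - snd p))"
    "\<bar>\<integral>p. norm (H (snd p)) * norm (fst p - snd p) \<partial>\<pi>\<bar> \<le> sqrt (\<integral>p. (norm (H (snd p)))^2 \<partial>\<pi>) * sqrt (\<integral>p. (norm (fst p - snd p))^2 \<partial>\<pi>)"
    by (rule integral_Cauchy_Schwarz; use H2 V in simp)+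
  show i: "integrable \<pi> (\<lambda>p. H (snd p) \<bullet> (fst p - snd p))"
    by (rule Bochner_Integration.integrable_bound[OF CS(1)]) (auto intro!: AE_I2 Cauchy_Schwarz_ineq2)
  have "\<bar>\<integral>p. H (snd p) \<bullet> (fst p - snd p) \<partial>\<pi>\<bar> \<le> (\<integral>p. norm (H (snd p)) * norm (fst p - snd p) \<partial>\<pi>)"
    by (rule order_trans[OF integral_abs_bound]) (intro integral_mono integrable_abs i CS(1) Cauchy_Schwarz_ineq2)
  also have "\<dots> \<le> sqrt (\<integral>b. (norm (H b))^2 \<partial>P0) * sqrt (\<integral>p. (norm (fst p - snd p))^2 \<partial>\<pi>)"
    using CS(2) unfolding H2' by linarith
  also have "\<dots> \<le> N * sqrt (\<eta> / \<tau>)"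
    unfolding HnormL2_def using V(2) by (intro mult_left_mono) auto
  finally show "\<bar>\<integral>p. H (snd p) \<bullet> (fst p - snd p) \<partial>\<pi>\<bar> \<le> N * sqrt (\<eta> / \<tau>)" .
qed

lemma coupling_pot_snd:
  assumes \<pi>: "\<pi> \<in> couplings Q P0"
  shows "integrable \<pi> (\<lambda>p. pot (snd p))" "(\<integral>p. pot (snd p) \<partial>\<pi>) = (\<integral>b. pot b \<partial>P0)"
proof -
  note \<pi>' = couplingsD[OF \<pi>]
  note \<pi>'(2)[measurable_cong]
  show "integrable \<pi> (\<lambda>p. pot (snd p))"
    using pot_integrable by (intro integrable_distr[of snd \<pi> borel]) (simp_all add: \<pi>'(4))
  have "(\<integral>b. pot b \<partial>P0) = (\<integral>b. pot b \<partial>distr \<pi> borel snd)" by (simp only: \<pi>'(4))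
  also have "\<dots> = (\<integral>p. pot (snd p) \<partial>\<pi>)" by (rule integral_distr) auto
  finally show "(\<integral>p. pot (snd p) \<partial>\<pi>) = (\<integral>b. pot b \<partial>P0)" by simp
qed

text \<open>The tangent inequality at \<open>G P0 z\<close>, integrated against
  \<open>\<phi>\<close>. The J P0 term stays on the right because subtraction in
  \<open>ennreal\<close> would be truncated.\<close>

lemma Jfun_ge_linear:
  assumes "\<beta> \<ge> 0" and Q: "prob_space Q" "sets Q = sets borel"
  shows "ennreal (1 + \<beta>) * (\<integral>\<^sup>+b. ennreal (pot b) \<partial>Q) \<le> J Q + ennreal \<beta> * J P0"
proof -
  note [measurable] = G_measurable[OF Q]
  have "ennreal (1 + \<beta>) * (\<integral>\<^sup>+b. ennreal (pot b) \<partial>Q) = (\<integral>\<^sup>+z. ennreal ((1 + \<beta>) * (G Q z * \<omega> z)) \<partial>lborel)"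
    unfolding nn_integral_G_\<omega>[OF Q, symmetric] using assms(1) G_pos[OF Q] \<omega>_pos
    by (subst nn_integral_cmult[symmetric]) (auto simp: ennreal_mult less_imp_le)
  also have "\<dots> \<le> (\<integral>\<^sup>+z. ennreal (G Q z powr (1 + \<beta>) * \<phi> z) + ennreal \<beta> * ennreal (G P0 z powr (1 + \<beta>) * \<phi> z) \<partial>lborel)"
  proof (rule nn_integral_mono)
    fix z
    define x g where "x = G Q z" and "g = G P0 z"
    have pos: "x > 0" "g > 0" by (auto simp: x_def g_def G_pos[OF Q] G_P0_pos)
    have "(1 + \<beta>) * (x * g powr \<beta>) * \<phi> z \<le> (x powr (1 + \<beta>) + \<beta> * g powr (1 + \<beta>)) * \<phi> z"
      using phi_pos[of z] by (intro mult_right_mono powr_tangent_le pos assms(1)) auto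
    then show "ennreal ((1 + \<beta>) * (G Q z * \<omega> z)) \<le> ennreal (G Q z powr (1 + \<beta>) * \<phi> z) + ennreal \<beta> * ennreal (G P0 z powr (1 + \<beta>) * \<phi> z)"
      using assms(1) phi_pos[of z]
      by (simp add: \<omega>_def w_def x_def g_def ennreal_mult[symmetric] ennreal_plus[symmetric] algebra_simps del: ennreal_plus)
  qed
  also have "\<dots> = J Q + ennreal \<beta> * J P0"
    unfolding Jfun_eq[OF Q] Jfun_eq[OF P0_prob P0_sets] by (subst nn_integral_add) (auto simp: nn_integral_cmult)
  finally show ?thesis .
qed

lemma Jfun_lower_bound:
  assumes \<beta>: "\<beta> \<ge> 0" and \<tau>: "\<tau> > 0" and \<delta>: "\<delta> \<ge> 0" and QU: "Q \<in> Uset \<tau> P0 \<delta>"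
  shows "ennreal (enn2real (J P0) - sqrt (\<delta> / \<tau>) * N) \<le> J Q"
proof (cases "J Q = \<infinity>")
  case False
  have Q: "prob_space Q" "sets Q = sets borel" using QU by (auto simp: Uset_def)
  note Q(2)[measurable_cong]
  define J0 j where "J0 = (\<integral>b. pot b \<partial>P0)" and "j = enn2real (J Q)"
  have J0: "J P0 = ennreal J0" "J0 \<ge> 0"
    using Jfun_P0 pot_nonneg by (auto simp: J0_def)
  have j: "J Q = ennreal j" "j \<ge> 0" using False by (auto simp: j_def less_top)
  have lin: "ennreal (1 + \<beta>) * (\<integral>\<^sup>+b. ennreal (pot b) \<partial>Q) \<le> ennreal (j + \<beta> * J0)"
    using Jfun_ge_linear[OF \<beta> Q] \<beta> j J0 by (simp add: ennreal_mult)
  \<comment> \<open>Integrability of \<open>pot\<close> under Q comes from finiteness of J Q through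
    the linear bound.\<close>
  have "(\<integral>\<^sup>+b. ennreal (pot b) \<partial>Q) < \<infinity>"
    using le_less_trans[OF lin ennreal_less_top] beta(2) by (auto simp: ennreal_mult_less_top less_imp_le)
  then have iQ: "integrable Q pot" using pot_nonneg by (intro integrableI_nonneg) auto
  have "(1 + \<beta>) * (\<integral>b. pot b \<partial>Q) \<le> j + \<beta> * J0"
    using lin \<beta> j J0 pot_nonneg
    by (simp add: nn_integral_eq_integral[OF iQ] ennreal_mult[symmetric] del: ennreal_plus)
  moreover have "J0 - N * sqrt (\<eta> / \<tau>) \<le> (1 + \<beta>) * (\<integral>b. pot b \<partial>Q) - \<beta> * J0" if \<eta>: "\<eta> > \<delta>" for \<eta>
  proof -
    obtain \<pi> where \<pi>: "\<pi> \<in> couplings Q P0" "cost \<tau> \<pi> \<le> ennreal \<eta>"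
      using UsetE[OF QU \<delta> \<eta>] .
    note \<pi>' = couplingsD[OF \<pi>(1)]
    note \<pi>'(2)[measurable_cong]
    have "\<eta> \<ge> 0" using \<delta> \<eta> by simp
    note CH = coupling_H[OF \<tau> this \<pi>]
    have ifst: "integrable \<pi> (\<lambda>p. pot (fst p))"
      using iQ unfolding \<pi>'(3)[symmetric] by (subst (asm) integrable_distr_eq) auto
    have "(\<integral>b. pot b \<partial>Q) = (\<integral>b. pot b \<partial>distr \<pi> borel fst)" by (simp only: \<pi>'(3))
    also have "\<dots> = (\<integral>p. pot (fst p) \<partial>\<pi>)" by (rule integral_distr) auto
    also have "\<dots> \<ge> (\<integral>p. pot (snd p) + (H (snd p) \<bullet> (fst p - snd p)) / (1 + \<beta>) \<partial>\<pi>)"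
    proof (rule integral_mono)
      fix p :: "(real^'d) \<times> (real^'d)"
      show "pot (snd p) + (H (snd p) \<bullet> (fst p - snd p)) / (1 + \<beta>) \<le> pot (fst p)"
        using pot_subgradient[OF \<beta>, of "snd p" "fst p - snd p"] by simp
    qed (use CH(1) coupling_pot_snd(1)[OF \<pi>(1)] ifst in auto)
    also have "(\<integral>p. pot (snd p) + (H (snd p) \<bullet> (fst p - snd p)) / (1 + \<beta>) \<partial>\<pi>)
        = J0 + (\<integral>p. H (snd p) \<bullet> (fst p - snd p) \<partial>\<pi>) / (1 + \<beta>)"
      using CH(1) coupling_pot_snd[OF \<pi>(1)] by (simp add: J0_def)
    finally have "(1 + \<beta>) * (J0 + (\<integral>p. H (snd p) \<bullet> (fst p - snd p) \<partial>\<pi>) / (1 + \<beta>)) \<le> (1 + \<beta>) * (\<integral>b. pot b \<partial>Q)"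
      using \<beta> by (intro mult_left_mono) auto
    then have "J0 + \<beta> * J0 + (\<integral>p. H (snd p) \<bullet> (fst p - snd p) \<partial>\<pi>) \<le> (1 + \<beta>) * (\<integral>b. pot b \<partial>Q)"
      using \<beta> by (simp add: distrib_left) (simp add: distrib_right)
    with CH(2) show ?thesis by simp
  qed
  ultimately have ge: "J0 - N * sqrt (\<eta> / \<tau>) \<le> j" if "\<eta> > \<delta>" for \<eta> using that by fastforce
  \<comment> \<open>The inequality no longer mentions the coupling, so the enlarged budget can be
    lowered to \<delta>.\<close>
  have "((\<lambda>\<eta>. J0 - N * sqrt (\<eta> / \<tau>)) \<longlongrightarrow> J0 - N * sqrt (\<delta> / \<tau>)) (at_right \<delta>)"
    using \<tau> by (intro tendsto_intros) auto
  then have "J0 - N * sqrt (\<delta> / \<tau>) \<le> j"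
    by (rule tendsto_upperbound) (auto simp: eventually_at_filter intro!: always_eventually ge)
  then show ?thesis using J0 j by (simp add: mult.commute)
qed simp

end

section \<open>Integrability for nonpositive exponents\<close>

text \<open>
  With exponents 2 and 2 in place of 3 and 3/2, the Taylor remainder would only be O(sqrt \<delta>).
\<close>
lemma mult_square_le_cubes:
  fixes a g \<mu> :: real
  assumes "a \<ge> 0" "g \<ge> 0" "\<mu> > 0"
  shows "a * g^2 \<le> \<mu>^6 * a^3 + g^3 / \<mu>^3"
proof (cases "g \<le> \<mu>^3 * a")
  case True
  have "a * g^2 \<le> a * (\<mu>^3 * a)^2" using assms True by (intro mult_left_mono power_mono) auto
  also have "\<dots> = \<mu>^6 * a^3" by (simp add: power_mult_distrib power2_eq_square power3_eq_cube eval_nat_numeral)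
  also have "\<dots> \<le> \<mu>^6 * a^3 + g^3 / \<mu>^3" using assms by simp
  finally show ?thesis .
next
  case False
  then have "a \<le> g / \<mu>^3" using assms by (simp add: field_simps)
  then have "a * g^2 \<le> g / \<mu>^3 * g^2" using assms by (intro mult_right_mono) auto
  also have "\<dots> = g^3 / \<mu>^3" by (simp add: power2_eq_square power3_eq_cube)
  also have "\<dots> \<le> \<mu>^6 * a^3 + g^3 / \<mu>^3" using assms by simp
  finally show ?thesis .
qed

text \<open>The term - T |n|^2 / 2 of the exponent is itself of second order in \<nu>, so only n
  \<bullet> u survives at first order. The condition \<nu> \<le> 1 allows \<nu>^2 to be traded for
  \<nu> when the whole exponent is estimated.\<close>

lemma exp_gaussian_exponent_taylor:
  fixes n u :: "'a::real_inner"
  assumes "T \<ge> 0" "k \<ge> 0" "0 \<le> \<nu>" "\<nu> \<le> 1" and n: "norm n \<le> k * \<nu>"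
  shows "\<bar>exp (n \<bullet> u - T * (norm n)^2 / 2) - 1 - n \<bullet> u\<bar>
    \<le> \<nu>^2 * ((k^2 * exp ((2 + k) * T * k / 2) + T * k^2 / 2) * exp ((2 + k) * norm u))"
proof -
  define s where "s = n \<bullet> u - T * (norm n)^2 / 2"
  \<comment> \<open>Chosen so that \<bar>s\<bar> \<le> \<nu> k X; the shift T k / 2 accounts for the
    quadratic part of s.\<close>
  define X where "X = norm u + T * k / 2"
  have X: "X \<ge> 0" using assms by (simp add: X_def)
  have nsq: "(norm n)^2 \<le> \<nu>^2 * k^2" using power_mono[OF n, of 2] by (simp add: power_mult_distrib mult.commute)
  have Tn: "T * (norm n)^2 / 2 \<le> \<nu>^2 * (T * k^2 / 2)" using mult_left_mono[OF nsq, of T] assms by (simp add: mult_ac)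
  have "\<bar>s\<bar> \<le> \<bar>n \<bullet> u\<bar> + T * (norm n)^2 / 2" using assms unfolding s_def
    by (smt (verit) divide_nonneg_nonneg mult_nonneg_nonneg zero_le_power2)
  also have "\<dots> \<le> k * \<nu> * norm u + \<nu> * (T * k^2 / 2)"
  proof (intro add_mono)
    show "\<bar>n \<bullet> u\<bar> \<le> k * \<nu> * norm u"
      using Cauchy_Schwarz_ineq2[of n u] mult_right_mono[OF n norm_ge_zero[of u]] by linarith
    have "\<nu>^2 * (T * k^2 / 2) \<le> \<nu> * (T * k^2 / 2)"
      using assms by (intro mult_right_mono) (auto simp: power2_eq_square mult_left_le)
    with Tn show "T * (norm n)^2 / 2 \<le> \<nu> * (T * k^2 / 2)" by linarith
  qed
  also have "\<dots> = \<nu> * (k * X)" by (simp add: X_def power2_eq_square algebra_simps)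
  finally have s: "\<bar>s\<bar> \<le> \<nu> * (k * X)" .
  also have "\<dots> \<le> k * X" using assms X by (intro mult_left_le_one_le) auto
  finally have s': "\<bar>s\<bar> \<le> k * X" .
  have "s^2 * exp \<bar>s\<bar> \<le> (\<nu> * (k * X))^2 * exp (k * X)"
    using s s' by (intro mult_mono) (auto simp: abs_le_square_iff[symmetric])
  also have "\<dots> = \<nu>^2 * (k^2 * (X^2 * exp (k * X)))" by (simp add: power_mult_distrib)
  also have "\<dots> \<le> \<nu>^2 * (k^2 * (exp (2 * X) * exp (k * X)))"
  proof (intro mult_left_mono mult_right_mono)
    have "X \<le> exp X" using exp_ge_add_one_self[of X] by linarith
    then have "X^2 \<le> (exp X)^2" using X by (intro power_mono)
    then show "X^2 \<le> exp (2 * X)" by (simp add: exp_double)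
  qed auto
  also have "exp (2 * X) * exp (k * X) = exp ((2 + k) * T * k / 2) * exp ((2 + k) * norm u)"
    unfolding mult_exp_exp X_def by (simp add: algebra_simps)
  finally have 1: "s^2 * exp \<bar>s\<bar> \<le> \<nu>^2 * (k^2 * (exp ((2 + k) * T * k / 2) * exp ((2 + k) * norm u)))" .
  have "\<nu>^2 * (T * k^2 / 2) * 1 \<le> \<nu>^2 * (T * k^2 / 2) * exp ((2 + k) * norm u)"
    using assms by (intro mult_left_mono) auto
  with Tn have 2: "T * (norm n)^2 / 2 \<le> \<nu>^2 * (T * k^2 / 2) * exp ((2 + k) * norm u)" by linarith
  have "\<bar>exp s - 1 - n \<bullet> u\<bar> \<le> \<bar>exp s - 1 - s\<bar> + T * (norm n)^2 / 2"
    using assms unfolding s_def by (smt (verit) divide_nonneg_nonneg mult_nonneg_nonneg zero_le_power2)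
  also have "\<dots> \<le> \<nu>^2 * (k^2 * (exp ((2 + k) * T * k / 2) * exp ((2 + k) * norm u))) + \<nu>^2 * (T * k^2 / 2) * exp ((2 + k) * norm u)"
    using abs_exp_minus_one_minus_le[of s] 1 2 by linarith
  finally show ?thesis unfolding s_def by (simp add: algebra_simps)
qed

context drift_model
begin

text \<open>Some ball carries positive mass, and on it the likelihood is at least a constant times
  exp (- M |z|). The constants are fixed before f, so the bound is uniform over all maps within
  distance K of the identity; K = 0 yields a bound for \<open>G P0\<close>.\<close>

lemma integral_L_perturbed_ge:
  assumes K: "K \<ge> 0"
  shows "\<exists>c k. c > 0 \<and> k \<ge> 0 \<and> (\<forall>f z. f \<in> borel_measurable borel \<longrightarrow> (\<forall>b. norm (f b - b) \<le> K) \<longrightarrow>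
    c * exp (- k * norm z) \<le> (\<integral>b. L (f b) z \<partial>P0))"
proof -
  interpret P0: prob_space P0 by (rule P0_prob)
  have sp: "space P0 = UNIV" using sets_eq_imp_space_eq[OF P0_sets] by simp
  have "(\<lambda>n. measure P0 {b. norm b \<le> real n}) \<longlonglongrightarrow> measure P0 (\<Union>n. {b. norm b \<le> real n})"
    by (rule P0.finite_Lim_measure_incseq) (auto simp: incseq_def P0_sets)
  also have "(\<Union>n. {b. norm (b::real^'d) \<le> real n}) = space P0" by (auto simp: sp real_arch_simple)
  finally have "(\<lambda>n. measure P0 {b. norm b \<le> real n}) \<longlonglongrightarrow> 1" by (simp add: P0.prob_space)
  from order_tendstoD(1)[OF this, of 0] obtain n :: nat where n: "measure P0 {b. norm b \<le> real n} > 0"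
    by (auto simp: eventually_sequentially)
  define M where "M = norm (mpr 0) + nrm * (real n + K)"
  have M: "M \<ge> 0" using K nrm_nonneg by (simp add: M_def)
  define c where "c = measure P0 {b. norm b \<le> real n} * exp (- (M^2 * T / 2))"
  show ?thesis
  proof (rule exI[of _ c], rule exI[of _ M], intro conjI allI impI)
    show "c > 0" using n by (simp add: c_def)
    show "M \<ge> 0" by fact
    fix f :: "real^'d \<Rightarrow> real^'d" and z
    assume [measurable]: "f \<in> borel_measurable borel" and "\<forall>b. norm (f b - b) \<le> K"
    then have f: "norm (f b - b) \<le> K" for b by simp
    have int: "integrable P0 (\<lambda>b. L (f b) z)"
      by (rule P0.integrable_const_bound[where B="exp ((norm z)^2 / (2 * T))"])
         (use L_le_gaussian L_pos in \<open>auto intro!: AE_I2 simp: abs_of_pos\<close>)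
    have le: "indicator {b. norm b \<le> real n} b * exp (- (M^2 * T / 2) + - M * norm z) \<le> L (f b) z" for b
    proof (cases "norm b \<le> real n")
      case True
      have "norm (f b) \<le> real n + K" using True f[of b] norm_triangle_ineq[of "f b - b" b] by simp
      then have "norm (mpr (f b)) \<le> M"
        using norm_mpr_le[of "f b"] mult_left_mono[OF _ nrm_nonneg, of "norm (f b)" "real n + K"] by (simp add: M_def)
      then have "norm (mpr (f b)) * norm z + (norm (mpr (f b)))^2 * T / 2 \<le> M * norm z + M^2 * T / 2"
        using T_pos by (intro add_mono mult_right_mono divide_right_mono power_mono) auto
      then have "exp (- (M^2 * T / 2) + - M * norm z) \<le> L (f b) z"
        by (intro order_trans[OF _ L_ge_exp]) simp
      then show ?thesis using True by simp
    qed (use L_pos in \<open>simp add: less_imp_le\<close>)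
    have "c * exp (- M * norm z) = (\<integral>b. indicator {b. norm b \<le> real n} b * exp (- (M^2 * T / 2) + - M * norm z) \<partial>P0)"
      by (simp add: c_def mult.assoc mult_exp_exp sp)
    also have "\<dots> \<le> (\<integral>b. L (f b) z \<partial>P0)"
    proof (intro integral_mono int le)
      show "integrable P0 (\<lambda>b. indicator {b. norm b \<le> real n} b * exp (- (M^2 * T / 2) + - M * norm z))"
        by (intro integrable_mult_left integrable_real_indicator) (auto simp: P0_sets P0.emeasure_finite less_top[symmetric])
    qed
    finally show "c * exp (- M * norm z) \<le> (\<integral>b. L (f b) z \<partial>P0)" .
  qed
qed

text \<open>A nonpositive power turns the exponential lower bound for \<open>G P0\<close> into an
  upper bound.\<close>

lemma w_le_exp:
  assumes "\<beta> \<le> 0"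
  obtains K k where "K \<ge> 0" "k \<ge> 0" "\<And>z. w z \<le> K * exp (k * norm z)"
proof -
  obtain c k where ck0: "c > 0" "k \<ge> 0" "\<forall>f z. f \<in> borel_measurable borel \<longrightarrow> (\<forall>b. norm (f b - b) \<le> 0) \<longrightarrow>
      c * exp (- k * norm z) \<le> (\<integral>b. L (f b) z \<partial>P0)"
    using integral_L_perturbed_ge[OF order_refl] by blast
  note ck = ck0(1,2) ck0(3)[rule_format, of "\<lambda>b. b", simplified]
  have "w z \<le> c powr \<beta> * exp ((- k * \<beta>) * norm z)" for z
  proof -
    have "w z \<le> (c * exp (- k * norm z)) powr \<beta>"
      unfolding w_def G_def using ck assms by (intro powr_mono2') auto
    also have "\<dots> = c powr \<beta> * exp ((- k * \<beta>) * norm z)"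
      using ck(1) by (simp add: powr_mult exp_powr_real mult_ac)
    finally show ?thesis .
  qed
  moreover have "- k * \<beta> \<ge> 0" using ck assms by (simp add: mult_nonneg_nonpos)
  ultimately show ?thesis using that[of "c powr \<beta>" "- k * \<beta>"] by simp
qed

text \<open>The centre \<open>mean b\<close> grows at most linearly in b, so an exponentially
  bounded weight costs only an exponential in the norm of b.\<close>

lemma nn_integral_w_shift_le:
  assumes "\<beta> \<le> 0"
  obtains K c where "K \<ge> 0" "c \<ge> 0"
    "\<And>b. moment d b \<le> ennreal (K * exp (c * norm b))"
proof -
  obtain K k where K: "K \<ge> 0" "k \<ge> 0" "\<And>z. w z \<le> K * exp (k * norm z)"
    using w_le_exp[OF assms] by blast
  define \<Phi> where "\<Phi> = enn2real (\<integral>\<^sup>+u. ennreal (exp ((d + k) * norm u) * \<phi> u) \<partial>lborel)"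
  have \<Phi>: "(\<integral>\<^sup>+u. ennreal (exp ((d + k) * norm u) * \<phi> u) \<partial>lborel) = ennreal \<Phi>" "\<Phi> \<ge> 0"
    using nn_integral_phi_exp_finite[of "d + k"] by (auto simp: \<Phi>_def less_top)
  show ?thesis
  proof
    show "K * exp (k * T * norm (mpr 0)) * \<Phi> \<ge> 0" "k * T * nrm \<ge> 0" using K \<Phi> T_pos nrm_nonneg by auto
    fix b :: "real^'d"
    let ?E = "K * exp (k * T * norm (mpr 0)) * exp (k * T * nrm * norm b)"
    have "moment d b
       \<le> (\<integral>\<^sup>+u. ennreal ?E * ennreal (exp ((d + k) * norm u) * \<phi> u) \<partial>lborel)"
    proof (rule nn_integral_mono)
      fix u :: "real^'d"
      have "norm (u + mean b) \<le> norm u + T * norm (mpr b)"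
        using norm_triangle_ineq[of u "mean b"] T_pos by simp
      also have "\<dots> \<le> norm u + T * (norm (mpr 0) + nrm * norm b)"
        using T_pos norm_mpr_le[of b] by (intro add_left_mono mult_left_mono) auto
      finally have "k * norm (u + mean b) \<le> k * (norm u + T * (norm (mpr 0) + nrm * norm b))"
        using K by (intro mult_left_mono)
      then have "w (u + mean b) \<le> K * exp (k * (norm u + T * (norm (mpr 0) + nrm * norm b)))"
        using K(1) by (intro order_trans[OF K(3)] mult_left_mono) auto
      also have "\<dots> = ?E * exp (k * norm u)" by (simp add: exp_add[symmetric] algebra_simps)
      finally have "exp (d * norm u) * (w (u + mean b) * \<phi> u) \<le> exp (d * norm u) * ((?E * exp (k * norm u)) * \<phi> u)"
        using phi_pos[of u] by (intro mult_left_mono mult_right_mono) auto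
      also have "\<dots> = ?E * (exp ((d + k) * norm u) * \<phi> u)" by (simp add: exp_add algebra_simps)
      finally show "ennreal (exp (d * norm u) * (w (u + mean b) * \<phi> u)) \<le> ennreal ?E * ennreal (exp ((d + k) * norm u) * \<phi> u)"
        using K(1) phi_pos[of u] by (simp add: ennreal_mult[symmetric] ennreal_leI)
    qed
    also have "\<dots> = ennreal ?E * ennreal \<Phi>" unfolding \<Phi>(1)[symmetric] by (rule nn_integral_cmult) measurable
    also have "\<dots> = ennreal (K * exp (k * T * norm (mpr 0)) * \<Phi> * exp (k * T * nrm * norm b))"
      using K \<Phi> by (simp add: ennreal_mult[symmetric] mult_ac)
    finally show "moment d b \<le> \<dots>" .
  qed
qed

text \<open>At this drift the Gaussian is centred, so \<open>moment C\<close> there is the unshifted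
  integral that \<open>w_phi_exp\<close> asks for.\<close>

lemma mpr_riskless: "mpr (\<chi> i. r) = 0"
  by (simp add: mpr_def)

text \<open>The growth exponent \<open>g\<close> will be linear in the norm for \<beta> \<le> 0 and
  quadratic for \<beta> \<ge> 0; the factor 2 comes from squaring the moment.\<close>

lemma regularI:
  assumes fin: "\<And>C. moment C (\<chi> i. r) < \<infinity>"
    and K: "K \<ge> 0" "\<And>b. moment 1 b \<le> ennreal (K * exp (g b))"
    and [measurable]: "g \<in> borel_measurable borel" and mom: "(\<integral>\<^sup>+b. ennreal (exp (2 * g b)) \<partial>P0) < \<infinity>"
  shows "regular_drift_model T r \<alpha> \<beta> \<sigma> P0"
proof unfold_locales
  show "(\<integral>\<^sup>+z. ennreal (exp (C * norm z) * (w z * \<phi> z)) \<partial>lborel) < \<infinity>" for C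
    using fin[of C] by (simp add: mpr_riskless)
  have "(\<integral>\<^sup>+b. (moment 1 b)^2 \<partial>P0) \<le> (\<integral>\<^sup>+b. ennreal (K^2) * ennreal (exp (2 * g b)) \<partial>P0)"
  proof (rule nn_integral_mono)
    fix b
    have "(moment 1 b)^2 \<le> (ennreal (K * exp (g b)))^2"
      using K(2)[of b] by (intro power_mono) auto
    also have "\<dots> = ennreal (K^2) * ennreal (exp (2 * g b))"
      using K(1) by (simp add: ennreal_power power_mult_distrib ennreal_mult exp_double)
    finally show "(moment 1 b)^2 \<le> \<dots>" .
  qed
  also have "\<dots> = ennreal (K^2) * (\<integral>\<^sup>+b. ennreal (exp (2 * g b)) \<partial>P0)"
    by (rule nn_integral_cmult) measurable
  also have "\<dots> < \<infinity>" using mom by (simp add: ennreal_mult_less_top)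
  finally show "(\<integral>\<^sup>+b. (moment 1 b)^2 \<partial>P0) < \<infinity>" .
qed

lemma regular_nonpos:
  assumes "\<beta> \<le> 0" and exp_moment: "\<And>c. (\<integral>\<^sup>+b. ennreal (exp (c * norm b)) \<partial>P0) < \<infinity>"
  shows "regular_drift_model T r \<alpha> \<beta> \<sigma> P0"
proof -
  obtain K c where K: "K \<ge> 0" "c \<ge> 0" "\<And>b. moment 1 b \<le> ennreal (K * exp (c * norm b))"
    using nn_integral_w_shift_le[OF assms(1), of 1] by blast
  have "moment C b < \<infinity>" for C b
  proof -
    obtain K c where "moment C b \<le> ennreal (K * exp (c * norm b))"
      using nn_integral_w_shift_le[OF assms(1), of C] by blast
    then show ?thesis by (rule le_less_trans) simp
  qed
  then show ?thesis
    using exp_moment[of "2 * c"] by (intro regularI[OF _ K(1,3)]) (auto simp: mult.assoc)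
qed

end

section \<open>Upper bound for nonpositive exponents\<close>

text \<open>The concave counterpart of \<open>powr_tangent_le\<close>. Young's inequality is applied
  with weights 1 + \<beta> and - \<beta> to x * g powr \<beta> and g powr (1 + \<beta>), whose
  weighted geometric mean is x powr (1 + \<beta>).\<close>

lemma powr_tangent_ge:
  fixes x g \<beta> :: real
  assumes pos: "x > 0" "g > 0" and \<beta>: "\<beta> \<le> 0" "1 + \<beta> > 0"
  shows "x powr (1 + \<beta>) \<le> (1 + \<beta>) * (x * g powr \<beta>) + (- \<beta>) * g powr (1 + \<beta>)"
proof -
  have "(x * g powr \<beta>) powr (1 + \<beta>) * (g powr (1 + \<beta>)) powr (- \<beta>) \<le> (1 + \<beta>) * (x * g powr \<beta>) + (- \<beta>) * g powr (1 + \<beta>)"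
    using pos \<beta> by (intro Youngs_inequality_0) auto
  moreover have "(x * g powr \<beta>) powr (1 + \<beta>) * (g powr (1 + \<beta>)) powr (- \<beta>) = x powr (1 + \<beta>)"
    using pos by (simp add: powr_mult powr_powr powr_add[symmetric] algebra_simps)
  ultimately show ?thesis by simp
qed

context regular_drift_model
begin

lemma integrable_L_inner_\<omega>: "integrable lborel (\<lambda>z. L b z * ((z - mean b) \<bullet> lin v) * \<omega> z)"
proof -
  have "integrable lborel (\<lambda>z. ((L b z * \<omega> z) *\<^sub>R adj (z - mean b)) \<bullet> v)"
    by (intro integrable_inner_left integrable_grad)
  then show ?thesis by (simp add: inner_adj mult_ac)
qed

text \<open>By \<open>L_add\<close> the remainder relative to \<open>L b z\<close> depends on b only
  through z - mean b. After recentring it is bounded by a moment of the weight, which grows at most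
  exponentially in b.\<close>

lemma pot_taylor_local:
  assumes "\<beta> \<le> 0"
  shows "\<exists>C c. C \<ge> 0 \<and> c \<ge> 0 \<and> (\<forall>b v. norm v \<le> 1 \<longrightarrow>
    pot (b + v) - pot b - (H b \<bullet> v) / (1 + \<beta>) \<le> (norm v)^2 * (C * exp (c * norm b)))"
proof -
  \<comment> \<open>The constant of \<open>exp_gaussian_exponent_taylor\<close> for k = nrm and
    \<nu> = norm v.\<close>
  define D where "D = nrm^2 * exp ((2 + nrm) * T * nrm / 2) + T * nrm^2 / 2"
  have D: "D \<ge> 0" using T_pos by (simp add: D_def)
  obtain K c where K: "K \<ge> 0" "c \<ge> 0"
    "\<And>b. moment (2 + nrm) b \<le> ennreal (K * exp (c * norm b))"
    using nn_integral_w_shift_le[OF assms, of "2 + nrm"] by blast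
  have "pot (b + v) - pot b - (H b \<bullet> v) / (1 + \<beta>) \<le> (norm v)^2 * (D * K * exp (c * norm b))" if v: "norm v \<le> 1" for b v
  proof -
    define R where "R z = L (b + v) z - L b z - L b z * ((z - mean b) \<bullet> lin v)" for z
    have Rm [measurable]: "R \<in> borel_measurable borel" unfolding R_def by measurable
    have Rb: "\<bar>R z\<bar> \<le> (norm v)^2 * D * exp ((2 + nrm) * norm (z - mean b)) * L b z" for z
    proof -
      have "R z = L b z * (exp (lin v \<bullet> (z - mean b) - T * (norm (lin v))^2 / 2) - 1 - lin v \<bullet> (z - mean b))"
        unfolding R_def L_add by (simp add: algebra_simps inner_commute)
      then have "\<bar>R z\<bar> = L b z * \<bar>exp (lin v \<bullet> (z - mean b) - T * (norm (lin v))^2 / 2) - 1 - lin v \<bullet> (z - mean b)\<bar>"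
        using L_pos[of b z] by (simp add: abs_mult)
      also have "\<dots> \<le> L b z * ((norm v)^2 * (D * exp ((2 + nrm) * norm (z - mean b))))"
        unfolding D_def using T_pos nrm_nonneg v norm_lin_le[of v] L_pos[of b z]
        by (intro mult_left_mono exp_gaussian_exponent_taylor) auto
      finally show ?thesis by (simp add: mult_ac)
    qed
    have i1: "integrable lborel (\<lambda>z. L (b + v) z * \<omega> z - L b z * \<omega> z)"
      by (intro Bochner_Integration.integrable_diff integrable_L_\<omega>)
    have int: "integrable lborel (\<lambda>z. R z * \<omega> z)"
      unfolding R_def left_diff_distrib
      by (intro Bochner_Integration.integrable_diff integrable_L_\<omega> integrable_L_inner_\<omega>)
    have eq: "pot (b + v) - pot b - (H b \<bullet> v) / (1 + \<beta>) = (\<integral>z. R z * \<omega> z \<partial>lborel)"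
    proof -
      have "(H b \<bullet> v) / (1 + \<beta>) = (\<integral>z. L b z * ((z - mean b) \<bullet> lin v) * \<omega> z \<partial>lborel)"
        using beta(2) by (simp add: H_inner)
      moreover have "(\<integral>z. R z * \<omega> z \<partial>lborel) = (\<integral>z. (L (b + v) z * \<omega> z - L b z * \<omega> z) - L b z * ((z - mean b) \<bullet> lin v) * \<omega> z \<partial>lborel)"
        by (simp add: R_def left_diff_distrib)
      ultimately show ?thesis
        by (simp add: pot_def Bochner_Integration.integral_diff[OF i1 integrable_L_inner_\<omega>]
             Bochner_Integration.integral_diff[OF integrable_L_\<omega> integrable_L_\<omega>])
    qed
    have "ennreal \<bar>\<integral>z. R z * \<omega> z \<partial>lborel\<bar> \<le> (\<integral>\<^sup>+z. ennreal (norm (R z * \<omega> z)) \<partial>lborel)"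
      using integral_norm_bound_ennreal[OF int] by simp
    also have "\<dots> \<le> (\<integral>\<^sup>+z. (ennreal ((norm v)^2 * D) * ennreal (exp ((2 + nrm) * norm (z - mean b)) * w z)) * ennreal (L b z * \<phi> z) \<partial>lborel)"
    proof (rule nn_integral_mono)
      fix z
      have "norm (R z * \<omega> z) \<le> ((norm v)^2 * D * exp ((2 + nrm) * norm (z - mean b)) * L b z) * \<omega> z"
        using mult_right_mono[OF Rb[of z] less_imp_le[OF \<omega>_pos[of z]]] \<omega>_pos[of z] by (simp add: abs_mult)
      then show "ennreal (norm (R z * \<omega> z)) \<le> (ennreal ((norm v)^2 * D) * ennreal (exp ((2 + nrm) * norm (z - mean b)) * w z)) * ennreal (L b z * \<phi> z)"
        using D w_pos[of z] L_pos[of b z] phi_pos[of z]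
        by (simp add: ennreal_mult[symmetric] ennreal_leI \<omega>_def mult_ac)
    qed
    also have "\<dots> = (\<integral>\<^sup>+u. (ennreal ((norm v)^2 * D) * ennreal (exp ((2 + nrm) * norm u) * w (u + mean b))) * ennreal (\<phi> u) \<partial>lborel)"
      by (subst nn_integral_L_phi) auto
    also have "\<dots> = (\<integral>\<^sup>+u. ennreal ((norm v)^2 * D) * ennreal (exp ((2 + nrm) * norm u) * (w (u + mean b) * \<phi> u)) \<partial>lborel)"
      using w_pos phi_pos by (intro nn_integral_cong) (simp add: ennreal_mult less_imp_le mult.assoc)
    also have "\<dots> = ennreal ((norm v)^2 * D) * moment (2 + nrm) b"
      by (rule nn_integral_cmult) measurable
    also have "\<dots> \<le> ennreal ((norm v)^2 * D) * ennreal (K * exp (c * norm b))"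
      by (intro mult_left_mono K) auto
    also have "\<dots> = ennreal ((norm v)^2 * (D * K * exp (c * norm b)))"
      using D K by (simp add: ennreal_mult[symmetric] mult_ac)
    finally have "\<bar>\<integral>z. R z * \<omega> z \<partial>lborel\<bar> \<le> (norm v)^2 * (D * K * exp (c * norm b))"
      using D K by (subst (asm) ennreal_le_iff) auto
    then show ?thesis unfolding eq by linarith
  qed
  moreover have "D * K \<ge> 0" using D K by simp
  ultimately show ?thesis using K(2) by blast
qed

text \<open>For norm v > 1 the local expansion says nothing; there the growth bounds for
  \<open>pot\<close> and H suffice, since the last term exceeds them. A single expression for both
  ranges can be integrated along a coupling without splitting by displacement.\<close>

lemma pot_taylor:
  assumes "\<beta> \<le> 0"
  shows "\<exists>C c. C \<ge> 0 \<and> c \<ge> 0 \<and> (\<forall>b v.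
    pot (b + v) \<le> pot b + (H b \<bullet> v) / (1 + \<beta>) + C * exp (c * norm b) * (norm v * exp (c * norm v))^2)"
proof -
  obtain C c where C: "C \<ge> 0" "c \<ge> 0" "\<And>b v. norm v \<le> 1 \<Longrightarrow>
    pot (b + v) - pot b - (H b \<bullet> v) / (1 + \<beta>) \<le> (norm v)^2 * (C * exp (c * norm b))"
    using pot_taylor_local[OF assms] by blast
  obtain K d where K: "K \<ge> 0" "d \<ge> 0"
    "\<And>b. moment 1 b \<le> ennreal (K * exp (d * norm b))"
    using nn_integral_w_shift_le[OF assms, of 1] by blast
  have maj: "majorant b \<le> ennreal (K * exp (d * norm b))" for b
    using K(3)[of b] by (simp add: majorant_def)
  have pot_le: "pot b \<le> K * exp (d * norm b)" for b
    using order_trans[OF pot_le_majorant maj[of b]] K(1) pot_nonneg by (subst (asm) ennreal_le_iff) auto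
  have H_le: "norm (H b) \<le> (1 + \<beta>) * nrm * (K * exp (d * norm b))" for b
  proof -
    have "ennreal (norm (H b)) \<le> ennreal ((1 + \<beta>) * nrm) * ennreal (K * exp (d * norm b))"
      by (rule order_trans[OF norm_H_le_majorant]) (intro mult_left_mono maj, simp)
    also have "\<dots> = ennreal ((1 + \<beta>) * nrm * (K * exp (d * norm b)))"
      using beta(2) nrm_nonneg K by (simp add: ennreal_mult[symmetric])
    finally show ?thesis using beta(2) nrm_nonneg K by (subst (asm) ennreal_le_iff) auto
  qed
  \<comment> \<open>C serves small v; for large v, K pays for \<open>pot (b + v)\<close> and K times
    nrm for the linear term.\<close>
  define E where "E = C + K * (1 + nrm)"
  define e where "e = c + d"
  have E: "E \<ge> 0" "e \<ge> 0" using C K nrm_nonneg by (auto simp: E_def e_def)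
  have "pot (b + v) \<le> pot b + (H b \<bullet> v) / (1 + \<beta>) + E * exp (e * norm b) * (norm v * exp (e * norm v))^2" for b v
  proof (cases "norm v \<le> 1")
    case True
    have "(norm v)^2 * (C * exp (c * norm b)) \<le> (norm v * exp (e * norm v))^2 * (E * exp (e * norm b))"
      using C K E nrm_nonneg by (intro mult_mono power_mono) (auto simp: E_def e_def mult_le_cancel_left1 mult_right_mono)
    then show ?thesis using C(3)[OF True, of b] by (simp add: mult_ac)
  next
    case False
    have v1: "1 \<le> norm v" using False by simp
    have "pot (b + v) \<le> K * exp (d * norm (b + v))" by (rule pot_le)
    also have "\<dots> \<le> K * (exp (d * norm b) * exp (d * norm v))"
      unfolding mult_exp_exp using K norm_triangle_ineq[of b v] mult_left_mono[OF norm_triangle_ineq[of b v] K(2)]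
      by (intro mult_left_mono) (auto simp: algebra_simps)
    also have "\<dots> \<le> K * (exp (e * norm b) * (norm v * exp (e * norm v))^2)"
    proof (intro mult_left_mono mult_mono)
      show "exp (d * norm b) \<le> exp (e * norm b)" using C by (simp add: e_def mult_right_mono)
      have "exp (d * norm v) \<le> exp (e * norm v)" using C by (simp add: e_def mult_right_mono)
      also have "\<dots> \<le> (norm v * exp (e * norm v))^2"
      proof -
        have "1 \<le> exp (e * norm v)" using E by simp
        moreover have "1 * exp (e * norm v) \<le> norm v * exp (e * norm v)" using v1 by (intro mult_right_mono) auto
        ultimately have "exp (e * norm v) \<le> norm v * exp (e * norm v)" "1 \<le> norm v * exp (e * norm v)"
          by linarith+
        then have "exp (e * norm v) * 1 \<le> (norm v * exp (e * norm v)) * (norm v * exp (e * norm v))"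
          by (intro mult_mono) auto
        then show ?thesis by (simp add: power2_eq_square)
      qed
      finally show "exp (d * norm v) \<le> (norm v * exp (e * norm v))^2" .
    qed (use K in auto)
    finally have 1: "pot (b + v) \<le> K * (exp (e * norm b) * (norm v * exp (e * norm v))^2)" .
    have "- ((H b \<bullet> v) / (1 + \<beta>)) \<le> norm (H b) * norm v / (1 + \<beta>)"
      unfolding minus_divide_left using Cauchy_Schwarz_ineq2[of "H b" v] beta(2) by (intro divide_right_mono) linarith+
    also have "\<dots> \<le> (1 + \<beta>) * nrm * (K * exp (d * norm b)) * norm v / (1 + \<beta>)"
      using beta(2) by (intro divide_right_mono mult_right_mono H_le) auto
    also have "\<dots> = nrm * K * (exp (d * norm b) * norm v)" using beta(2) by simp
    also have "\<dots> \<le> nrm * K * (exp (e * norm b) * (norm v * exp (e * norm v))^2)"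
    proof (intro mult_left_mono mult_mono)
      show "exp (d * norm b) \<le> exp (e * norm b)" using C by (simp add: e_def mult_right_mono)
      have "norm v * 1 \<le> norm v * (norm v * (exp (e * norm v))^2)"
      proof (intro mult_left_mono)
        have "1 * 1 \<le> norm v * (exp (e * norm v))^2" using v1 E by (intro mult_mono one_le_power) auto
        then show "1 \<le> norm v * (exp (e * norm v))^2" by simp
      qed simp
      then show "norm v \<le> (norm v * exp (e * norm v))^2" by (simp add: power2_eq_square mult_ac)
    qed (use K nrm_nonneg in auto)
    finally have 2: "- ((H b \<bullet> v) / (1 + \<beta>)) \<le> nrm * K * (exp (e * norm b) * (norm v * exp (e * norm v))^2)" .
    have 3: "C * (exp (e * norm b) * (norm v * exp (e * norm v))^2) \<ge> 0" using C by simp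
    have "E * exp (e * norm b) * (norm v * exp (e * norm v))^2 = C * (exp (e * norm b) * (norm v * exp (e * norm v))^2)
       + K * (exp (e * norm b) * (norm v * exp (e * norm v))^2) + nrm * K * (exp (e * norm b) * (norm v * exp (e * norm v))^2)"
      unfolding E_def by (simp add: algebra_simps)
    then show ?thesis using 1 2 3 pot_nonneg[of b] by linarith
  qed
  then show ?thesis using E by blast
qed

lemma Jfun_le_linear:
  assumes "\<beta> \<le> 0" and Q: "prob_space Q" "sets Q = sets borel"
  shows "J Q \<le> ennreal (- \<beta>) * J P0 + ennreal (1 + \<beta>) * (\<integral>\<^sup>+b. ennreal (pot b) \<partial>Q)"
proof -
  note [measurable] = G_measurable[OF Q]
  have "J Q = (\<integral>\<^sup>+z. ennreal (G Q z powr (1 + \<beta>) * \<phi> z) \<partial>lborel)" by (rule Jfun_eq[OF Q])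
  also have "\<dots> \<le> (\<integral>\<^sup>+z. ennreal (- \<beta>) * ennreal (G P0 z powr (1 + \<beta>) * \<phi> z) + ennreal (1 + \<beta>) * ennreal (G Q z * \<omega> z) \<partial>lborel)"
  proof (rule nn_integral_mono)
    fix z
    define x g where "x = G Q z" and "g = G P0 z"
    have pos: "x > 0" "g > 0" by (auto simp: x_def g_def G_pos[OF Q] G_P0_pos)
    have "x powr (1 + \<beta>) * \<phi> z \<le> ((1 + \<beta>) * (x * g powr \<beta>) + (- \<beta>) * g powr (1 + \<beta>)) * \<phi> z"
      using phi_pos[of z] by (intro mult_right_mono powr_tangent_ge pos assms(1) beta(2)) auto
    then have "x powr (1 + \<beta>) * \<phi> z \<le> (- \<beta>) * (g powr (1 + \<beta>) * \<phi> z) + (1 + \<beta>) * (x * (g powr \<beta> * \<phi> z))"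
      by (simp add: algebra_simps)
    moreover have "x * (g powr \<beta> * \<phi> z) \<ge> 0" using pos phi_pos[of z] by simp
    moreover have "\<beta> * (g powr (1 + \<beta>) * \<phi> z) \<le> 0" using assms(1) phi_pos[of z] by (simp add: mult_nonpos_nonneg)
    ultimately show "ennreal (G Q z powr (1 + \<beta>) * \<phi> z) \<le> ennreal (- \<beta>) * ennreal (G P0 z powr (1 + \<beta>) * \<phi> z) + ennreal (1 + \<beta>) * ennreal (G Q z * \<omega> z)"
      using assms(1) beta(2) phi_pos[of z] pos
      by (simp add: \<omega>_def w_def x_def[symmetric] g_def[symmetric] ennreal_mult[symmetric] ennreal_plus[symmetric] ennreal_leI del: ennreal_plus)
  qed
  also have "\<dots> = ennreal (- \<beta>) * J P0 + ennreal (1 + \<beta>) * (\<integral>\<^sup>+z. ennreal (G Q z * \<omega> z) \<partial>lborel)"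
    unfolding Jfun_eq[OF P0_prob P0_sets] by (subst nn_integral_add) (auto simp: nn_integral_cmult)
  finally show ?thesis unfolding nn_integral_G_\<omega>[OF Q] .
qed

text \<open>Half of the exponent \<tau> v^2 absorbs exp ((3 c + 1) v), the other half feeds
  \<open>le_exp_minus_one\<close>. The extra 1 in 3 c + 1 comes from the third factor v, which is
  replaced by exp v.\<close>

lemma cube_exp_le_ctau:
  fixes \<tau> c v :: real
  assumes \<tau>: "\<tau> > 0" and "c \<ge> 0" and "v \<ge> 0"
  shows "(v * exp (c * v))^3 \<le> exp ((3 * c + 1)^2 / (2 * \<tau>)) / \<tau> * (exp (\<tau> * v^2) - 1)"
proof -
  have "(v * exp (c * v))^3 = v^2 * (v * exp (3 * c * v))"
    by (simp add: power_mult_distrib power3_eq_cube power2_eq_square mult_exp_exp algebra_simps)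
  also have "\<dots> \<le> v^2 * (exp v * exp (3 * c * v))"
  proof (intro mult_left_mono mult_right_mono)
    show "v \<le> exp v" using exp_ge_add_one_self[of v] by linarith
  qed auto
  also have "exp v * exp (3 * c * v) = exp ((3 * c + 1) * v)" by (simp add: mult_exp_exp algebra_simps)
  also have "v^2 * exp ((3 * c + 1) * v) \<le> v^2 * exp (\<tau> / 2 * v^2 + (3 * c + 1)^2 / (4 * (\<tau> / 2)))"
    using linear_le_quadratic[of "\<tau> / 2" "3 * c + 1" v] \<tau> by (intro mult_left_mono) auto
  also have "\<dots> = exp ((3 * c + 1)^2 / (2 * \<tau>)) / \<tau> * (\<tau> * v^2 * exp (\<tau> * v^2 / 2))"
    using \<tau> by (simp add: exp_add)
  also have "\<dots> \<le> exp ((3 * c + 1)^2 / (2 * \<tau>)) / \<tau> * (exp (\<tau> * v^2) - 1)"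
    using \<tau> by (intro mult_left_mono le_exp_minus_one) auto
  finally show ?thesis .
qed

text \<open>The Taylor remainder is \<open>A\<close> at the point drawn from P0 times the square of
  \<open>g\<close> at the displacement. \<open>mult_square_le_cubes\<close> separates the two: the
  cube of \<open>A\<close> is an exponential moment of P0, and the cube of \<open>g\<close> is paid
  for by the cost. The constant is fixed before \<delta> and Q.\<close>

lemma Jfun_upper_bound:
  assumes \<beta>: "\<beta> \<le> 0" and \<tau>: "\<tau> > 0"
    and exp_moment: "\<And>c. (\<integral>\<^sup>+b. ennreal (exp (c * norm b)) \<partial>P0) < \<infinity>"
  shows "\<exists>C\<ge>0. \<forall>\<delta>>0. \<forall>Q\<in>Uset \<tau> P0 \<delta>. J Q \<le>
    ennreal (enn2real (J P0) + sqrt (\<delta> / \<tau>) * N + C * \<delta> powr (2/3))"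
proof -
  obtain C c where C: "C \<ge> 0" "c \<ge> 0" "\<And>b v.
    pot (b + v) \<le> pot b + (H b \<bullet> v) / (1 + \<beta>) + C * exp (c * norm b) * (norm v * exp (c * norm v))^2"
    using pot_taylor[OF \<beta>] by blast
  define A where "A b = C * exp (c * norm b)" for b :: "real^'d"
  define g where "g v = norm v * exp (c * norm v)" for v :: "real^'d"
  have [measurable]: "A \<in> borel_measurable borel" "g \<in> borel_measurable borel"
    unfolding A_def g_def by measurable
  have Ag: "A b \<ge> 0" "g v \<ge> 0" for b v using C by (auto simp: A_def g_def)
  define a3 where "a3 = enn2real (\<integral>\<^sup>+b. ennreal ((A b)^3) \<partial>P0)"
  have a3: "(\<integral>\<^sup>+b. ennreal ((A b)^3) \<partial>P0) = ennreal a3" "a3 \<ge> 0"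
  proof -
    have "(\<integral>\<^sup>+b. ennreal ((A b)^3) \<partial>P0) = (\<integral>\<^sup>+b. ennreal (C^3) * ennreal (exp ((3 * c) * norm b)) \<partial>P0)"
      using C by (intro nn_integral_cong)
        (simp add: A_def power_mult_distrib power3_eq_cube mult_exp_exp ennreal_mult[symmetric] algebra_simps)
    also have "\<dots> = ennreal (C^3) * (\<integral>\<^sup>+b. ennreal (exp ((3 * c) * norm b)) \<partial>P0)"
      by (rule nn_integral_cmult) measurable
    also have "\<dots> < \<infinity>" using exp_moment[of "3 * c"] by (simp add: ennreal_mult_less_top)
    finally show "(\<integral>\<^sup>+b. ennreal ((A b)^3) \<partial>P0) = ennreal a3" "a3 \<ge> 0" by (auto simp: a3_def less_top)
  qed
  define D where "D = exp ((3 * c + 1)^2 / (2 * \<tau>)) / \<tau>"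
  have D: "D \<ge> 0" using \<tau> by (simp add: D_def)
  define J0 where "J0 = (\<integral>b. pot b \<partial>P0)"
  have J0: "J P0 = ennreal J0" "J0 \<ge> 0"
    using Jfun_P0 pot_nonneg by (auto simp: J0_def)
  have main: "J Q \<le> ennreal (J0 + N * sqrt (\<eta> / \<tau>) + (1 + \<beta>) * (a3 + D) * \<eta> powr (2/3))"
    if \<delta>: "\<delta> > 0" and QU: "Q \<in> Uset \<tau> P0 \<delta>" and \<eta>: "\<eta> > \<delta>" for \<delta> \<eta> Q
  proof -
    have Q: "prob_space Q" "sets Q = sets borel" using QU by (auto simp: Uset_def)
    note Q(2)[measurable_cong]
    obtain \<pi> where \<pi>: "\<pi> \<in> couplings Q P0" "cost \<tau> \<pi> \<le> ennreal \<eta>"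
      using UsetE[OF QU less_imp_le[OF \<delta>] \<eta>] .
    note \<pi>' = couplingsD[OF \<pi>(1)]
    note \<pi>'(2)[measurable_cong]
    have \<eta>0: "\<eta> > 0" "\<eta> \<ge> 0" using \<delta> \<eta> by auto
    note CH = coupling_H[OF \<tau> \<eta>0(2) \<pi>]
    \<comment> \<open>Balances the two terms: \<mu>^6 and \<eta> / \<mu>^3 agree exactly when
      \<mu>^9 = \<eta>, and then both equal \<eta> powr (2/3).\<close>
    define \<mu> where "\<mu> = \<eta> powr (1/9)"
    have \<mu>: "\<mu> > 0" "\<mu>^6 = \<eta> powr (2/3)" "\<eta> / \<mu>^3 = \<eta> powr (2/3)"
      using \<eta>0(1) by (auto simp: \<mu>_def powr_realpow[symmetric] powr_powr powr_diff[symmetric] simp flip: powr_diff)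
        (simp add: powr_realpow[symmetric] powr_powr divide_powr_uminus powr_mult_base)
    define rem where "rem p = A (snd p) * (g (fst p - snd p))^2" for p
    have rem_m [measurable]: "rem \<in> borel_measurable \<pi>" unfolding rem_def by measurable
    have "(\<integral>\<^sup>+p. ennreal (rem p) \<partial>\<pi>) \<le> (\<integral>\<^sup>+p. ennreal (\<mu>^6) * ennreal ((A (snd p))^3) + ennreal (D / \<mu>^3) * ennreal (ctau \<tau> (fst p) (snd p)) \<partial>\<pi>)"
    proof (rule nn_integral_mono)
      fix p :: "(real^'d) \<times> (real^'d)"
      have ct: "ctau \<tau> (fst p) (snd p) \<ge> 0" using \<tau> by (simp add: ctau_def)
      have "(g (fst p - snd p))^3 \<le> D * ctau \<tau> (fst p) (snd p)"
        unfolding g_def D_def ctau_def using cube_exp_le_ctau[OF \<tau> C(2), of "norm (fst p - snd p)"] by simp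
      then have "(g (fst p - snd p))^3 / \<mu>^3 \<le> D / \<mu>^3 * ctau \<tau> (fst p) (snd p)"
        using \<mu>(1) by (simp add: divide_right_mono)
      then have "rem p \<le> \<mu>^6 * (A (snd p))^3 + D / \<mu>^3 * ctau \<tau> (fst p) (snd p)"
        unfolding rem_def using mult_square_le_cubes[OF Ag(1) Ag(2) \<mu>(1), of "snd p" "fst p - snd p"] by linarith
      then show "ennreal (rem p) \<le> ennreal (\<mu>^6) * ennreal ((A (snd p))^3) + ennreal (D / \<mu>^3) * ennreal (ctau \<tau> (fst p) (snd p))"
        using Ag(1)[of "snd p"] \<mu>(1) D ct
        by (simp add: ennreal_mult[symmetric] ennreal_plus[symmetric] ennreal_leI del: ennreal_plus)
    qed
    also have "\<dots> = ennreal (\<mu>^6) * (\<integral>\<^sup>+p. ennreal ((A (snd p))^3) \<partial>\<pi>) + ennreal (D / \<mu>^3) * cost \<tau> \<pi>"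
    proof -
      have [measurable]: "(\<lambda>p. ctau \<tau> (fst p) (snd p)) \<in> borel_measurable \<pi>" unfolding ctau_def by measurable
      show ?thesis by (subst nn_integral_add) (auto simp: nn_integral_cmult)
    qed
    also have "(\<integral>\<^sup>+p. ennreal ((A (snd p))^3) \<partial>\<pi>) = ennreal a3"
    proof -
      have "ennreal a3 = (\<integral>\<^sup>+b. ennreal ((A b)^3) \<partial>distr \<pi> borel snd)" by (simp only: \<pi>'(4) a3(1))
      also have "\<dots> = (\<integral>\<^sup>+p. ennreal ((A (snd p))^3) \<partial>\<pi>)" by (rule nn_integral_distr) auto
      finally show ?thesis by simp
    qed
    also have "ennreal (\<mu>^6) * ennreal a3 + ennreal (D / \<mu>^3) * cost \<tau> \<pi>
        \<le> ennreal (\<mu>^6) * ennreal a3 + ennreal (D / \<mu>^3) * ennreal \<eta>"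
      by (intro add_left_mono mult_left_mono \<pi>) auto
    also have "\<dots> = ennreal ((a3 + D) * \<eta> powr (2/3))"
    proof -
      have "\<mu>^6 * a3 + D / \<mu>^3 * \<eta> = (a3 + D) * \<eta> powr (2/3)"
        using \<mu>(2,3) by (simp add: distrib_right mult.commute) (metis times_divide_eq_right)
      then show ?thesis using \<mu>(1) a3(2) D \<eta>0
        by (simp add: ennreal_mult[symmetric] ennreal_plus[symmetric] del: ennreal_plus)
    qed
    finally have rem: "(\<integral>\<^sup>+p. ennreal (rem p) \<partial>\<pi>) \<le> ennreal ((a3 + D) * \<eta> powr (2/3))" .
    have rem0: "rem p \<ge> 0" for p using Ag by (simp add: rem_def)
    have irem: "integrable \<pi> rem"
      using le_less_trans[OF rem ennreal_less_top] rem0 by (intro integrableI_nonneg) auto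
    have rem': "(\<integral>p. rem p \<partial>\<pi>) \<le> (a3 + D) * \<eta> powr (2/3)"
      using rem rem0 a3(2) D by (simp add: nn_integral_eq_integral[OF irem])
    define f where "f p = pot (snd p) + (H (snd p) \<bullet> (fst p - snd p)) / (1 + \<beta>) + rem p" for p
    have if': "integrable \<pi> f" unfolding f_def
      using CH(1) coupling_pot_snd(1)[OF \<pi>(1)] irem by (intro Bochner_Integration.integrable_add integrable_divide) auto
    have fge: "pot (fst p) \<le> f p" for p
      using C(3)[of "snd p" "fst p - snd p"] by (simp add: f_def rem_def A_def g_def)
    have f0: "f p \<ge> 0" for p using fge[of p] pot_nonneg[of "fst p"] by linarith
    have f': "(\<integral>p. f p \<partial>\<pi>) = J0 + (\<integral>p. H (snd p) \<bullet> (fst p - snd p) \<partial>\<pi>) / (1 + \<beta>) + (\<integral>p. rem p \<partial>\<pi>)"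
      unfolding f_def using CH(1) coupling_pot_snd[OF \<pi>(1)] irem by (simp add: J0_def)
    have "(\<integral>\<^sup>+b. ennreal (pot b) \<partial>Q) = (\<integral>\<^sup>+b. ennreal (pot b) \<partial>distr \<pi> borel fst)" by (simp only: \<pi>'(3))
    also have "\<dots> = (\<integral>\<^sup>+p. ennreal (pot (fst p)) \<partial>\<pi>)" by (rule nn_integral_distr) auto
    also have "\<dots> \<le> (\<integral>\<^sup>+p. ennreal (f p) \<partial>\<pi>)" by (intro nn_integral_mono ennreal_leI fge)
    also have "\<dots> = ennreal (\<integral>p. f p \<partial>\<pi>)" using f0 by (intro nn_integral_eq_integral if') auto
    finally have potQ: "(\<integral>\<^sup>+b. ennreal (pot b) \<partial>Q) \<le> ennreal (\<integral>p. f p \<partial>\<pi>)" .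
    have "J Q \<le> ennreal (- \<beta>) * ennreal J0 + ennreal (1 + \<beta>) * ennreal (\<integral>p. f p \<partial>\<pi>)"
      by (rule order_trans[OF Jfun_le_linear[OF \<beta> Q]]) (unfold J0, intro add_left_mono mult_left_mono potQ, simp)
    also have "\<dots> = ennreal (- \<beta> * J0 + (1 + \<beta>) * (\<integral>p. f p \<partial>\<pi>))"
      using \<beta> beta(2) J0(2) f0 by (simp add: ennreal_mult[symmetric] ennreal_plus[symmetric] mult_nonpos_nonneg del: ennreal_plus)
    also have "\<dots> \<le> ennreal (J0 + N * sqrt (\<eta> / \<tau>) + (1 + \<beta>) * (a3 + D) * \<eta> powr (2/3))"
    proof (rule ennreal_leI)
      have "(1 + \<beta>) * (\<integral>p. f p \<partial>\<pi>) = (1 + \<beta>) * J0 + (\<integral>p. H (snd p) \<bullet> (fst p - snd p) \<partial>\<pi>) + (1 + \<beta>) * (\<integral>p. rem p \<partial>\<pi>)"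
        unfolding f' using beta(2) by (simp add: distrib_left)
      moreover have "(1 + \<beta>) * (\<integral>p. rem p \<partial>\<pi>) \<le> (1 + \<beta>) * ((a3 + D) * \<eta> powr (2/3))"
        using beta(2) by (intro mult_left_mono rem') auto
      ultimately show "- \<beta> * J0 + (1 + \<beta>) * (\<integral>p. f p \<partial>\<pi>) \<le> J0 + N * sqrt (\<eta> / \<tau>) + (1 + \<beta>) * (a3 + D) * \<eta> powr (2/3)"
        using CH(2) by (simp add: distrib_right mult.assoc)
    qed
    finally show ?thesis .
  qed
  show ?thesis
  proof (intro exI[of _ "(1 + \<beta>) * (a3 + D)"] conjI allI impI ballI)
    show "0 \<le> (1 + \<beta>) * (a3 + D)" using beta(2) a3 D by simp
    fix \<delta> Q assume \<delta>: "(\<delta>::real) > 0" and Q: "Q \<in> Uset \<tau> P0 \<delta>"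
    define j where "j = enn2real (J Q)"
    \<comment> \<open>Any \<eta> above \<delta> shows that J Q is finite; the limit of \<eta> to
      \<delta> can then be taken in the reals.\<close>
    have "\<delta> < \<delta> + 1" by simp
    from le_less_trans[OF main[OF \<delta> Q this] ennreal_less_top]
    have j: "J Q = ennreal j" by (simp add: j_def)
    let ?F = "\<lambda>\<eta>. J0 + N * sqrt (\<eta> / \<tau>) + (1 + \<beta>) * (a3 + D) * \<eta> powr (2/3)"
    have F0: "?F \<eta> \<ge> 0" if "\<eta> > 0" for \<eta>
      using that \<tau> J0(2) HnormL2_nonneg beta(2) a3(2) D by (auto intro!: add_nonneg_nonneg mult_nonneg_nonneg)
    have "(?F \<longlongrightarrow> ?F \<delta>) (at_right \<delta>)"
      using \<tau> \<delta> by (intro tendsto_intros) auto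
    then have "j \<le> ?F \<delta>"
    proof (rule tendsto_lowerbound)
      show "\<forall>\<^sub>F \<eta> in at_right \<delta>. j \<le> ?F \<eta>"
        unfolding eventually_at_filter
      proof (intro always_eventually allI impI)
        fix \<eta> assume "\<eta> \<in> {\<delta><..}"
        then have \<eta>: "\<eta> > \<delta>" by simp
        then show "j \<le> ?F \<eta>" using main[OF \<delta> Q \<eta>] F0[of \<eta>] \<delta> unfolding j by (subst (asm) ennreal_le_iff) auto
      qed
    qed simp
    then show "J Q \<le> ennreal (enn2real (J P0) + sqrt (\<delta> / \<tau>) * N + (1 + \<beta>) * (a3 + D) * \<delta> powr (2/3))"
      unfolding j J0(1) using J0(2) by (intro ennreal_leI) (simp add: mult.commute)
  qed
qed

end

section \<open>Integrability for nonnegative exponents\<close>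

text \<open>The hypothesis places \<kappa> beyond the larger root of x^2 - a x - c. With a =
  \<beta>^2 - \<beta> + 2 and c = 2 (\<beta>^2 + \<beta>) this root is the first entry of the
  maximum in the assumption on \<gamma>0.\<close>

lemma quadratic_root_bound:
  fixes a c \<kappa> :: real
  assumes "c \<ge> 0" "\<kappa> \<ge> (a + sqrt (a^2 + 4 * c)) / 2"
  shows "\<kappa>^2 \<ge> a * \<kappa> + c"
proof -
  have "sqrt (a^2 + 4 * c) \<le> 2 * \<kappa> - a" using assms(2) by (simp add: field_simps)
  then have "(sqrt (a^2 + 4 * c))^2 \<le> (2 * \<kappa> - a)^2" using assms(1) by (intro power_mono) auto
  then have "a^2 + 4 * c \<le> (2 * \<kappa> - a)^2" using assms(1) by simp
  then have "4 * (a * \<kappa> + c) \<le> 4 * \<kappa>^2" by (simp add: power2_eq_square algebra_simps)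
  then show ?thesis by simp
qed

context drift_model
begin

text \<open>Jensen's inequality for x powr q, via the tangent at \<open>G P0 z\<close>. As x powr
  \<beta> is concave for \<beta> < 1, the exponent is raised to q, and the summand 1 covers mixture
  values below 1. The result is an integral over P0, ready for an exchange of integrals.\<close>

lemma w_le_L_powr:
  assumes "\<beta> \<ge> 0" "q = max \<beta> 1"
  shows "ennreal (w z) \<le> 1 + (\<integral>\<^sup>+b. ennreal (L b z powr q) \<partial>P0)"
proof -
  interpret P0: prob_space P0 by (rule P0_prob)
  define g where "g = G P0 z"
  have g: "g > 0" by (simp add: g_def G_P0_pos)
  have q: "q \<ge> 1" using assms by simp
  have int: "integrable P0 (\<lambda>b. L b z powr q)"
  proof (rule P0.integrable_const_bound[where B="exp ((norm z)^2 / (2 * T)) powr q"])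
    show "AE b in P0. norm (L b z powr q) \<le> exp ((norm z)^2 / (2 * T)) powr q"
      using L_le_gaussian L_pos q by (intro AE_I2) (auto intro!: powr_mono2 simp: less_imp_le)
  qed measurable
  have "(\<integral>b. q * g powr (q - 1) * L b z \<partial>P0) \<le> (\<integral>b. L b z powr q + (q - 1) * g powr q \<partial>P0)"
  proof (rule integral_mono)
    fix b
    show "q * g powr (q - 1) * L b z \<le> L b z powr q + (q - 1) * g powr q"
      using powr_tangent_le[OF L_pos[of b z] g, of "q - 1"] q by (simp add: mult_ac)
  qed (use int integrable_L_P0 in auto)
  also have "\<dots> = (\<integral>b. L b z powr q \<partial>P0) + (q - 1) * g powr q"
    using int by (simp add: P0.prob_space)
  also have "(\<integral>b. q * g powr (q - 1) * L b z \<partial>P0) = q * (g powr (q - 1) * g)"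
    by (simp add: g_def G_def)
  also have "g powr (q - 1) * g = g powr q" using g by (simp add: powr_diff)
  finally have J: "g powr q \<le> (\<integral>b. L b z powr q \<partial>P0)" by (simp add: algebra_simps)
  have "w z \<le> 1 + g powr q"
  proof (cases "g \<le> 1")
    case True
    then have "g powr \<beta> \<le> 1" using g assms by (simp add: powr_le1)
    then show ?thesis by (simp add: w_def g_def add_increasing2)
  next
    case False
    then have "g powr \<beta> \<le> g powr q" using assms by (intro powr_mono) auto
    then show ?thesis by (simp add: w_def g_def)
  qed
  with J have "w z \<le> 1 + (\<integral>b. L b z powr q \<partial>P0)" by linarith
  then have "ennreal (w z) \<le> ennreal (1 + (\<integral>b. L b z powr q \<partial>P0))" by (rule ennreal_leI)
  also have "\<dots> = 1 + ennreal (\<integral>b. L b z powr q \<partial>P0)"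
    by (subst ennreal_plus) auto
  also have "\<dots> = 1 + (\<integral>\<^sup>+b. ennreal (L b z powr q) \<partial>P0)"
    using int by (subst nn_integral_eq_integral) auto
  finally show ?thesis .
qed

text \<open>After Jensen and Fubini each b' contributes a Gaussian integral with exponent T (q (m'
  \<bullet> m) + (q^2 + 1 - q) |m'|^2 / 2), where m = mpr b and m' = mpr b'. Splitting the cross
  term leaves \<kappa> T |m|^2 / 2 outside and \<kappa> T |m'|^2 / 2 to be integrated under P0. The
  half on the outside matters because this bound is squared later.\<close>

lemma nn_integral_w_shift_le_gaussian:
  assumes "\<beta> \<ge> 0" and \<kappa>: "\<kappa> \<ge> 8" "\<kappa>^2 \<ge> (\<beta>^2 - \<beta> + 2) * \<kappa> + 2 * (\<beta>^2 + \<beta>)"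
    and mom: "(\<integral>\<^sup>+b. ennreal (exp (\<kappa> * T * (norm (mpr b))^2)) \<partial>P0) < \<infinity>"
  shows "\<exists>K\<ge>0. \<forall>b. moment C b
     \<le> ennreal (K * exp (\<kappa> * T * (norm (mpr b))^2 / 2))"
proof -
  interpret P0: prob_space P0 by (rule P0_prob)
  interpret pair_sigma_finite P0 lborel ..
  define q where "q = max \<beta> 1"
  have q: "q \<ge> 1" by (simp add: q_def)
  \<comment> \<open>Up to the factor T / 2, the left side is the coefficient of |m'|^2 once the
    cross term is split. For \<beta> \<le> 1 the bound \<kappa> \<ge> 8 is ample; otherwise the
    quadratic condition on \<kappa> gives the claim.\<close>
  have q\<kappa>: "q^2 + 1 - q + q^2 / \<kappa> \<le> \<kappa>"
  proof (cases "\<beta> \<le> 1")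
    case True
    then have "q = 1" by (simp add: q_def)
    have "1 / \<kappa> \<le> 1" using \<kappa> by simp
    then have "1 + 1 / \<kappa> \<le> \<kappa>" using \<kappa>(1) by linarith
    then show ?thesis by (simp add: \<open>q = 1\<close>)
  next
    case False
    then have "q = \<beta>" by (simp add: q_def)
    have "\<beta>^2 \<le> 2 * (\<beta>^2 + \<beta>)" using assms(1) by simp
    then have "(q^2 + 1 - q) * \<kappa> + q^2 \<le> \<kappa> * \<kappa>"
      using \<kappa>(2) \<kappa>(1) unfolding \<open>q = \<beta>\<close> by (simp add: algebra_simps power2_eq_square)
    then show ?thesis using \<kappa>(1) by (simp add: field_simps)
  qed
  \<comment> \<open>Slightly below 1 / (2 * T), yet the exponent from completing the square stays below \<kappa>.\<close>
  define c where "c = q^2 / (2 * T * (q^2 + 1))"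
  have qpos: "q^2 > 0" using q by simp
  define \<rho> where "\<rho> = q^2 / (q^2 + 1)"
  have \<rho>: "0 < \<rho>" "\<rho> < 1" using qpos by (auto simp: \<rho>_def add_pos_pos)
  have c_\<rho>: "c = \<rho> / (2 * T)" by (simp add: c_def \<rho>_def)
  have c: "c > 0" "c < 1 / (2 * T)"
    unfolding c_\<rho> using \<rho> T_pos by (auto intro!: divide_strict_right_mono)
  have c4: "(q * m)^2 / (4 * c) = T * (q^2 + 1) * m^2 / 2" for m :: real
    using qpos T_pos by (simp add: c_def power_mult_distrib field_simps)
  obtain K where K: "K > 0" "\<And>u. \<phi> u * exp (C * norm u) \<le> K * exp (- c * (norm u)^2)"
    using phi_exp_le[of c C] c by auto
  define \<Gamma> where "\<Gamma> = enn2real (\<integral>\<^sup>+u. ennreal (exp (- c * (norm (u::real^'d))^2)) \<partial>lborel)"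
  have \<Gamma>: "(\<integral>\<^sup>+u. ennreal (exp (- c * (norm (u::real^'d))^2)) \<partial>lborel) = ennreal \<Gamma>" "\<Gamma> \<ge> 0"
    using nn_integral_gaussian_finite[OF c(1), where 'a="real^'d"] by (auto simp: \<Gamma>_def less_top)
  define F where "F = enn2real (\<integral>\<^sup>+u. ennreal (exp (C * norm u) * \<phi> u) \<partial>lborel)"
  have F: "(\<integral>\<^sup>+u. ennreal (exp (C * norm u) * \<phi> u) \<partial>lborel) = ennreal F" "F \<ge> 0"
    using nn_integral_phi_exp_finite[of C] by (auto simp: F_def less_top)
  define M where "M = enn2real (\<integral>\<^sup>+b. ennreal (exp (\<kappa> * T * (norm (mpr b))^2 / 2)) \<partial>P0)"
  have "(\<integral>\<^sup>+b. ennreal (exp (\<kappa> * T * (norm (mpr b))^2 / 2)) \<partial>P0) \<le> (\<integral>\<^sup>+b. ennreal (exp (\<kappa> * T * (norm (mpr b))^2)) \<partial>P0)"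
    using \<kappa>(1) T_pos by (intro nn_integral_mono ennreal_leI) simp
  then have M: "(\<integral>\<^sup>+b. ennreal (exp (\<kappa> * T * (norm (mpr b))^2 / 2)) \<partial>P0) = ennreal M" "M \<ge> 0"
    using mom by (auto simp: M_def less_top)
  let ?A = "F + K * \<Gamma> * M"
  have bound: "moment C b
     \<le> ennreal (?A * exp (\<kappa> * T * (norm (mpr b))^2 / 2))" for b
  proof -
    let ?m = "mpr b"
    have inner: "(\<integral>\<^sup>+u. ennreal (exp (C * norm u) * \<phi> u) * ennreal (L b' (u + T *\<^sub>R ?m) powr q) \<partial>lborel)
        \<le> ennreal (K * \<Gamma> * exp (\<kappa> * T * (norm ?m)^2 / 2)) * ennreal (exp (\<kappa> * T * (norm (mpr b'))^2 / 2))" for b'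
    proof -
      let ?m' = "mpr b'"
      let ?e = "q * T * (?m' \<bullet> ?m) - q * T * (norm ?m')^2 / 2"
      have Lq: "L b' (u + T *\<^sub>R ?m) powr q = exp ((q *\<^sub>R ?m') \<bullet> u) * exp ?e" for u
        unfolding L_eq exp_powr_real mult_exp_exp by (simp add: inner_simps algebra_simps)
      have "(\<integral>\<^sup>+u. ennreal (exp (C * norm u) * \<phi> u) * ennreal (L b' (u + T *\<^sub>R ?m) powr q) \<partial>lborel)
        \<le> (\<integral>\<^sup>+u. ennreal (K * exp ?e) * ennreal (exp (- c * (norm u)^2 + (q *\<^sub>R ?m') \<bullet> u)) \<partial>lborel)"
      proof (rule nn_integral_mono)
        fix u :: "real^'d"
        have "(\<phi> u * exp (C * norm u)) * (exp ((q *\<^sub>R ?m') \<bullet> u) * exp ?e)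
           \<le> (K * exp (- c * (norm u)^2)) * (exp ((q *\<^sub>R ?m') \<bullet> u) * exp ?e)"
          by (intro mult_right_mono K) auto
        also have "\<dots> = K * exp ?e * exp (- c * (norm u)^2 + (q *\<^sub>R ?m') \<bullet> u)"
          unfolding exp_add by (simp only: mult_ac)
        finally have "(exp (C * norm u) * \<phi> u) * L b' (u + T *\<^sub>R ?m) powr q \<le> K * exp ?e * exp (- c * (norm u)^2 + (q *\<^sub>R ?m') \<bullet> u)"
          unfolding Lq by (simp only: mult_ac)
        then show "ennreal (exp (C * norm u) * \<phi> u) * ennreal (L b' (u + T *\<^sub>R ?m) powr q)
          \<le> ennreal (K * exp ?e) * ennreal (exp (- c * (norm u)^2 + (q *\<^sub>R ?m') \<bullet> u))"
          using K(1) phi_pos[of u] by (simp only: ennreal_mult[symmetric] ennreal_leI mult_nonneg_nonneg exp_ge_zero less_imp_le powr_ge_zero)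
      qed
      also have "\<dots> = ennreal (K * exp ?e) * (ennreal (exp ((norm (q *\<^sub>R ?m'))^2 / (4 * c))) * ennreal \<Gamma>)"
        unfolding \<Gamma>(1)[symmetric] nn_integral_gaussian_linear[OF c(1), symmetric] by (rule nn_integral_cmult) measurable
      also have "\<dots> = ennreal (K * \<Gamma> * exp (?e + (norm (q *\<^sub>R ?m'))^2 / (4 * c)))"
        using K(1) \<Gamma>(2) by (simp add: ennreal_mult[symmetric] exp_add mult_ac)
      also have "\<dots> \<le> ennreal (K * \<Gamma> * exp (\<kappa> * T * (norm ?m)^2 / 2 + \<kappa> * T * (norm ?m')^2 / 2))"
      proof (intro ennreal_leI mult_left_mono)
        define x y where "x = norm ?m" and "y = norm ?m'"
        have ip: "?m' \<bullet> ?m \<le> y * x" unfolding x_def y_def by (rule norm_cauchy_schwarz)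
        \<comment> \<open>The weight \<kappa> / 2 on x^2 is the most that the claimed bound
          allows.\<close>
        have "q * y * x \<le> \<kappa> / 2 * x^2 + (q * y)^2 / (4 * (\<kappa> / 2))"
          using \<kappa>(1) by (intro linear_le_quadratic) simp
        then have yx: "q * y * x \<le> \<kappa> / 2 * x^2 + (q^2 / \<kappa>) * y^2 / 2" by (simp add: power_mult_distrib)
        have "?e + (norm (q *\<^sub>R ?m'))^2 / (4 * c) = T * (q * (?m' \<bullet> ?m) + (q^2 + 1 - q) * y^2 / 2)"
          using c4[of y] q by (simp add: y_def[symmetric] algebra_simps add_divide_distrib diff_divide_distrib)
        also have "\<dots> \<le> T * (\<kappa> / 2 * x^2 + \<kappa> * y^2 / 2)"
        proof (intro mult_left_mono)
          have "q * (?m' \<bullet> ?m) \<le> q * y * x" using ip q by (simp add: mult.assoc)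
          moreover have "(q^2 + 1 - q + q^2 / \<kappa>) * y^2 \<le> \<kappa> * y^2" by (intro mult_right_mono q\<kappa>) simp
          ultimately show "q * (?m' \<bullet> ?m) + (q^2 + 1 - q) * y^2 / 2 \<le> \<kappa> / 2 * x^2 + \<kappa> * y^2 / 2"
            using yx by (simp add: distrib_right)
        qed (use T_pos in simp)
        finally show "exp (?e + (norm (q *\<^sub>R ?m'))^2 / (4 * c)) \<le> exp (\<kappa> * T * (norm ?m)^2 / 2 + \<kappa> * T * (norm ?m')^2 / 2)"
          by (simp add: x_def[symmetric] y_def[symmetric] algebra_simps)
      qed (use K \<Gamma> in simp)
      also have "\<dots> = ennreal (K * \<Gamma> * exp (\<kappa> * T * (norm ?m)^2 / 2)) * ennreal (exp (\<kappa> * T * (norm ?m')^2 / 2))"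
        using K(1) \<Gamma>(2) by (simp add: ennreal_mult[symmetric] exp_add mult_ac)
      finally show ?thesis .
    qed
    have "(\<integral>\<^sup>+u. ennreal (exp (C * norm u) * (w (u + T *\<^sub>R ?m) * \<phi> u)) \<partial>lborel)
      \<le> (\<integral>\<^sup>+u. ennreal (exp (C * norm u) * \<phi> u) + (\<integral>\<^sup>+b'. ennreal (exp (C * norm u) * \<phi> u) * ennreal (L b' (u + T *\<^sub>R ?m) powr q) \<partial>P0) \<partial>lborel)"
    proof (rule nn_integral_mono)
      fix u :: "real^'d"
      have "ennreal (exp (C * norm u) * (w (u + T *\<^sub>R ?m) * \<phi> u)) = ennreal (exp (C * norm u) * \<phi> u) * ennreal (w (u + T *\<^sub>R ?m))"
        using phi_pos[of u] w_pos[of "u + T *\<^sub>R ?m"] by (simp add: ennreal_mult[symmetric] mult_ac)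
      also have "\<dots> \<le> ennreal (exp (C * norm u) * \<phi> u) * (1 + (\<integral>\<^sup>+b'. ennreal (L b' (u + T *\<^sub>R ?m) powr q) \<partial>P0))"
        by (intro mult_left_mono w_le_L_powr[OF assms(1) q_def]) simp
      finally show "ennreal (exp (C * norm u) * (w (u + T *\<^sub>R ?m) * \<phi> u))
         \<le> ennreal (exp (C * norm u) * \<phi> u) + (\<integral>\<^sup>+b'. ennreal (exp (C * norm u) * \<phi> u) * ennreal (L b' (u + T *\<^sub>R ?m) powr q) \<partial>P0)"
        by (simp add: distrib_left nn_integral_cmult)
    qed
    also have "\<dots> = ennreal F + (\<integral>\<^sup>+u. (\<integral>\<^sup>+b'. ennreal (exp (C * norm u) * \<phi> u) * ennreal (L b' (u + T *\<^sub>R ?m) powr q) \<partial>P0) \<partial>lborel)"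
      by (subst nn_integral_add) (auto simp: F)
    also have "(\<integral>\<^sup>+u. (\<integral>\<^sup>+b'. ennreal (exp (C * norm u) * \<phi> u) * ennreal (L b' (u + T *\<^sub>R ?m) powr q) \<partial>P0) \<partial>lborel)
       = (\<integral>\<^sup>+b'. (\<integral>\<^sup>+u. ennreal (exp (C * norm u) * \<phi> u) * ennreal (L b' (u + T *\<^sub>R ?m) powr q) \<partial>lborel) \<partial>P0)"
      by (rule Fubini') measurable
    also have "\<dots> \<le> (\<integral>\<^sup>+b'. ennreal (K * \<Gamma> * exp (\<kappa> * T * (norm ?m)^2 / 2)) * ennreal (exp (\<kappa> * T * (norm (mpr b'))^2 / 2)) \<partial>P0)"
      by (intro nn_integral_mono inner)
    also have "\<dots> = ennreal (K * \<Gamma> * exp (\<kappa> * T * (norm ?m)^2 / 2)) * ennreal M"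
      unfolding M(1)[symmetric] by (rule nn_integral_cmult) measurable
    also have "ennreal F + \<dots> = ennreal (F + K * \<Gamma> * exp (\<kappa> * T * (norm ?m)^2 / 2) * M)"
      using F(2) K(1) \<Gamma>(2) M(2) by (simp add: ennreal_mult[symmetric] ennreal_plus[symmetric] del: ennreal_plus)
    also have "\<dots> \<le> ennreal (?A * exp (\<kappa> * T * (norm ?m)^2 / 2))"
    proof (rule ennreal_leI)
      have "F * 1 \<le> F * exp (\<kappa> * T * (norm ?m)^2 / 2)" using F(2) \<kappa>(1) T_pos by (intro mult_left_mono) auto
      then show "F + K * \<Gamma> * exp (\<kappa> * T * (norm ?m)^2 / 2) * M \<le> ?A * exp (\<kappa> * T * (norm ?m)^2 / 2)"
        by (simp add: algebra_simps)
    qed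
    finally show ?thesis by (simp add: add_left_mono)
  qed
  moreover have "?A \<ge> 0" using F K \<Gamma> M by simp
  ultimately show ?thesis by blast
qed

lemma regular_nonneg:
  assumes "\<beta> \<ge> 0" and \<kappa>: "\<kappa> \<ge> 8" "\<kappa>^2 \<ge> (\<beta>^2 - \<beta> + 2) * \<kappa> + 2 * (\<beta>^2 + \<beta>)"
    and mom: "(\<integral>\<^sup>+b. ennreal (exp (\<kappa> * T * (norm (mpr b))^2)) \<partial>P0) < \<infinity>"
  shows "regular_drift_model T r \<alpha> \<beta> \<sigma> P0"
proof -
  obtain K where K: "K \<ge> 0" "\<And>b. moment 1 b \<le> ennreal (K * exp (\<kappa> * T * (norm (mpr b))^2 / 2))"
    using nn_integral_w_shift_le_gaussian[OF assms, of 1] by blast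
  have "moment C b < \<infinity>" for C b
  proof -
    obtain K where "moment C b \<le> ennreal (K * exp (\<kappa> * T * (norm (mpr b))^2 / 2))"
      using nn_integral_w_shift_le_gaussian[OF assms, of C] by blast
    then show ?thesis by (rule le_less_trans) simp
  qed
  then show ?thesis using mom by (intro regularI[OF _ K]) auto
qed

text \<open>Centring at the riskless drift only adds a linear and a constant term to the exponent;
  the strict gap between \<gamma>^2 and \<open>\<kappa> * T * nrm^2\<close> absorbs the linear
  one.\<close>

lemma exp_mpr_moment:
  assumes \<gamma>: "\<kappa> * T * nrm^2 < \<gamma>^2" "\<kappa> \<ge> 0"
    and mom: "(\<integral>\<^sup>+b. ennreal (exp (\<gamma>^2 * (norm b)^2)) \<partial>P0) < \<infinity>"
  shows "(\<integral>\<^sup>+b. ennreal (exp (\<kappa> * T * (norm (mpr b))^2)) \<partial>P0) < \<infinity>"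
proof -
  define a e where "a = \<kappa> * T * nrm^2" and "e = \<gamma>^2 - a"
  have a: "a \<ge> 0" "e > 0" using \<gamma> T_pos by (auto simp: a_def e_def)
  define R where "R = norm ((\<chi> i. r) :: real^'d)"
  let ?K = "(2 * a * R)^2 / (4 * e) + a * R^2"
  have le: "\<kappa> * T * (norm (mpr b))^2 \<le> ?K + \<gamma>^2 * (norm b)^2" for b
  proof -
    have "norm (mpr b) \<le> nrm * norm (b - (\<chi> i. r))" unfolding mpr_def by (rule norm_lin_le)
    also have "\<dots> \<le> nrm * (norm b + R)" unfolding R_def by (intro mult_left_mono norm_triangle_ineq4 nrm_nonneg)
    finally have "(norm (mpr b))^2 \<le> (nrm * (norm b + R))^2" by (intro power_mono) auto
    then have "\<kappa> * T * (norm (mpr b))^2 \<le> \<kappa> * T * (nrm * (norm b + R))^2"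
      using \<gamma>(2) T_pos by (intro mult_left_mono) auto
    also have "\<dots> = a * (norm b)^2 + (2 * a * R) * norm b + a * R^2"
      by (simp add: a_def power2_eq_square algebra_simps)
    also have "\<dots> \<le> a * (norm b)^2 + (e * (norm b)^2 + (2 * a * R)^2 / (4 * e)) + a * R^2"
      using linear_le_quadratic[OF a(2), of "2 * a * R" "norm b"] by linarith
    finally show ?thesis by (simp add: e_def algebra_simps)
  qed
  have "(\<integral>\<^sup>+b. ennreal (exp (\<kappa> * T * (norm (mpr b))^2)) \<partial>P0) \<le> (\<integral>\<^sup>+b. ennreal (exp ?K) * ennreal (exp (\<gamma>^2 * (norm b)^2)) \<partial>P0)"
    by (intro nn_integral_mono) (use le in \<open>simp add: ennreal_mult[symmetric] mult_exp_exp ennreal_leI\<close>)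
  also have "\<dots> = ennreal (exp ?K) * (\<integral>\<^sup>+b. ennreal (exp (\<gamma>^2 * (norm b)^2)) \<partial>P0)"
    by (rule nn_integral_cmult) measurable
  also have "\<dots> < \<infinity>" using mom by (simp add: ennreal_mult_less_top)
  finally show ?thesis .
qed

lemma exp_norm_moment:
  assumes \<gamma>: "\<gamma> > 0" and mom: "(\<integral>\<^sup>+b. ennreal (exp (\<gamma>^2 * (norm b)^2)) \<partial>P0) < \<infinity>"
  shows "(\<integral>\<^sup>+b. ennreal (exp (c * norm b)) \<partial>P0) < \<infinity>"
proof -
  have "(\<integral>\<^sup>+b. ennreal (exp (c * norm b)) \<partial>P0) \<le> (\<integral>\<^sup>+b. ennreal (exp (c^2 / (4 * \<gamma>^2))) * ennreal (exp (\<gamma>^2 * (norm b)^2)) \<partial>P0)"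
    using linear_le_quadratic[of "\<gamma>^2" c "norm _"] \<gamma>
    by (intro nn_integral_mono) (simp add: ennreal_mult[symmetric] mult_exp_exp ennreal_leI add.commute)
  also have "\<dots> = ennreal (exp (c^2 / (4 * \<gamma>^2))) * (\<integral>\<^sup>+b. ennreal (exp (\<gamma>^2 * (norm b)^2)) \<partial>P0)"
    by (rule nn_integral_cmult) measurable
  also have "\<dots> < \<infinity>" using mom by (simp add: ennreal_mult_less_top)
  finally show ?thesis .
qed

end

section \<open>Differentiating along bounded perturbations\<close>

lemma powr_add_le:
  fixes a b \<beta> :: real
  assumes "a \<ge> 0" "b \<ge> 0" "\<beta> \<ge> 0"
  shows "(a + b) powr \<beta> \<le> 2 powr \<beta> * (a powr \<beta> + b powr \<beta>)"
proof -
  have "(a + b) powr \<beta> \<le> (2 * max a b) powr \<beta>" using assms by (intro powr_mono2) auto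
  also have "\<dots> = 2 powr \<beta> * (max a b) powr \<beta>" using assms by (simp add: powr_mult)
  also have "\<dots> \<le> 2 powr \<beta> * (a powr \<beta> + b powr \<beta>)"
    by (intro mult_left_mono) (auto simp: max_def)
  finally show ?thesis .
qed

text \<open>Bounded support gives a single dominating function, a multiple of exp (c |z|), for all b
  at once; boundedness of V keeps the exponential cost finite.\<close>

locale bounded_perturbation = regular_drift_model T r \<alpha> \<beta> \<sigma> P0
  for T r \<alpha> \<beta> :: real and \<sigma> :: "real^'d^'d" and P0 :: "(real^'d) measure" +
  fixes V :: "real^'d \<Rightarrow> real^'d" and R K :: real
  assumes V_measurable [measurable]: "V \<in> borel_measurable borel"
    and V_bound: "\<And>b. norm (V b) \<le> K" and V_support: "\<And>b. norm b > R \<Longrightarrow> V b = 0"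
    and R_nonneg: "R \<ge> 0"
begin

definition push :: "real \<Rightarrow> (real^'d) measure" where
  "push t = distr P0 borel (\<lambda>b. b + t *\<^sub>R V b)"

lemma K_nonneg: "K \<ge> 0"
  using V_bound[of 0] norm_ge_zero order_trans by blast

lemma push_prob: "prob_space (push t)"
  unfolding push_def by (rule prob_space.prob_space_distr[OF P0_prob]) measurable

lemma push_sets: "sets (push t) = sets borel"
  by (simp add: push_def)

lemmas G_push_pos = G_pos[OF push_prob push_sets]

lemma G_push: "G (push t) z = (\<integral>b. L (b + t *\<^sub>R V b) z \<partial>P0)"
  unfolding G_def push_def by (rule integral_distr) measurable

lemma integrable_L_push: "integrable P0 (\<lambda>b. L (b + t *\<^sub>R V b) z)"
  using integrable_L[OF push_prob push_sets, of t z] unfolding push_def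
  by (subst (asm) integrable_distr_eq) auto

abbreviation lip :: "real \<Rightarrow> real \<Rightarrow> bool" where
  "lip C c \<equiv> \<forall>b z t. 0 \<le> t \<longrightarrow> t \<le> 1 \<longrightarrow> \<bar>L (b + t *\<^sub>R V b) z - L b z\<bar> \<le> t * (C * exp (c * norm z))"

text \<open>Outside the ball V vanishes and the difference is zero; inside,
  \<open>abs_L_diff_le\<close> applies with the bounds R and K.\<close>

lemma push_L_diff:
  "\<exists>C c. C \<ge> 0 \<and> c \<ge> 0 \<and> lip C c"
proof -
  obtain C c where C: "C \<ge> 0" "c \<ge> 0" "\<And>b v z t. norm b \<le> R \<Longrightarrow> norm v \<le> K \<Longrightarrow> 0 \<le> t \<Longrightarrow> t \<le> 1 \<Longrightarrow>
      \<bar>L (b + t *\<^sub>R v) z - L b z\<bar> \<le> t * (C * exp (c * norm z))"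
    using abs_L_diff_le[OF R_nonneg K_nonneg] by blast
  have "\<bar>L (b + t *\<^sub>R V b) z - L b z\<bar> \<le> t * (C * exp (c * norm z))" if "0 \<le> t" "t \<le> 1" for b z t
  proof (cases "norm b \<le> R")
    case False
    then show ?thesis using V_support[of b] that C by simp
  qed (use C(3) V_bound that in blast)
  then show ?thesis using C by blast
qed

text \<open>Derivative at t = 0 of the likelihood along b + t V b.\<close>

definition DL :: "real^'d \<Rightarrow> real^'d \<Rightarrow> real" where
  "DL z b = L b z * ((z - mean b) \<bullet> lin (V b))"

lemma abs_DL_le:
  assumes "lip C c"
  shows "\<bar>DL z b\<bar> \<le> C * exp (c * norm z)"
proof (rule tendsto_upperbound)
  show "((\<lambda>t. \<bar>(L (b + t *\<^sub>R V b) z - L b z) / t\<bar>) \<longlongrightarrow> \<bar>DL z b\<bar>) (at_right 0)"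
    unfolding DL_def by (intro tendsto_intros L_diff_quotient_tendsto)
  show "\<forall>\<^sub>F t in at_right 0. \<bar>(L (b + t *\<^sub>R V b) z - L b z) / t\<bar> \<le> C * exp (c * norm z)"
    using eventually_at_right_real[of 0 1]
  proof (rule eventually_mono)
    fix t :: real assume t: "t \<in> {0<..<1}"
    with assms[rule_format, of t b z] show "\<bar>(L (b + t *\<^sub>R V b) z - L b z) / t\<bar> \<le> C * exp (c * norm z)"
      by (simp add: abs_divide divide_le_eq mult.commute)
  qed simp
qed simp

text \<open>Fubini turns the derivative of the mixture in direction V, tested against \<omega>, into
  the L2 pairing of H with V.\<close>

lemma integral_DL_\<omega>: "(\<integral>z. (\<integral>b. DL z b \<partial>P0) * \<omega> z \<partial>lborel) = (\<integral>b. H b \<bullet> V b \<partial>P0) / (1 + \<beta>)"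
proof -
  interpret P0: prob_space P0 by (rule P0_prob)
  interpret pair_sigma_finite lborel P0 ..
  obtain C c where C: "C \<ge> 0" "c \<ge> 0" "lip C c"
    using push_L_diff by blast
  note DLb = abs_DL_le[OF C(3)]
  have mz [measurable]: "(\<lambda>z. DL z b) \<in> borel_measurable borel" for b unfolding DL_def by measurable
  have mb [measurable]: "DL z \<in> borel_measurable borel" for z unfolding DL_def by measurable
  have meas [measurable]: "(\<lambda>(z, b). DL z b * \<omega> z) \<in> borel_measurable (lborel \<Otimes>\<^sub>M P0)"
    unfolding DL_def by measurable
  have iDL: "integrable P0 (DL z)" for z
    by (rule P0.integrable_const_bound[where B="C * exp (c * norm z)"]) (auto intro!: AE_I2 DLb)
  have int: "integrable (lborel \<Otimes>\<^sub>M P0) (\<lambda>(z, b). DL z b * \<omega> z)"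
  proof (rule Fubini_integrable)
    show "integrable lborel (\<lambda>z. \<integral>b. norm (case (z, b) of (z, b) \<Rightarrow> DL z b * \<omega> z) \<partial>P0)"
    proof (rule Bochner_Integration.integrable_bound)
      show "integrable lborel (\<lambda>z. C * exp (c * norm z) * \<omega> z)"
        by (rule integrable_times_\<omega>[of _ C c]) (use C in auto)
      show "AE z in lborel. norm (\<integral>b. norm (case (z, b) of (z, b) \<Rightarrow> DL z b * \<omega> z) \<partial>P0) \<le> norm (C * exp (c * norm z) * \<omega> z)"
      proof (intro AE_I2)
        fix z
        have "(\<integral>b. norm (DL z b * \<omega> z) \<partial>P0) \<le> (\<integral>b. C * exp (c * norm z) * \<omega> z \<partial>P0)"
          using iDL[of z] DLb[of z] \<omega>_pos[of z] by (intro integral_mono) (auto simp: abs_mult intro!: mult_right_mono)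
        then show "norm (\<integral>b. norm (case (z, b) of (z, b) \<Rightarrow> DL z b * \<omega> z) \<partial>P0) \<le> norm (C * exp (c * norm z) * \<omega> z)"
          using C \<omega>_pos[of z] by (simp add: P0.prob_space)
      qed
    qed measurable
    show "AE z in lborel. integrable P0 (\<lambda>b. case (z, b) of (z, b) \<Rightarrow> DL z b * \<omega> z)"
      using iDL by auto
  qed measurable
  have "(\<integral>z. (\<integral>b. DL z b \<partial>P0) * \<omega> z \<partial>lborel) = (\<integral>z. (\<integral>b. DL z b * \<omega> z \<partial>P0) \<partial>lborel)"
    using iDL by simp
  also have "\<dots> = (\<integral>b. (\<integral>z. DL z b * \<omega> z \<partial>lborel) \<partial>P0)"
    using Fubini_integral[OF int] by simp
  also have "\<dots> = (\<integral>b. (H b \<bullet> V b) / (1 + \<beta>) \<partial>P0)"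
    using beta(2) by (simp add: H_inner DL_def)
  finally show ?thesis by simp
qed

text \<open>The right side stays integrable against exp (C |z|) times \<open>\<phi>\<close> for
  every C, by \<open>w_phi_exp\<close> and Gaussian decay. For \<beta> \<ge> 0 the perturbed mixture
  is at most \<open>G P0\<close> plus an exponential; for \<beta> < 0 it is bounded below, uniformly
  in t.\<close>

lemma G_push_powr_le:
  "\<exists>C c. C \<ge> 0 \<and> c \<ge> 0 \<and> (\<forall>t z. 0 \<le> t \<longrightarrow> t \<le> 1 \<longrightarrow> G (push t) z powr \<beta> \<le> C * (w z + exp (c * norm z)))"
proof (cases "\<beta> \<ge> 0")
  case True
  interpret P0: prob_space P0 by (rule P0_prob)
  obtain C c where C: "C \<ge> 0" "c \<ge> 0" "lip C c"
    using push_L_diff by blast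
  let ?D = "2 powr \<beta> * (1 + C powr \<beta>)"
  have "G (push t) z powr \<beta> \<le> ?D * (w z + exp (\<beta> * c * norm z))" if t: "0 \<le> t" "t \<le> 1" for t z
  proof -
    have "G (push t) z \<le> (\<integral>b. L b z + C * exp (c * norm z) \<partial>P0)"
      unfolding G_push
    proof (rule integral_mono)
      fix b
      have "t * (C * exp (c * norm z)) \<le> 1 * (C * exp (c * norm z))" using t C by (intro mult_right_mono) auto
      then show "L (b + t *\<^sub>R V b) z \<le> L b z + C * exp (c * norm z)" using C(3)[rule_format, OF t, of b z] by linarith
    qed (use integrable_L_push integrable_L_P0 in auto)
    also have "\<dots> = G P0 z + C * exp (c * norm z)"
      using integrable_L_P0 by (simp add: G_def P0.prob_space)
    finally have "G (push t) z powr \<beta> \<le> (G P0 z + C * exp (c * norm z)) powr \<beta>"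
      using G_push_pos[of t z] True by (intro powr_mono2) auto
    also have "\<dots> \<le> 2 powr \<beta> * (w z + (C * exp (c * norm z)) powr \<beta>)"
      unfolding w_def using G_P0_pos[of z] C True by (intro powr_add_le) auto
    also have "(C * exp (c * norm z)) powr \<beta> = C powr \<beta> * exp (\<beta> * c * norm z)"
      using C by (simp add: powr_mult exp_powr_real mult_ac)
    also have "2 powr \<beta> * (w z + C powr \<beta> * exp (\<beta> * c * norm z)) \<le> 2 powr \<beta> * ((1 + C powr \<beta>) * (w z + exp (\<beta> * c * norm z)))"
      using w_pos[of z] by (intro mult_left_mono) (auto simp: algebra_simps)
    finally show ?thesis by (simp add: mult.assoc)
  qed
  moreover have "?D \<ge> 0" "\<beta> * c \<ge> 0" using C True by auto
  ultimately show ?thesis by blast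
next
  case False
  obtain c k where ck: "c > 0" "k \<ge> 0" "\<And>f z. f \<in> borel_measurable borel \<Longrightarrow> (\<forall>b. norm (f b - b) \<le> K) \<Longrightarrow>
      c * exp (- k * norm z) \<le> (\<integral>b. L (f b) z \<partial>P0)"
    using integral_L_perturbed_ge[OF K_nonneg] by blast
  have "G (push t) z powr \<beta> \<le> c powr \<beta> * (w z + exp ((- k * \<beta>) * norm z))" if t: "0 \<le> t" "t \<le> 1" for t z
  proof -
    have "\<forall>b. norm ((b + t *\<^sub>R V b) - b) \<le> K"
    proof
      fix b
      have "t * norm (V b) \<le> 1 * K" using t V_bound[of b] by (intro mult_mono) auto
      then show "norm ((b + t *\<^sub>R V b) - b) \<le> K" using t by simp
    qed
    then have "c * exp (- k * norm z) \<le> G (push t) z" unfolding G_push by (intro ck(3)) measurable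
    then have "G (push t) z powr \<beta> \<le> (c * exp (- k * norm z)) powr \<beta>"
      using ck False by (intro powr_mono2') auto
    also have "\<dots> = c powr \<beta> * exp ((- k * \<beta>) * norm z)"
      using ck(1) by (simp add: powr_mult exp_powr_real mult_ac)
    also have "\<dots> \<le> c powr \<beta> * (w z + exp ((- k * \<beta>) * norm z))"
      using w_pos[of z] by (intro mult_left_mono) auto
    finally show ?thesis .
  qed
  moreover have "- k * \<beta> \<ge> 0" using ck False by (simp add: mult_nonneg_nonpos)
  ultimately show ?thesis using ck(1) by (intro exI[of _ "c powr \<beta>"] exI[of _ "- k * \<beta>"]) auto
qed

text \<open>The power is taken at the perturbed mixture rather than at \<open>G P0\<close>: the
  tangent there bounds J (push t) from the side opposite to the linear bounds used for the ball. Its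
  behaviour as t tends to 0 is all that is needed from the path.\<close>

abbreviation DG :: "real \<Rightarrow> real^'d \<Rightarrow> real" where
  "DG t z \<equiv> G (push t) z powr \<beta> * (G (push t) z - G P0 z) * \<phi> z"

definition DJ :: "real \<Rightarrow> real" where
  "DJ t = (\<integral>z. DG t z \<partial>lborel)"

lemma G_push_measurable [measurable]: "G (push t) \<in> borel_measurable borel"
  by (rule G_measurable[OF push_prob push_sets])

lemma G_push_diff_le:
  assumes "lip C c"
    and t: "0 \<le> t" "t \<le> 1"
  shows "\<bar>G (push t) z - G P0 z\<bar> \<le> t * (C * exp (c * norm z))"
proof -
  interpret P0: prob_space P0 by (rule P0_prob)
  have "G (push t) z - G P0 z = (\<integral>b. L (b + t *\<^sub>R V b) z - L b z \<partial>P0)"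
    unfolding G_push G_def[of P0] using integrable_L_push integrable_L_P0 by simp
  also have "\<bar>\<dots>\<bar> \<le> (\<integral>b. \<bar>L (b + t *\<^sub>R V b) z - L b z\<bar> \<partial>P0)" by (rule integral_abs_bound)
  also have "\<dots> \<le> (\<integral>b. t * (C * exp (c * norm z)) \<partial>P0)"
    using integrable_L_push integrable_L_P0 assms
    by (intro integral_mono) auto
  finally show ?thesis by (simp add: P0.prob_space)
qed

lemma integrable_phi_exp: "integrable lborel (\<lambda>z. exp (c * norm z) * \<phi> z)"
  using nn_integral_phi_exp_finite[of c] phi_pos by (intro integrableI_nonneg) (auto simp: less_imp_le)

text \<open>As g does not depend on t, this gives integrability for each t and also dominates all
  quotients DG t z / t.\<close>

lemma DJ_bounds:
  "\<exists>g. integrable lborel g \<and> (\<forall>t z. 0 < t \<longrightarrow> t \<le> 1 \<longrightarrow>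
    \<bar>DG t z\<bar> \<le> t * g z)"
proof -
  obtain C c where C: "C \<ge> 0" "c \<ge> 0" "lip C c"
    using push_L_diff by blast
  obtain D d where D: "D \<ge> 0" "d \<ge> 0" "\<And>t z. 0 \<le> t \<Longrightarrow> t \<le> 1 \<Longrightarrow> G (push t) z powr \<beta> \<le> D * (w z + exp (d * norm z))"
    using G_push_powr_le by blast
  define g where "g z = D * C * (exp (c * norm z) * \<omega> z) + D * C * (exp ((d + c) * norm z) * \<phi> z)" for z
  have "integrable lborel g" unfolding g_def
    by (intro Bochner_Integration.integrable_add integrable_mult_right integrable_exp_\<omega> integrable_phi_exp)
  moreover have "\<bar>DG t z\<bar> \<le> t * g z" if t: "0 < t" "t \<le> 1" for t z
  proof -
    have "\<bar>DG t z\<bar> = G (push t) z powr \<beta> * \<bar>G (push t) z - G P0 z\<bar> * \<phi> z"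
      using phi_pos[of z] by (simp add: abs_mult)
    also have "\<dots> \<le> (D * (w z + exp (d * norm z))) * (t * (C * exp (c * norm z))) * \<phi> z"
      using t D C w_pos[of z] phi_pos[of z] G_push_diff_le[OF C(3), of t z]
      by (intro mult_right_mono mult_mono D(3)) (auto intro!: add_nonneg_nonneg mult_nonneg_nonneg)
    also have "\<dots> = t * g z" unfolding g_def \<omega>_def by (simp add: algebra_simps exp_add)
    finally show ?thesis .
  qed
  ultimately show ?thesis by blast
qed

lemma integrable_DJ:
  assumes "0 < t" "t \<le> 1"
  shows "integrable lborel (\<lambda>z. DG t z)"
proof -
  obtain g where g: "integrable lborel g" "\<And>t z. 0 < t \<Longrightarrow> t \<le> 1 \<Longrightarrow>
    \<bar>DG t z\<bar> \<le> t * g z"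
    using DJ_bounds by blast
  show ?thesis
  proof (rule Bochner_Integration.integrable_bound)
    show "integrable lborel (\<lambda>z. t * g z)" using g by simp
    show "AE z in lborel. norm (DG t z) \<le> norm (t * g z)"
    proof (intro AE_I2)
      fix z
      show "norm (DG t z) \<le> norm (t * g z)"
        using g(2)[OF assms, of z] unfolding real_norm_def by linarith
    qed
  qed measurable
qed

text \<open>Two nested limits: for fixed z the mixture is differentiated under P0, then the quotient
  is passed to the limit under the integral in z.\<close>

lemma DJ_tendsto: "((\<lambda>t. (1 + \<beta>) * DJ t / t) \<longlongrightarrow> (\<integral>b. H b \<bullet> V b \<partial>P0)) (at_right 0)"
proof (rule tendsto_at_right_sequentially[of 0 1])
  interpret P0: prob_space P0 by (rule P0_prob)
  fix S :: "nat \<Rightarrow> real" assume S: "\<And>n. 0 < S n" "\<And>n. S n < 1" "S \<longlonglongrightarrow> 0"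
  have S': "filterlim S (at_right 0) sequentially"
    using S by (intro filterlim_at_withinI) (auto intro!: always_eventually)
  obtain C c where C: "C \<ge> 0" "c \<ge> 0" "lip C c"
    using push_L_diff by blast
  obtain g where g: "integrable lborel g" "\<And>t z. 0 < t \<Longrightarrow> t \<le> 1 \<Longrightarrow>
    \<bar>DG t z\<bar> \<le> t * g z"
    using DJ_bounds by blast
  have mb [measurable]: "DL z \<in> borel_measurable borel" for z unfolding DL_def by measurable
  have Gq: "(\<lambda>n. (G (push (S n)) z - G P0 z) / S n) \<longlonglongrightarrow> (\<integral>b. DL z b \<partial>P0)" for z
  proof -
    have "(\<lambda>n. (\<integral>b. (L (b + S n *\<^sub>R V b) z - L b z) / S n \<partial>P0)) \<longlonglongrightarrow> (\<integral>b. DL z b \<partial>P0)"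
    proof (rule integral_dominated_convergence)
      show "integrable P0 (\<lambda>b. C * exp (c * norm z))" by simp
      show "AE b in P0. (\<lambda>n. (L (b + S n *\<^sub>R V b) z - L b z) / S n) \<longlonglongrightarrow> DL z b"
        unfolding DL_def by (intro AE_I2 filterlim_compose[OF L_diff_quotient_tendsto S'])
      fix n
      show "AE b in P0. norm ((L (b + S n *\<^sub>R V b) z - L b z) / S n) \<le> C * exp (c * norm z)"
      proof (intro AE_I2)
        fix b
        show "norm ((L (b + S n *\<^sub>R V b) z - L b z) / S n) \<le> C * exp (c * norm z)"
          using C(3)[rule_format, of "S n" b z] S(1,2)[of n] by (simp add: abs_divide divide_le_eq mult.commute)
      qed
    qed measurable
    moreover have "(\<integral>b. (L (b + S n *\<^sub>R V b) z - L b z) / S n \<partial>P0) = (G (push (S n)) z - G P0 z) / S n" for n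
      unfolding G_push G_def[of P0] using integrable_L_push integrable_L_P0 by simp
    ultimately show ?thesis by (simp only:)
  qed
  \<comment> \<open>Convergence of the quotients forces continuity of the mixture, which the factor
    \<open>G (push t) z powr \<beta>\<close> requires.\<close>
  have Gt: "(\<lambda>n. G (push (S n)) z) \<longlonglongrightarrow> G P0 z" for z
  proof -
    have "(\<lambda>n. (G (push (S n)) z - G P0 z) / S n * S n + G P0 z) \<longlonglongrightarrow> (\<integral>b. DL z b \<partial>P0) * 0 + G P0 z"
      by (intro tendsto_intros Gq S)
    moreover have "(G (push (S n)) z - G P0 z) / S n * S n + G P0 z = G (push (S n)) z" for n
      using S(1)[of n] by simp
    ultimately show ?thesis by simp
  qed
  have "(\<lambda>n. (\<integral>z. (DG (S n) z) / S n \<partial>lborel)) \<longlonglongrightarrow> (\<integral>z. (\<integral>b. DL z b \<partial>P0) * \<omega> z \<partial>lborel)"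
  proof (rule integral_dominated_convergence)
    show "integrable lborel g" by fact
    show "AE z in lborel. (\<lambda>n. (DG (S n) z) / S n) \<longlonglongrightarrow> (\<integral>b. DL z b \<partial>P0) * \<omega> z"
    proof (intro AE_I2)
      fix z
      have "(\<lambda>n. G (push (S n)) z powr \<beta> * ((G (push (S n)) z - G P0 z) / S n) * \<phi> z) \<longlonglongrightarrow> G P0 z powr \<beta> * (\<integral>b. DL z b \<partial>P0) * \<phi> z"
        using G_P0_pos[of z] by (intro tendsto_intros Gt Gq) auto
      then show "(\<lambda>n. (DG (S n) z) / S n) \<longlonglongrightarrow> (\<integral>b. DL z b \<partial>P0) * \<omega> z"
        by (simp add: \<omega>_def w_def mult_ac)
    qed
    fix n
    show "AE z in lborel. norm ((DG (S n) z) / S n) \<le> g z"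
    proof (intro AE_I2)
      fix z
      show "norm ((DG (S n) z) / S n) \<le> g z"
        using g(2)[of "S n" z] S(1,2)[of n] unfolding norm_divide by (simp add: divide_le_eq mult.commute)
    qed
  next
    show "(\<lambda>z. (\<integral>b. DL z b \<partial>P0) * \<omega> z) \<in> borel_measurable lborel"
      unfolding DL_def by measurable
  qed measurable
  then have "(\<lambda>n. DJ (S n) / S n) \<longlonglongrightarrow> (\<integral>b. H b \<bullet> V b \<partial>P0) / (1 + \<beta>)"
    unfolding integral_DL_\<omega> by (simp add: DJ_def)
  then have "(\<lambda>n. (1 + \<beta>) * (DJ (S n) / S n)) \<longlonglongrightarrow> (1 + \<beta>) * ((\<integral>b. H b \<bullet> V b \<partial>P0) / (1 + \<beta>))"
    by (rule tendsto_mult_left)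
  then show "(\<lambda>n. (1 + \<beta>) * DJ (S n) / S n) \<longlonglongrightarrow> (\<integral>b. H b \<bullet> V b \<partial>P0)"
    using beta(2) by simp
qed simp

section \<open>One-sided bounds for J along the perturbed laws\<close>

lemma integral_G_powr_P0:
  "integrable lborel (\<lambda>z. G P0 z powr (1 + \<beta>) * \<phi> z)"
  "(\<integral>z. G P0 z powr (1 + \<beta>) * \<phi> z \<partial>lborel) = enn2real (J P0)"
proof -
  have "(\<integral>\<^sup>+z. ennreal (G P0 z powr (1 + \<beta>) * \<phi> z) \<partial>lborel) < \<infinity>"
    unfolding Jfun_eq[OF P0_prob P0_sets, symmetric] Jfun_P0 by simp
  then show i: "integrable lborel (\<lambda>z. G P0 z powr (1 + \<beta>) * \<phi> z)"
    using phi_pos by (intro integrableI_nonneg) (auto simp: less_imp_le)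
  show "(\<integral>z. G P0 z powr (1 + \<beta>) * \<phi> z \<partial>lborel) = enn2real (J P0)"
    unfolding Jfun_eq[OF P0_prob P0_sets] using phi_pos by (subst integral_eq_nn_integral) (auto simp: less_imp_le)
qed

text \<open>The tangent inequality of the power at \<open>G (push t) z\<close>, evaluated at
  \<open>G P0 z\<close> and solved for the perturbed power: an upper bound for it when \<beta> \<ge>
  0, a lower bound when \<beta> \<le> 0.\<close>

definition tangent :: "real \<Rightarrow> real^'d \<Rightarrow> real" where
  "tangent t z = (G P0 z powr (1 + \<beta>) + (1 + \<beta>) * (G (push t) z powr \<beta> * (G (push t) z - G P0 z))) * \<phi> z"

lemma tangent_integral:
  assumes "0 < t" "t \<le> 1"
  shows "integrable lborel (tangent t)" "(\<integral>z. tangent t z \<partial>lborel) = enn2real (J P0) + (1 + \<beta>) * DJ t"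
proof -
  have eq: "tangent t = (\<lambda>z. G P0 z powr (1 + \<beta>) * \<phi> z + (1 + \<beta>) * DG t z)"
    by (simp add: tangent_def fun_eq_iff algebra_simps)
  show "integrable lborel (tangent t)" unfolding eq
    by (intro Bochner_Integration.integrable_add integral_G_powr_P0 integrable_mult_right integrable_DJ assms)
  show "(\<integral>z. tangent t z \<partial>lborel) = enn2real (J P0) + (1 + \<beta>) * DJ t"
    unfolding eq DJ_def using integral_G_powr_P0 integrable_DJ[OF assms] by simp
qed

lemma Jfun_push_le:
  assumes "\<beta> \<ge> 0" and t: "0 < t" "t \<le> 1"
  shows "J (push t) < \<infinity>" "enn2real (J (push t)) \<le> enn2real (J P0) + (1 + \<beta>) * DJ t"
proof -
  have le: "G (push t) z powr (1 + \<beta>) * \<phi> z \<le> tangent t z" for z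
    unfolding tangent_def
    using powr_tangent_le[OF G_P0_pos G_push_pos assms(1), of z t z] G_push_pos[of t z] phi_pos[of z]
    by (intro mult_right_mono) (simp_all add: powr_add algebra_simps)
  then have nonneg: "tangent t z \<ge> 0" for z
    using phi_pos[of z] by (meson less_imp_le mult_nonneg_nonneg order_trans powr_ge_zero)
  have "J (push t) \<le> (\<integral>\<^sup>+z. ennreal (tangent t z) \<partial>lborel)"
    unfolding Jfun_eq[OF push_prob push_sets] by (intro nn_integral_mono ennreal_leI le)
  also have "\<dots> = ennreal (\<integral>z. tangent t z \<partial>lborel)"
    using nonneg by (intro nn_integral_eq_integral tangent_integral t) auto
  finally have *: "J (push t) \<le> ennreal (\<integral>z. tangent t z \<partial>lborel)" .
  then show "J (push t) < \<infinity>" by (rule le_less_trans) simp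
  show "enn2real (J (push t)) \<le> enn2real (J P0) + (1 + \<beta>) * DJ t"
    unfolding tangent_integral(2)[OF t, symmetric]
    using nonneg by (intro enn2real_leI * integral_nonneg_AE) auto
qed

text \<open>The tangent now bounds J from below and cannot show that it is finite; the upper bound
  over the ball supplies finiteness.\<close>

lemma Jfun_push_ge:
  assumes "\<beta> \<le> 0" and t: "0 < t" "t \<le> 1" and fin: "J (push t) < \<infinity>"
  shows "enn2real (J P0) + (1 + \<beta>) * DJ t \<le> enn2real (J (push t))"
proof -
  have le: "tangent t z \<le> G (push t) z powr (1 + \<beta>) * \<phi> z" for z
    unfolding tangent_def
    using powr_tangent_ge[OF G_P0_pos G_push_pos assms(1) beta(2), of z t z] G_push_pos[of t z] phi_pos[of z]
    by (intro mult_right_mono) (simp_all add: powr_add algebra_simps)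
  have "integrable lborel (\<lambda>z. G (push t) z powr (1 + \<beta>) * \<phi> z)"
    using fin phi_pos unfolding Jfun_eq[OF push_prob push_sets] by (intro integrableI_nonneg) (auto simp: less_imp_le)
  then have "(\<integral>z. tangent t z \<partial>lborel) \<le> (\<integral>z. G (push t) z powr (1 + \<beta>) * \<phi> z \<partial>lborel)"
    by (intro integral_mono tangent_integral t le)
  also have "\<dots> = enn2real (J (push t))"
    unfolding Jfun_eq[OF push_prob push_sets] using phi_pos by (subst integral_eq_nn_integral) (auto simp: less_imp_le)
  finally show ?thesis by (simp add: tangent_integral[OF t])
qed

end

section \<open>Asymptotically optimal perturbations\<close>

text \<open>At radius \<delta> the largest n with accuracy 1 / (n + 1) attainable is used. Capping n
  by 1 / \<delta> keeps the candidate set finite, so that the maximum exists, and still lets n tend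
  to infinity.\<close>

lemma diagonal_choice_at_right_0:
  fixes P :: "real \<Rightarrow> real \<Rightarrow> 'a \<Rightarrow> bool"
  assumes ex: "\<And>\<epsilon>. \<epsilon> > 0 \<Longrightarrow> \<forall>\<^sub>F \<delta> in at_right 0. \<exists>x. P \<epsilon> \<delta> x"
    and mono: "\<And>\<epsilon> \<epsilon>' \<delta> x. P \<epsilon> \<delta> x \<Longrightarrow> \<epsilon> \<le> \<epsilon>' \<Longrightarrow> \<delta> > 0 \<Longrightarrow> P \<epsilon>' \<delta> x"
  shows "\<exists>X. \<forall>\<epsilon>>0. \<forall>\<^sub>F \<delta> in at_right 0. P \<epsilon> \<delta> (X \<delta>)"
proof -
  define A where "A \<delta> = {n. n \<le> nat \<lfloor>1 / \<delta>\<rfloor> \<and> (\<exists>x. P (1 / real (Suc n)) \<delta> x)}" for \<delta> :: real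
  define X where "X \<delta> = (SOME x. P (1 / real (Suc (Max (A \<delta>)))) \<delta> x)" for \<delta>
  have "\<forall>\<^sub>F \<delta> in at_right 0. P \<epsilon> \<delta> (X \<delta>)" if "\<epsilon> > 0" for \<epsilon>
  proof -
    from that obtain N where N: "1 / real (Suc N) < \<epsilon>" using reals_Archimedean by (auto simp: inverse_eq_divide)
    have "\<forall>\<^sub>F \<delta> in at_right 0. \<exists>x. P (1 / real (Suc N)) \<delta> x" by (rule ex) simp
    moreover have "\<forall>\<^sub>F \<delta> in at_right 0. \<delta> \<in> {0<..<1 / real (Suc N)}" by (rule eventually_at_right_real) simp
    ultimately show "\<forall>\<^sub>F \<delta> in at_right 0. P \<epsilon> \<delta> (X \<delta>)"
    proof eventually_elim
      case (elim \<delta>)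
      then have \<delta>: "\<delta> > 0" "\<delta> < 1 / real (Suc N)" by auto
      then have "real N \<le> 1 / \<delta>" by (simp add: field_simps)
      then have "N \<le> nat \<lfloor>1 / \<delta>\<rfloor>" by (simp add: le_nat_floor)
      with elim have NA: "N \<in> A \<delta>" by (simp add: A_def)
      have fin: "finite (A \<delta>)" by (simp add: A_def)
      have "Max (A \<delta>) \<in> A \<delta>" using fin NA by (intro Max_in) auto
      then have "\<exists>x. P (1 / real (Suc (Max (A \<delta>)))) \<delta> x" by (simp add: A_def)
      then have PX: "P (1 / real (Suc (Max (A \<delta>)))) \<delta> (X \<delta>)" unfolding X_def by (rule someI_ex)
      have "N \<le> Max (A \<delta>)" using fin NA by simp
      then have "1 / real (Suc (Max (A \<delta>))) \<le> 1 / real (Suc N)" by (simp add: frac_le)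
      with N have "1 / real (Suc (Max (A \<delta>))) \<le> \<epsilon>" by linarith
      then show ?case using mono[OF PX _ \<delta>(1)] by blast
    qed
  qed
  then show ?thesis by blast
qed

text \<open>The joint law of f b and b is a coupling, so its cost bounds the transport
  distance.\<close>

lemma distr_in_Uset:
  fixes P :: "'a::euclidean_space measure"
  assumes P: "prob_space P" and sets_P [measurable_cong]: "sets P = sets borel"
    and f [measurable]: "f \<in> borel_measurable borel"
    and cost: "(\<integral>\<^sup>+b. ennreal (ctau \<tau> (f b) b) \<partial>P) \<le> ennreal \<delta>"
  shows "distr P borel f \<in> Uset \<tau> P \<delta>"
proof -
  have fP [measurable]: "f \<in> borel_measurable P" by measurable
  have pm: "(\<lambda>b. (f b, b)) \<in> measurable P (borel \<Otimes>\<^sub>M borel)" by measurable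
  let ?\<pi> = "distr P (borel \<Otimes>\<^sub>M borel) (\<lambda>b. (f b, b))"
  have "distr ?\<pi> borel fst = distr P borel f"
    by (subst distr_distr[OF _ pm]) (auto simp: comp_def)
  moreover have "distr ?\<pi> borel snd = P"
    by (subst distr_distr[OF _ pm]) (auto simp: comp_def intro!: distr_id2 sets_P[symmetric])
  ultimately have mem: "?\<pi> \<in> couplings (distr P borel f) P"
    using prob_space.prob_space_distr[OF P pm] by (simp add: couplings_def)
  have "Dc (ctau \<tau>) (distr P borel f) P \<le> cost \<tau> ?\<pi>"
    unfolding Dc_def by (rule INF_lower[OF mem])
  also have "\<dots> = (\<integral>\<^sup>+b. ennreal (ctau \<tau> (f b) b) \<partial>P)"
    by (subst nn_integral_distr[OF pm]) (auto simp: ctau_def)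
  also note cost
  finally show ?thesis using prob_space.prob_space_distr[OF P fP] by (simp add: Uset_def)
qed

context regular_drift_model
begin

lemma N_square: "N^2 = (\<integral>b. (norm (H b))^2 \<partial>P0)"
  by (simp add: HnormL2_def)

text \<open>Dominated convergence brings the truncation as close as desired to s H / N in L2. The
  norm is kept strictly below 1; the spare room pays for the excess of the exponential over the
  quadratic cost.\<close>

lemma truncated_direction:
  assumes N: "N > 0" and \<epsilon>: "\<epsilon> > 0" and s: "\<bar>s\<bar> = 1"
  shows "\<exists>V n. bounded_perturbation T r \<alpha> \<beta> \<sigma> P0 V (real n) (real n / N) \<and>
    (\<integral>\<^sup>+b. ennreal ((norm (V b - (s / N) *\<^sub>R H b))^2) \<partial>P0) \<le> ennreal \<epsilon> \<and>
    integrable P0 (\<lambda>b. (norm (V b))^2) \<and> (\<integral>b. (norm (V b))^2 \<partial>P0) < 1 \<and> N - \<epsilon> \<le> s * (\<integral>b. H b \<bullet> V b \<partial>P0)"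
proof -
  define B where "B n = {b. norm b \<le> real n \<and> norm (H b) \<le> real n}" for n
  \<comment> \<open>The indicator bounds both b and H b. The factor in front of it tends to 1 yet
    keeps the L2 norm strictly below 1.\<close>
  define f where "f n b = (1 - 1 / real (n + 2)) * indicator (B n) b" for n b
  define V where "V n b = (s / N * f n b) *\<^sub>R H b" for n b
  have [measurable]: "B n \<in> sets borel" for n unfolding B_def by measurable
  have fm [measurable]: "f n \<in> borel_measurable borel" for n unfolding f_def by measurable
  have Vm [measurable]: "V n \<in> borel_measurable borel" for n unfolding V_def by measurable
  have f01: "0 \<le> f n b" "f n b \<le> 1 - 1 / real (n + 2)" "f n b \<le> 1" for n b
    by (auto simp: f_def indicator_def divide_le_eq_1)
  have f2: "(f n b)^2 \<le> 1" "(1 - f n b)^2 \<le> 1" for n b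
    using f01[of n b] by (auto simp: power_le_one)
  have iH: "integrable P0 (\<lambda>b. (norm (H b))^2 / N^2)" using H_square_integrable by simp
  have dom: "norm (a * (norm (H b))^2 / N^2) \<le> (norm (H b))^2 / N^2" if "0 \<le> a" "a \<le> 1" for a b
    using mult_right_mono[OF that(2), of "(norm (H b))^2"] that by (simp add: divide_right_mono abs_mult)
  have flim: "(\<lambda>n. f n b) \<longlonglongrightarrow> 1" for b
  proof -
    have "\<forall>\<^sub>F n in sequentially. f n b = 1 - 1 / real (n + 2)"
      using eventually_ge_at_top[of "nat \<lceil>max (norm b) (norm (H b))\<rceil>"]
    proof eventually_elim
      case (elim n)
      then have "max (norm b) (norm (H b)) \<le> real n" by linarith
      then show ?case by (simp add: f_def B_def)
    qed
    moreover have "(\<lambda>n. 1 - 1 / real (n + 2)) \<longlonglongrightarrow> 1 - 0"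
      by (intro tendsto_diff tendsto_const LIMSEQ_ignore_initial_segment[OF lim_1_over_n])
    ultimately show ?thesis by (simp add: tendsto_cong)
  qed
  have s2: "s^2 = 1" using s by (metis abs_square_eq_1 power2_abs)
  have nV: "(norm (V n b))^2 = (f n b)^2 * (norm (H b))^2 / N^2" for n b
    by (simp add: V_def power_mult_distrib power_divide s2 s abs_mult)
  have bp: "bounded_perturbation T r \<alpha> \<beta> \<sigma> P0 (V n) (real n) (real n / N)" for n
  proof unfold_locales
    fix b
    show "norm (V n b) \<le> real n / N"
    proof (cases "b \<in> B n")
      case True
      have "norm (V n b) = f n b * norm (H b) / N" using N s f01(1)[of n b] by (simp add: V_def abs_mult abs_divide)
      also have "\<dots> \<le> 1 * real n / N"
        using True N f01[of n b] by (intro divide_right_mono mult_mono) (auto simp: B_def)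
      finally show ?thesis by simp
    qed (use N in \<open>simp add: V_def f_def\<close>)
    show "norm b > real n \<Longrightarrow> V n b = 0" by (simp add: V_def f_def B_def)
  qed (auto)
  have iV: "integrable P0 (\<lambda>b. (norm (V n b))^2)" for n
    unfolding nV by (rule Bochner_Integration.integrable_bound[OF iH]) (use dom f2 in \<open>auto intro!: AE_I2\<close>)
  have if2: "integrable P0 (\<lambda>b. (1 - f n b)^2 * (norm (H b))^2 / N^2)" for n
    by (rule Bochner_Integration.integrable_bound[OF iH]) (use dom f2 in \<open>auto intro!: AE_I2\<close>)
  have V1: "(\<integral>b. (norm (V n b))^2 \<partial>P0) < 1" for n
  proof -
    define a where "a = 1 - 1 / real (n + 2)"
    have a: "0 \<le> a" "a < 1" by (auto simp: a_def divide_le_eq_1)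
    have "(\<integral>b. (norm (V n b))^2 \<partial>P0) \<le> (\<integral>b. a^2 * (norm (H b))^2 / N^2 \<partial>P0)"
    proof (rule integral_mono[OF iV])
      show "integrable P0 (\<lambda>b. a^2 * (norm (H b))^2 / N^2)" using H_square_integrable by simp
      fix b show "(norm (V n b))^2 \<le> a^2 * (norm (H b))^2 / N^2"
        unfolding nV a_def using f01[of n b] by (intro divide_right_mono mult_right_mono power_mono) auto
    qed
    also have "\<dots> = a^2" using N by (simp flip: N_square)
    also have "a^2 < 1" using a by (simp add: power_less_one_iff abs_square_less_1)
    finally show ?thesis .
  qed
  have lim1: "(\<lambda>n. \<integral>b. (1 - f n b)^2 * (norm (H b))^2 / N^2 \<partial>P0) \<longlonglongrightarrow> (\<integral>b. 0 \<partial>P0)"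
  proof (rule integral_dominated_convergence[OF _ _ iH])
    show "AE b in P0. (\<lambda>n. (1 - f n b)^2 * (norm (H b))^2 / N^2) \<longlonglongrightarrow> 0"
    proof (intro AE_I2)
      fix b
      have "(\<lambda>n. (1 - f n b)^2 * (norm (H b))^2 / N^2) \<longlonglongrightarrow> (1 - 1)^2 * (norm (H b))^2 / N^2"
        using N by (intro tendsto_intros flim) auto
      then show "(\<lambda>n. (1 - f n b)^2 * (norm (H b))^2 / N^2) \<longlonglongrightarrow> 0" by simp
    qed
    show "AE b in P0. norm ((1 - f n b)^2 * (norm (H b))^2 / N^2) \<le> (norm (H b))^2 / N^2" for n
      by (intro AE_I2 dom f2) simp
  qed measurable
  have lim2: "(\<lambda>n. \<integral>b. f n b * (norm (H b))^2 / N \<partial>P0) \<longlonglongrightarrow> (\<integral>b. (norm (H b))^2 / N \<partial>P0)"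
  proof (rule integral_dominated_convergence)
    show "integrable P0 (\<lambda>b. (norm (H b))^2 / N)" using H_square_integrable by simp
    show "AE b in P0. (\<lambda>n. f n b * (norm (H b))^2 / N) \<longlonglongrightarrow> (norm (H b))^2 / N"
    proof (intro AE_I2)
      fix b
      have "(\<lambda>n. f n b * (norm (H b))^2 / N) \<longlonglongrightarrow> 1 * (norm (H b))^2 / N"
        using N by (intro tendsto_intros flim) auto
      then show "(\<lambda>n. f n b * (norm (H b))^2 / N) \<longlonglongrightarrow> (norm (H b))^2 / N" by simp
    qed
    show "AE b in P0. norm (f n b * (norm (H b))^2 / N) \<le> (norm (H b))^2 / N" for n
    proof (intro AE_I2)
      fix b
      have "f n b * (norm (H b))^2 \<le> 1 * (norm (H b))^2" using f01[of n b] by (intro mult_right_mono) auto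
      then show "norm (f n b * (norm (H b))^2 / N) \<le> (norm (H b))^2 / N"
        using f01[of n b] N by (simp add: divide_right_mono abs_mult)
    qed
  qed measurable
  have HV: "s * (\<integral>b. H b \<bullet> V n b \<partial>P0) = (\<integral>b. f n b * (norm (H b))^2 / N \<partial>P0)" for n
  proof -
    have "s * (\<integral>b. H b \<bullet> V n b \<partial>P0) = (\<integral>b. s * (H b \<bullet> V n b) \<partial>P0)" by simp
    also have "(\<lambda>b. s * (H b \<bullet> V n b)) = (\<lambda>b. s^2 * f n b * (norm (H b))^2 / N)"
      by (simp add: V_def fun_eq_iff dot_square_norm power2_eq_square[of s])
    finally show ?thesis by (simp add: s2)
  qed
  have "(\<integral>b. (norm (H b))^2 / N \<partial>P0) = N" using N by (simp flip: N_square) (simp add: power2_eq_square)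
  with lim2 have "\<forall>\<^sub>F n in sequentially. (\<integral>b. f n b * (norm (H b))^2 / N \<partial>P0) > N - \<epsilon>"
    using \<epsilon> by (intro order_tendstoD(1)) auto
  moreover have "\<forall>\<^sub>F n in sequentially. (\<integral>b. (1 - f n b)^2 * (norm (H b))^2 / N^2 \<partial>P0) < \<epsilon>"
    using lim1 \<epsilon> by (intro order_tendstoD(2)) auto
  ultimately have "\<forall>\<^sub>F n in sequentially. (\<integral>b. f n b * (norm (H b))^2 / N \<partial>P0) > N - \<epsilon>
      \<and> (\<integral>b. (1 - f n b)^2 * (norm (H b))^2 / N^2 \<partial>P0) < \<epsilon>"
    by (rule eventually_conj)
  then obtain n where n: "(\<integral>b. f n b * (norm (H b))^2 / N \<partial>P0) > N - \<epsilon>"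
      "(\<integral>b. (1 - f n b)^2 * (norm (H b))^2 / N^2 \<partial>P0) < \<epsilon>"
    using eventually_happens'[OF sequentially_bot] by blast
  have "(\<integral>\<^sup>+b. ennreal ((norm (V n b - (s / N) *\<^sub>R H b))^2) \<partial>P0) = (\<integral>\<^sup>+b. ennreal ((1 - f n b)^2 * (norm (H b))^2 / N^2) \<partial>P0)"
  proof (intro nn_integral_cong arg_cong[where f=ennreal])
    fix b
    have "V n b - (s / N) *\<^sub>R H b = (- (s / N) * (1 - f n b)) *\<^sub>R H b"
      unfolding V_def scaleR_left_diff_distrib[symmetric]
      by (rule arg_cong[where f="\<lambda>c. c *\<^sub>R H b"]) (simp add: algebra_simps diff_divide_distrib)
    then show "(norm (V n b - (s / N) *\<^sub>R H b))^2 = (1 - f n b)^2 * (norm (H b))^2 / N^2"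
      by (simp add: power_mult_distrib power_divide s2 abs_mult)
  qed
  also have "\<dots> = ennreal (\<integral>b. (1 - f n b)^2 * (norm (H b))^2 / N^2 \<partial>P0)"
    by (rule nn_integral_eq_integral[OF if2]) simp
  also have "\<dots> \<le> ennreal \<epsilon>" using n(2) by (intro ennreal_leI) simp
  finally have "(\<integral>\<^sup>+b. ennreal ((norm (V n b - (s / N) *\<^sub>R H b))^2) \<partial>P0) \<le> ennreal \<epsilon>" .
  moreover have "N - \<epsilon> \<le> s * (\<integral>b. H b \<bullet> V n b \<partial>P0)" unfolding HV using n(1) by (rule less_imp_le)
  ultimately show ?thesis using bp[of n] iV[of n] V1[of n] by blast
qed

text \<open>All demands on a perturbation at radius \<delta> with accuracy \<epsilon> sit in one
  predicate, so that the diagonal choice yields a single \<Delta> meeting them together. The sign s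
  is -1 for the infimum and 1 for the supremum.\<close>

definition good :: "real \<Rightarrow> real \<Rightarrow> real \<Rightarrow> real \<Rightarrow> (real^'d \<Rightarrow> real^'d) \<Rightarrow> bool" where
  "good \<tau> s \<epsilon> \<delta> \<Delta> \<longleftrightarrow> \<Delta> \<in> borel_measurable borel \<and>
    (\<integral>\<^sup>+b. ennreal ((norm (\<Delta> b - (s * sqrt (\<delta> / \<tau>) / N) *\<^sub>R H b))^2) \<partial>P0) \<le> ennreal (\<epsilon> * \<delta>) \<and>
    distr P0 borel (\<lambda>b. b + \<Delta> b) \<in> Uset \<tau> P0 \<delta> \<and>
    J (distr P0 borel (\<lambda>b. b + \<Delta> b)) < \<infinity> \<and>
    sqrt (\<delta> / \<tau>) * N - \<epsilon> * sqrt \<delta> \<le> s * (enn2real (J (distr P0 borel (\<lambda>b. b + \<Delta> b))) - enn2real (J P0))"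

text \<open>A fixed truncated direction, run at speed sqrt (\<delta> / \<tau>), serves all small
  \<delta>; its truncation level depends on \<epsilon> but not on \<delta>.\<close>

lemma perturbation_exists:
  assumes \<tau>: "\<tau> > 0" and \<epsilon>: "\<epsilon> > 0"
    and s: "s = -1 \<and> \<beta> \<ge> 0 \<or> s = 1 \<and> \<beta> \<le> 0 \<and> (\<forall>\<delta>>0. \<forall>Q\<in>Uset \<tau> P0 \<delta>. J Q < \<infinity>)"
  shows "\<forall>\<^sub>F \<delta> in at_right 0. \<exists>\<Delta>. good \<tau> s \<epsilon> \<delta> \<Delta>"
proof (cases "N = 0")
  \<comment> \<open>Here s * sqrt (\<delta> / \<tau>) / N is 0 as well, and no perturbation is needed.\<close>
  case True
  have id: "distr P0 borel (\<lambda>b. b) = P0" by (rule distr_id2) (simp add: P0_sets)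
  have "J P0 < \<infinity>" by (simp add: Jfun_P0)
  moreover have "distr P0 borel (\<lambda>b. b) \<in> Uset \<tau> P0 \<delta>" if "\<delta> > 0" for \<delta>
    by (rule distr_in_Uset[OF P0_prob P0_sets]) (auto simp: ctau_def)
  ultimately show ?thesis using eventually_at_right_real[of 0 1]
    by (auto elim!: eventually_mono intro!: exI[of _ "\<lambda>_. 0"] simp: good_def True id \<epsilon> less_imp_le)
next
  case False
  with HnormL2_nonneg have N: "N > 0" by simp
  have s1: "\<bar>s\<bar> = 1" "s * s = 1" using s by auto
  \<comment> \<open>With t = sqrt (\<delta> / \<tau>), the first entry makes t^2 \<epsilon>' \<le>
    \<epsilon> \<delta>. The second allows two losses of \<epsilon>', one from truncation and one
    from the difference quotient, at a total of \<epsilon> sqrt \<delta>.\<close>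
  define \<epsilon>' where "\<epsilon>' = min (\<epsilon> * \<tau>) (\<epsilon> * sqrt \<tau> / 2)"
  have \<epsilon>': "\<epsilon>' > 0" "\<epsilon>' \<le> \<epsilon> * \<tau>" "\<epsilon>' \<le> \<epsilon> * sqrt \<tau> / 2" using \<epsilon> \<tau> by (auto simp: \<epsilon>'_def)
  obtain V n where V: "bounded_perturbation T r \<alpha> \<beta> \<sigma> P0 V (real n) (real n / N)"
    "(\<integral>\<^sup>+b. ennreal ((norm (V b - (s / N) *\<^sub>R H b))^2) \<partial>P0) \<le> ennreal \<epsilon>'"
    "integrable P0 (\<lambda>b. (norm (V b))^2)" "(\<integral>b. (norm (V b))^2 \<partial>P0) < 1" "N - \<epsilon>' \<le> s * (\<integral>b. H b \<bullet> V b \<partial>P0)"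
    using truncated_direction[OF N \<epsilon>'(1) s1(1)] by blast
  interpret bounded_perturbation T r \<alpha> \<beta> \<sigma> P0 V "real n" "real n / N" by (rule V(1))
  define K where "K = real n / N"
  define v where "v = (\<integral>b. (norm (V b))^2 \<partial>P0)"
  have v: "0 \<le> v" "v < 1" using V(4) by (auto simp: v_def)
  have tt: "filterlim (\<lambda>\<delta>. sqrt (\<delta> / \<tau>)) (at_right 0) (at_right 0)"
  proof (rule filterlim_at_withinI)
    have "((\<lambda>\<delta>. sqrt (\<delta> / \<tau>)) \<longlongrightarrow> sqrt (0 / \<tau>)) (at_right 0)"
      using \<tau> by (intro tendsto_intros) auto
    then show "((\<lambda>\<delta>. sqrt (\<delta> / \<tau>)) \<longlongrightarrow> 0) (at_right 0)" by simp
    show "\<forall>\<^sub>F \<delta> in at_right 0. sqrt (\<delta> / \<tau>) \<in> {0<..} - {0}"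
      using eventually_at_right_less[of 0] by eventually_elim (use \<tau> in auto)
  qed
  have "((\<lambda>t. s * ((1 + \<beta>) * DJ t / t)) \<longlongrightarrow> s * (\<integral>b. H b \<bullet> V b \<partial>P0)) (at_right 0)"
    by (intro tendsto_intros DJ_tendsto)
  then have "\<forall>\<^sub>F t in at_right 0. s * ((1 + \<beta>) * DJ t / t) > s * (\<integral>b. H b \<bullet> V b \<partial>P0) - \<epsilon>'"
    using \<epsilon>'(1) by (intro order_tendstoD(1)) auto
  then have ev1: "\<forall>\<^sub>F \<delta> in at_right 0. s * ((1 + \<beta>) * DJ (sqrt (\<delta> / \<tau>)) / sqrt (\<delta> / \<tau>)) > s * (\<integral>b. H b \<bullet> V b \<partial>P0) - \<epsilon>'"
    by (rule eventually_compose_filterlim[OF _ tt])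
  have "((\<lambda>\<delta>. v * exp (\<delta> * K^2)) \<longlongrightarrow> v * exp (0 * K^2)) (at_right 0)" by (intro tendsto_intros)
  then have ev2: "\<forall>\<^sub>F \<delta> in at_right 0. v * exp (\<delta> * K^2) < 1" using v by (intro order_tendstoD(2)) auto
  have ev3: "\<forall>\<^sub>F \<delta> in at_right 0. \<delta> \<in> {0<..<\<tau>}" using \<tau> by (intro eventually_at_right_real)
  show ?thesis using ev1 ev2 ev3
  proof eventually_elim
    case (elim \<delta>)
    then have \<delta>: "\<delta> > 0" "\<delta> < \<tau>" by auto
    define t where "t = sqrt (\<delta> / \<tau>)"
    have t: "0 < t" "t \<le> 1" "t^2 = \<delta> / \<tau>" using \<delta> \<tau> by (auto simp: t_def)
    have push_eq: "distr P0 borel (\<lambda>b. b + t *\<^sub>R V b) = push t" by (simp add: push_def)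
    have close: "(\<integral>\<^sup>+b. ennreal ((norm (t *\<^sub>R V b - (s * t / N) *\<^sub>R H b))^2) \<partial>P0) \<le> ennreal (\<epsilon> * \<delta>)"
    proof -
      have "(\<integral>\<^sup>+b. ennreal ((norm (t *\<^sub>R V b - (s * t / N) *\<^sub>R H b))^2) \<partial>P0)
          = (\<integral>\<^sup>+b. ennreal (t^2) * ennreal ((norm (V b - (s / N) *\<^sub>R H b))^2) \<partial>P0)"
      proof (rule nn_integral_cong)
        fix b
        have "t *\<^sub>R V b - (s * t / N) *\<^sub>R H b = t *\<^sub>R (V b - (s / N) *\<^sub>R H b)"
          by (simp add: algebra_simps)
        then show "ennreal ((norm (t *\<^sub>R V b - (s * t / N) *\<^sub>R H b))^2) = ennreal (t^2) * ennreal ((norm (V b - (s / N) *\<^sub>R H b))^2)"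
          by (simp add: power_mult_distrib ennreal_mult)
      qed
      also have "\<dots> = ennreal (t^2) * (\<integral>\<^sup>+b. ennreal ((norm (V b - (s / N) *\<^sub>R H b))^2) \<partial>P0)"
        by (rule nn_integral_cmult) measurable
      also have "\<dots> \<le> ennreal (t^2) * ennreal \<epsilon>'" by (intro mult_left_mono V) auto
      also have "\<dots> = ennreal (\<delta> / \<tau> * \<epsilon>')" using t \<epsilon>' \<delta> \<tau> by (simp add: ennreal_mult[symmetric])
      also have "\<dots> \<le> ennreal (\<epsilon> * \<delta>)"
        using mult_left_mono[OF \<epsilon>'(2), of "\<delta> / \<tau>"] \<delta> \<tau> by (intro ennreal_leI) (simp add: mult.commute)
      finally show ?thesis .
    qed
    have inU: "push t \<in> Uset \<tau> P0 \<delta>"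
      unfolding push_def
    proof (rule distr_in_Uset[OF P0_prob P0_sets])
      have "(\<integral>\<^sup>+b. ennreal (ctau \<tau> (b + t *\<^sub>R V b) b) \<partial>P0) \<le> (\<integral>\<^sup>+b. ennreal (\<delta> * exp (\<delta> * K^2) * (norm (V b))^2) \<partial>P0)"
      proof (intro nn_integral_mono ennreal_leI)
        fix b
        have e: "\<tau> * (norm (b + t *\<^sub>R V b - b))^2 = \<delta> * (norm (V b))^2"
          using t \<tau> by (simp add: power_mult_distrib)
        \<comment> \<open>Since \<delta> |V b|^2 \<le> \<delta> K^2, the exponential cost exceeds
          the quadratic one by at most the factor exp (\<delta> K^2), which v < 1 compensates once
          \<delta> is small.\<close>
        have "exp (\<delta> * (norm (V b))^2) - 1 \<le> \<delta> * (norm (V b))^2 * exp (\<delta> * (norm (V b))^2)"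
          using abs_exp_minus_one_le[of "\<delta> * (norm (V b))^2"] \<delta> by simp
        also have "\<dots> \<le> \<delta> * (norm (V b))^2 * exp (\<delta> * K^2)"
          using \<delta> V_bound[of b] by (intro mult_left_mono) (auto simp: K_def intro!: power_mono)
        finally show "ctau \<tau> (b + t *\<^sub>R V b) b \<le> \<delta> * exp (\<delta> * K^2) * (norm (V b))^2"
          unfolding ctau_def e by (simp add: mult_ac)
      qed
      also have "\<dots> = ennreal (\<integral>b. \<delta> * exp (\<delta> * K^2) * (norm (V b))^2 \<partial>P0)"
        using V(3) \<delta> by (intro nn_integral_eq_integral) auto
      also have "(\<integral>b. \<delta> * exp (\<delta> * K^2) * (norm (V b))^2 \<partial>P0) = \<delta> * (v * exp (\<delta> * K^2))"
        by (simp add: v_def)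
      also have "ennreal (\<delta> * (v * exp (\<delta> * K^2))) \<le> ennreal \<delta>"
        using elim(2) \<delta> by (intro ennreal_leI) (simp add: mult_left_le)
      finally show "(\<integral>\<^sup>+b. ennreal (ctau \<tau> (b + t *\<^sub>R V b) b) \<partial>P0) \<le> ennreal \<delta>" .
    qed measurable
    have tt': "t * (s * ((1 + \<beta>) * DJ t / t)) = s * ((1 + \<beta>) * DJ t)" using t by simp
    have "t * (N - 2 * \<epsilon>') \<le> t * (s * ((1 + \<beta>) * DJ t / t))"
      using elim(1) V(5) t(1) unfolding t_def[symmetric] by (intro mult_left_mono) auto
    then have "t * N - t * (2 * \<epsilon>') \<le> s * ((1 + \<beta>) * DJ t)" unfolding tt' by (simp add: algebra_simps)
    moreover have "t * (2 * \<epsilon>') \<le> \<epsilon> * sqrt \<delta>"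
    proof -
      have "t * (2 * \<epsilon>') \<le> t * (\<epsilon> * sqrt \<tau>)" using \<epsilon>'(3) t by (intro mult_left_mono) auto
      also have "\<dots> = \<epsilon> * sqrt \<delta>" using \<tau> by (simp add: t_def real_sqrt_divide)
      finally show ?thesis .
    qed
    ultimately have lb: "t * N - \<epsilon> * sqrt \<delta> \<le> s * ((1 + \<beta>) * DJ t)" by linarith
    have "J (push t) < \<infinity> \<and> s * ((1 + \<beta>) * DJ t) \<le> s * (enn2real (J (push t)) - enn2real (J P0))"
      using s
    proof
      assume "s = -1 \<and> \<beta> \<ge> 0"
      with Jfun_push_le[OF _ t(1,2)] show ?thesis by auto
    next
      assume *: "s = 1 \<and> \<beta> \<le> 0 \<and> (\<forall>\<delta>>0. \<forall>Q\<in>Uset \<tau> P0 \<delta>. J Q < \<infinity>)"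
      with inU \<delta> have "J (push t) < \<infinity>" by blast
      with * Jfun_push_ge[OF _ t(1,2)] show ?thesis by auto
    qed
    with lb close inU show ?case
      by (intro exI[of _ "\<lambda>b. t *\<^sub>R V b"]) (auto simp: good_def push_eq t_def[symmetric])
  qed
qed

lemma asymptotic_perturbation:
  assumes \<tau>: "\<tau> > 0"
    and s: "s = -1 \<and> \<beta> \<ge> 0 \<or> s = 1 \<and> \<beta> \<le> 0 \<and> (\<forall>\<delta>>0. \<forall>Q\<in>Uset \<tau> P0 \<delta>. J Q < \<infinity>)"
  shows "\<exists>\<Delta>. (\<forall>\<delta>. \<Delta> \<delta> \<in> borel_measurable borel) \<and> (\<forall>\<epsilon>>0. \<forall>\<^sub>F \<delta> in at_right 0. good \<tau> s \<epsilon> \<delta> (\<Delta> \<delta>))"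
proof -
  have mono: "good \<tau> s \<epsilon>' \<delta> \<Delta>" if "good \<tau> s \<epsilon> \<delta> \<Delta>" "\<epsilon> \<le> \<epsilon>'" "\<delta> > 0" for \<epsilon> \<epsilon>' \<delta> \<Delta>
  proof -
    have "ennreal (\<epsilon> * \<delta>) \<le> ennreal (\<epsilon>' * \<delta>)" "\<epsilon> * sqrt \<delta> \<le> \<epsilon>' * sqrt \<delta>"
      using that by (auto intro!: ennreal_leI mult_right_mono)
    with that(1) show ?thesis unfolding good_def by (meson diff_left_mono order_trans)
  qed
  obtain X where X: "\<forall>\<epsilon>>0. \<forall>\<^sub>F \<delta> in at_right 0. good \<tau> s \<epsilon> \<delta> (X \<delta>)"
    using diagonal_choice_at_right_0[of "good \<tau> s"] perturbation_exists[OF \<tau> _ s] mono by blast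
  \<comment> \<open>Radii at which the choice fails to be measurable receive the zero map; close to
    0 this case does not occur.\<close>
  define \<Delta> where "\<Delta> \<delta> = (if X \<delta> \<in> borel_measurable borel then X \<delta> else (\<lambda>_. 0))" for \<delta>
  have "\<forall>\<^sub>F \<delta> in at_right 0. good \<tau> s \<epsilon> \<delta> (\<Delta> \<delta>)" if "\<epsilon> > 0" for \<epsilon>
    using X[rule_format, OF that] by eventually_elim (simp add: \<Delta>_def good_def)
  then show ?thesis by (intro exI[of _ \<Delta>]) (auto simp: \<Delta>_def)
qed

lemma good_eventuallyD:
  assumes "\<forall>\<epsilon>>0. \<forall>\<^sub>F \<delta> in at_right 0. good \<tau> s \<epsilon> \<delta> (\<Delta> \<delta>)"
  shows "\<forall>\<epsilon>>0. \<forall>\<^sub>F \<delta> in at_right 0.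
      (\<integral>\<^sup>+b. ennreal ((norm (\<Delta> \<delta> b - (s * sqrt (\<delta> / \<tau>) / N) *\<^sub>R H b))^2) \<partial>P0) \<le> ennreal (\<epsilon> * \<delta>)"
    and "\<forall>\<^sub>F \<delta> in at_right 0. distr P0 borel (\<lambda>b. b + \<Delta> \<delta> b) \<in> Uset \<tau> P0 \<delta>"
    and "\<forall>\<^sub>F \<delta> in at_right 0. J (distr P0 borel (\<lambda>b. b + \<Delta> \<delta> b)) < \<infinity>"
    and "\<epsilon> > 0 \<Longrightarrow> \<forall>\<^sub>F \<delta> in at_right 0.
      sqrt (\<delta> / \<tau>) * N - \<epsilon> * sqrt \<delta> \<le> s * (enn2real (J (distr P0 borel (\<lambda>b. b + \<Delta> \<delta> b))) - enn2real (J P0))"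
proof -
  have ev: "\<forall>\<^sub>F \<delta> in at_right 0. good \<tau> s \<epsilon> \<delta> (\<Delta> \<delta>)" if "\<epsilon> > 0" for \<epsilon> using assms that by blast
  show "\<forall>\<epsilon>>0. \<forall>\<^sub>F \<delta> in at_right 0.
      (\<integral>\<^sup>+b. ennreal ((norm (\<Delta> \<delta> b - (s * sqrt (\<delta> / \<tau>) / N) *\<^sub>R H b))^2) \<partial>P0) \<le> ennreal (\<epsilon> * \<delta>)"
    by (intro allI impI, drule ev, erule eventually_mono) (simp add: good_def)
  show "\<forall>\<^sub>F \<delta> in at_right 0. distr P0 borel (\<lambda>b. b + \<Delta> \<delta> b) \<in> Uset \<tau> P0 \<delta>"
    "\<forall>\<^sub>F \<delta> in at_right 0. J (distr P0 borel (\<lambda>b. b + \<Delta> \<delta> b)) < \<infinity>"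
    using ev[OF zero_less_one] by (eventually_elim, simp add: good_def)+
  show "\<forall>\<^sub>F \<delta> in at_right 0.
      sqrt (\<delta> / \<tau>) * N - \<epsilon> * sqrt \<delta> \<le> s * (enn2real (J (distr P0 borel (\<lambda>b. b + \<Delta> \<delta> b))) - enn2real (J P0))"
    if "\<epsilon> > 0" using ev[OF that] by eventually_elim (simp add: good_def)
qed

end

section \<open>Expansions of the infimum and of the supremum\<close>

context regular_drift_model
begin

text \<open>The infimum is caught between the exact lower bound and the value at the constructed
  law, so 0 \<le> e2 \<le> e1 and both errors are small because e1 is.\<close>

lemma inf_expansion:
  assumes \<tau>: "\<tau> > 0" and \<beta>: "\<beta> \<ge> 0"
  shows "(\<exists>\<Delta> :: real \<Rightarrow> real^'d \<Rightarrow> real^'d.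
          (\<forall>\<delta>>0. \<Delta> \<delta> \<in> borel_measurable borel)
        \<and> (\<forall>\<epsilon>>0. \<forall>\<^sub>F \<delta> in at_right 0.
              (\<integral>\<^sup>+ b. ennreal ((norm (\<Delta> \<delta> b + (sqrt (\<delta> / \<tau>) / N) *\<^sub>R H b))^2) \<partial>P0) \<le> ennreal (\<epsilon> * \<delta>))
        \<and> (\<forall>\<^sub>F \<delta> in at_right 0. distr P0 borel (\<lambda>b. b + \<Delta> \<delta> b) \<in> Uset \<tau> P0 \<delta>)
        \<and> (\<exists>e. e \<in> o[at_right 0](\<lambda>\<delta>. sqrt \<delta>) \<and>
             (\<forall>\<^sub>F \<delta> in at_right 0. J (distr P0 borel (\<lambda>b. b + \<Delta> \<delta> b))
                = ennreal (enn2real (J P0) - sqrt (\<delta> / \<tau>) * N + e \<delta>))))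
      \<and> (\<exists>e. e \<in> o[at_right 0](\<lambda>\<delta>. sqrt \<delta>) \<and>
           (\<forall>\<^sub>F \<delta> in at_right 0. (INF Q\<in>Uset \<tau> P0 \<delta>. J Q)
              = ennreal (enn2real (J P0) - sqrt (\<delta> / \<tau>) * N + e \<delta>)))"
proof -
  obtain \<Delta> where \<Delta>1: "\<And>\<delta>. \<Delta> \<delta> \<in> borel_measurable borel"
    and \<Delta>2: "\<forall>\<epsilon>>0. \<forall>\<^sub>F \<delta> in at_right 0. good \<tau> (-1) \<epsilon> \<delta> (\<Delta> \<delta>)"
    using asymptotic_perturbation[OF \<tau>, of "-1"] \<beta> by blast
  note \<Delta> = \<Delta>1 good_eventuallyD[OF \<Delta>2]
  define q where "q \<delta> = J (distr P0 borel (\<lambda>b. b + \<Delta> \<delta> b))" for \<delta>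
  define i where "i \<delta> = (INF Q\<in>Uset \<tau> P0 \<delta>. J Q)" for \<delta>
  define a where "a \<delta> = enn2real (J P0) - sqrt (\<delta> / \<tau>) * N" for \<delta>
  define e1 where "e1 \<delta> = enn2real (q \<delta>) - a \<delta>" for \<delta>
  define e2 where "e2 \<delta> = enn2real (i \<delta>) - a \<delta>" for \<delta>
  have ev: "\<forall>\<^sub>F \<delta> in at_right 0. q \<delta> < \<infinity> \<and> i \<delta> < \<infinity> \<and> 0 \<le> e2 \<delta> \<and> e2 \<delta> \<le> e1 \<delta>"
    using \<Delta>(3,4) eventually_at_right_less[of 0]
  proof eventually_elim
    case (elim \<delta>)
    have iq: "i \<delta> \<le> q \<delta>" unfolding i_def q_def by (rule INF_lower[OF elim(1)])
    then have fin: "i \<delta> < \<infinity>" "q \<delta> < \<infinity>" using elim(2) by (auto simp: q_def)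
    have "ennreal (a \<delta>) \<le> i \<delta>"
      unfolding i_def a_def by (intro INF_greatest Jfun_lower_bound \<beta> \<tau>) (use elim in auto)
    then have "a \<delta> \<le> enn2real (i \<delta>)" using fin(1) by (cases "i \<delta>") (auto simp: ennreal_le_iff2)
    moreover have "enn2real (i \<delta>) \<le> enn2real (q \<delta>)" using iq fin by (intro enn2real_mono) auto
    ultimately show ?case using fin by (simp add: e1_def e2_def)
  qed
  have e1: "\<forall>\<^sub>F \<delta> in at_right 0. e1 \<delta> \<le> \<epsilon> * sqrt \<delta>" if "\<epsilon> > 0" for \<epsilon>
    using \<Delta>(5)[OF that] by eventually_elim (simp add: e1_def a_def q_def)
  have o: "e1 \<in> o[at_right 0](\<lambda>\<delta>. sqrt \<delta>)" "e2 \<in> o[at_right 0](\<lambda>\<delta>. sqrt \<delta>)"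
  proof (rule_tac [!] landau_o.smallI)
    fix c :: real assume "c > 0"
    from ev e1[OF this] eventually_at_right_less[of 0]
    show "\<forall>\<^sub>F \<delta> in at_right 0. norm (e1 \<delta>) \<le> c * norm (sqrt \<delta>)" "\<forall>\<^sub>F \<delta> in at_right 0. norm (e2 \<delta>) \<le> c * norm (sqrt \<delta>)"
      by (eventually_elim, simp)+
  qed
  have "\<forall>\<^sub>F \<delta> in at_right 0. q \<delta> = ennreal (a \<delta> + e1 \<delta>)" "\<forall>\<^sub>F \<delta> in at_right 0. i \<delta> = ennreal (a \<delta> + e2 \<delta>)"
    using ev by (eventually_elim, simp add: e1_def e2_def)+
  with o \<Delta>(1-3) show ?thesis unfolding q_def i_def a_def
    by (intro conjI exI[of _ \<Delta>] exI[of _ e1] exI[of _ e2]) auto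
qed

text \<open>Here e1 \<le> e2: the constructed law keeps e1 above - \<epsilon> sqrt \<delta>, and the
  bound over the ball keeps e2 below C \<delta> powr (2/3), which is o(sqrt \<delta>).\<close>

lemma sup_expansion:
  assumes \<tau>: "\<tau> > 0" and \<beta>: "\<beta> \<le> 0"
    and exp_moment: "\<And>c. (\<integral>\<^sup>+b. ennreal (exp (c * norm b)) \<partial>P0) < \<infinity>"
  shows "(\<exists>\<Delta> :: real \<Rightarrow> real^'d \<Rightarrow> real^'d.
          (\<forall>\<delta>>0. \<Delta> \<delta> \<in> borel_measurable borel)
        \<and> (\<forall>\<epsilon>>0. \<forall>\<^sub>F \<delta> in at_right 0.
              (\<integral>\<^sup>+ b. ennreal ((norm (\<Delta> \<delta> b - (sqrt (\<delta> / \<tau>) / N) *\<^sub>R H b))^2) \<partial>P0) \<le> ennreal (\<epsilon> * \<delta>))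
        \<and> (\<forall>\<^sub>F \<delta> in at_right 0. distr P0 borel (\<lambda>b. b + \<Delta> \<delta> b) \<in> Uset \<tau> P0 \<delta>)
        \<and> (\<exists>e. e \<in> o[at_right 0](\<lambda>\<delta>. sqrt \<delta>) \<and>
             (\<forall>\<^sub>F \<delta> in at_right 0. J (distr P0 borel (\<lambda>b. b + \<Delta> \<delta> b))
                = ennreal (enn2real (J P0) + sqrt (\<delta> / \<tau>) * N + e \<delta>))))
      \<and> (\<exists>e. e \<in> o[at_right 0](\<lambda>\<delta>. sqrt \<delta>) \<and>
           (\<forall>\<^sub>F \<delta> in at_right 0. (SUP Q\<in>Uset \<tau> P0 \<delta>. J Q)
              = ennreal (enn2real (J P0) + sqrt (\<delta> / \<tau>) * N + e \<delta>)))"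
proof -
  obtain C where C: "C \<ge> 0" "\<And>\<delta> Q. \<delta> > 0 \<Longrightarrow> Q \<in> Uset \<tau> P0 \<delta> \<Longrightarrow>
     J Q \<le> ennreal (enn2real (J P0) + sqrt (\<delta> / \<tau>) * N + C * \<delta> powr (2/3))"
    using Jfun_upper_bound[OF \<beta> \<tau> exp_moment] by blast
  have "\<forall>\<delta>>0. \<forall>Q\<in>Uset \<tau> P0 \<delta>. J Q < \<infinity>" using le_less_trans[OF C(2) ennreal_less_top] by auto
  then obtain \<Delta> where \<Delta>1: "\<And>\<delta>. \<Delta> \<delta> \<in> borel_measurable borel"
    and \<Delta>2: "\<forall>\<epsilon>>0. \<forall>\<^sub>F \<delta> in at_right 0. good \<tau> 1 \<epsilon> \<delta> (\<Delta> \<delta>)"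
    using asymptotic_perturbation[OF \<tau>, of 1] \<beta> by blast
  note \<Delta> = \<Delta>1 good_eventuallyD[OF \<Delta>2]
  define q where "q \<delta> = J (distr P0 borel (\<lambda>b. b + \<Delta> \<delta> b))" for \<delta>
  define i where "i \<delta> = (SUP Q\<in>Uset \<tau> P0 \<delta>. J Q)" for \<delta>
  define a where "a \<delta> = enn2real (J P0) + sqrt (\<delta> / \<tau>) * N" for \<delta>
  define e1 where "e1 \<delta> = enn2real (q \<delta>) - a \<delta>" for \<delta>
  define e2 where "e2 \<delta> = enn2real (i \<delta>) - a \<delta>" for \<delta>
  have ev: "\<forall>\<^sub>F \<delta> in at_right 0. q \<delta> < \<infinity> \<and> i \<delta> < \<infinity> \<and> e1 \<delta> \<le> e2 \<delta> \<and> e2 \<delta> \<le> C * \<delta> powr (2/3)"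
    using \<Delta>(3) eventually_at_right_less[of 0]
  proof eventually_elim
    case (elim \<delta>)
    have qi: "q \<delta> \<le> i \<delta>" unfolding i_def q_def by (rule SUP_upper[OF elim(1)])
    have ic: "i \<delta> \<le> ennreal (a \<delta> + C * \<delta> powr (2/3))"
      unfolding i_def a_def by (intro SUP_least C(2)) (use elim in auto)
    have fin: "i \<delta> < \<infinity>" "q \<delta> < \<infinity>" using le_less_trans[OF ic ennreal_less_top] qi by auto
    have "0 \<le> a \<delta> + C * \<delta> powr (2/3)"
      using C(1) \<tau> elim HnormL2_nonneg by (auto simp: a_def intro!: add_nonneg_nonneg mult_nonneg_nonneg)
    then have "enn2real (i \<delta>) \<le> a \<delta> + C * \<delta> powr (2/3)" using ic by (intro enn2real_leI)
    moreover have "enn2real (q \<delta>) \<le> enn2real (i \<delta>)" using qi fin by (intro enn2real_mono) auto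
    ultimately show ?case using fin by (simp add: e1_def e2_def)
  qed
  have e1: "\<forall>\<^sub>F \<delta> in at_right 0. - (\<epsilon> * sqrt \<delta>) \<le> e1 \<delta>" if "\<epsilon> > 0" for \<epsilon>
    using \<Delta>(5)[OF that] by eventually_elim (simp add: e1_def a_def q_def)
  have small: "\<forall>\<^sub>F \<delta> in at_right 0. C * \<delta> powr (2/3) \<le> \<epsilon> * sqrt \<delta>" if "\<epsilon> > 0" for \<epsilon>
  proof -
    have "((\<lambda>\<delta>::real. C * \<delta> powr (1/6)) \<longlongrightarrow> C * 0 powr (1/6)) (at_right 0)"
      by (intro tendsto_intros) (auto simp: eventually_at_filter)
    then have "\<forall>\<^sub>F \<delta> in at_right 0. C * \<delta> powr (1/6) < \<epsilon>" using that by (intro order_tendstoD(2)) auto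
    then show ?thesis using eventually_at_right_less[of 0]
    proof eventually_elim
      case (elim \<delta>)
      have "\<delta> powr (2/3) = \<delta> powr (1/6) * sqrt \<delta>"
        using elim by (simp add: powr_half_sqrt[symmetric] powr_add[symmetric])
      then show ?case using mult_right_mono[of "C * \<delta> powr (1/6)" \<epsilon> "sqrt \<delta>"] elim by (simp add: mult.assoc)
    qed
  qed
  have o: "e1 \<in> o[at_right 0](\<lambda>\<delta>. sqrt \<delta>)" "e2 \<in> o[at_right 0](\<lambda>\<delta>. sqrt \<delta>)"
  proof (rule_tac [!] landau_o.smallI)
    fix c :: real assume "c > 0"
    from ev e1[OF this] small[OF this] eventually_at_right_less[of 0]
    show "\<forall>\<^sub>F \<delta> in at_right 0. norm (e1 \<delta>) \<le> c * norm (sqrt \<delta>)" "\<forall>\<^sub>F \<delta> in at_right 0. norm (e2 \<delta>) \<le> c * norm (sqrt \<delta>)"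
      by (eventually_elim, simp add: abs_le_iff)+
  qed
  have "\<forall>\<^sub>F \<delta> in at_right 0. q \<delta> = ennreal (a \<delta> + e1 \<delta>)" "\<forall>\<^sub>F \<delta> in at_right 0. i \<delta> = ennreal (a \<delta> + e2 \<delta>)"
    using ev by (eventually_elim, simp add: e1_def e2_def)+
  with o \<Delta>(1-3) show ?thesis unfolding q_def i_def a_def
    by (intro conjI exI[of _ \<Delta>] exI[of _ e1] exI[of _ e2]) auto
qed

end

section \<open>From the Gaussian moment hypothesis to the two expansions\<close>

theorem theorem5:
  fixes T r \<alpha> \<beta> \<tau> :: real and \<sigma> :: "real^'d^'d" and P0 :: "(real^'d) measure"
  assumes T: "T > 0" and r: "r > 0" and inv: "invertible \<sigma>"
    and \<alpha>: "\<alpha> < 1" "\<alpha> \<noteq> 0"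
    and \<beta>: "\<beta> = \<alpha> / (1 - \<alpha>)"
    and \<tau>: "\<tau> > max (4 * T * (frob (matrix_inv \<sigma>))^2)
                     (2 * T * (4 * \<beta>^2 - 2 * \<beta>) * (frob (matrix_inv \<sigma>))^2)"
    and P0: "prob_space P0" "sets P0 = sets borel"
    and \<gamma>0: "\<exists>\<gamma>0 > 0.
        (\<forall>\<gamma>. 0 < \<gamma> \<and> \<gamma> < \<gamma>0 \<longrightarrow> (\<integral>\<^sup>+ b. ennreal (exp (\<gamma>^2 * (norm b)^2)) \<partial>P0) < \<infinity>)
      \<and> \<gamma>0^2 / (frob (matrix_inv \<sigma>))^2 >
          T * Max {(\<beta>^2 - \<beta> + 2 + sqrt ((\<beta>^2 - \<beta> + 2)^2 + 8 * (\<beta>^2 + \<beta>))) / 2,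
                   8,
                   \<tau> * (2 * T * (4 * \<beta>^2 - 2 * \<beta>))
                     / (\<tau> - 2 * T * (4 * \<beta>^2 - 2 * \<beta>) * (frob (matrix_inv \<sigma>))^2)}"
  shows
   "(0 < \<alpha> \<longrightarrow>
      (\<exists>\<Delta> :: real \<Rightarrow> real^'d \<Rightarrow> real^'d.
          (\<forall>\<delta>>0. \<Delta> \<delta> \<in> borel_measurable borel)
        \<and> (\<forall>\<epsilon>>0. \<forall>\<^sub>F \<delta> in at_right 0.
              (\<integral>\<^sup>+ b. ennreal ((norm (\<Delta> \<delta> b
                  + (sqrt (\<delta> / \<tau>) / HnormL2 T r \<sigma> \<alpha> P0) *\<^sub>R Hfun T r \<sigma> \<alpha> P0 b))^2) \<partial>P0)
              \<le> ennreal (\<epsilon> * \<delta>))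
        \<and> (\<forall>\<^sub>F \<delta> in at_right 0. distr P0 borel (\<lambda>b. b + \<Delta> \<delta> b) \<in> Uset \<tau> P0 \<delta>)
        \<and> (\<exists>e. e \<in> o[at_right 0](\<lambda>\<delta>. sqrt \<delta>) \<and>
             (\<forall>\<^sub>F \<delta> in at_right 0.
                Jfun T r \<sigma> \<alpha> (distr P0 borel (\<lambda>b. b + \<Delta> \<delta> b))
                = ennreal (enn2real (Jfun T r \<sigma> \<alpha> P0)
                           - sqrt (\<delta> / \<tau>) * HnormL2 T r \<sigma> \<alpha> P0 + e \<delta>))))
      \<and> (\<exists>e. e \<in> o[at_right 0](\<lambda>\<delta>. sqrt \<delta>) \<and>
           (\<forall>\<^sub>F \<delta> in at_right 0.
              (INF Q\<in>Uset \<tau> P0 \<delta>. Jfun T r \<sigma> \<alpha> Q)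
              = ennreal (enn2real (Jfun T r \<sigma> \<alpha> P0)
                         - sqrt (\<delta> / \<tau>) * HnormL2 T r \<sigma> \<alpha> P0 + e \<delta>))))
  \<and> (\<alpha> < 0 \<longrightarrow>
      (\<exists>\<Delta> :: real \<Rightarrow> real^'d \<Rightarrow> real^'d.
          (\<forall>\<delta>>0. \<Delta> \<delta> \<in> borel_measurable borel)
        \<and> (\<forall>\<epsilon>>0. \<forall>\<^sub>F \<delta> in at_right 0.
              (\<integral>\<^sup>+ b. ennreal ((norm (\<Delta> \<delta> b
                  - (sqrt (\<delta> / \<tau>) / HnormL2 T r \<sigma> \<alpha> P0) *\<^sub>R Hfun T r \<sigma> \<alpha> P0 b))^2) \<partial>P0)
              \<le> ennreal (\<epsilon> * \<delta>))
        \<and> (\<forall>\<^sub>F \<delta> in at_right 0. distr P0 borel (\<lambda>b. b + \<Delta> \<delta> b) \<in> Uset \<tau> P0 \<delta>)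
        \<and> (\<exists>e. e \<in> o[at_right 0](\<lambda>\<delta>. sqrt \<delta>) \<and>
             (\<forall>\<^sub>F \<delta> in at_right 0.
                Jfun T r \<sigma> \<alpha> (distr P0 borel (\<lambda>b. b + \<Delta> \<delta> b))
                = ennreal (enn2real (Jfun T r \<sigma> \<alpha> P0)
                           + sqrt (\<delta> / \<tau>) * HnormL2 T r \<sigma> \<alpha> P0 + e \<delta>))))
      \<and> (\<exists>e. e \<in> o[at_right 0](\<lambda>\<delta>. sqrt \<delta>) \<and>
           (\<forall>\<^sub>F \<delta> in at_right 0.
              (SUP Q\<in>Uset \<tau> P0 \<delta>. Jfun T r \<sigma> \<alpha> Q)
              = ennreal (enn2real (Jfun T r \<sigma> \<alpha> P0)
                         + sqrt (\<delta> / \<tau>) * HnormL2 T r \<sigma> \<alpha> P0 + e \<delta>))))"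
proof -
  interpret drift_model T r \<alpha> \<beta> \<sigma> P0
    by (rule drift_model.intro[OF T \<alpha>(1) \<beta> P0])
  let ?s = "frob (matrix_inv \<sigma>)"
  let ?k = "(\<beta>^2 - \<beta> + 2 + sqrt ((\<beta>^2 - \<beta> + 2)^2 + 8 * (\<beta>^2 + \<beta>))) / 2"
  \<comment> \<open>Dominates 8 and the root in \<open>quadratic_root_bound\<close>, as the
    integrability argument for \<beta> \<ge> 0 requires.\<close>
  define \<kappa> where "\<kappa> = max ?k 8"
  have \<tau>0: "\<tau> > 0"
  proof -
    have "0 \<le> 4 * T * ?s^2" using T by simp
    also have "\<dots> < \<tau>" using \<tau> by simp
    finally show ?thesis .
  qed
  define M where "M = Max {?k, 8, \<tau> * (2 * T * (4 * \<beta>^2 - 2 * \<beta>)) / (\<tau> - 2 * T * (4 * \<beta>^2 - 2 * \<beta>) * ?s^2)}"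
  have M: "?k \<le> M" "8 \<le> M" unfolding M_def by (rule Max_ge; simp)+
  obtain \<gamma>0 where \<gamma>0: "\<gamma>0 > 0" "\<gamma>0^2 / ?s^2 > T * M"
    "\<And>\<gamma>. 0 < \<gamma> \<Longrightarrow> \<gamma> < \<gamma>0 \<Longrightarrow> (\<integral>\<^sup>+ b. ennreal (exp (\<gamma>^2 * (norm b)^2)) \<partial>P0) < \<infinity>"
    using \<gamma>0 unfolding M_def by blast
  have "\<kappa> \<le> M" "\<kappa> \<ge> 8" using M by (auto simp: \<kappa>_def)
  then have \<kappa>M: "T * \<kappa> \<le> T * M" "T * \<kappa> > 0" using T by auto
  \<comment> \<open>If the norm were 0, division by zero would make the left side of the assumption
    on \<gamma>0 equal to 0, against the positive T M.\<close>
  then have s: "?s^2 > 0" using \<gamma>0(2) by (cases "?s = 0") auto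
  have "T * \<kappa> < \<gamma>0^2 / ?s^2" using \<kappa>M \<gamma>0(2) by linarith
  then have lt: "\<kappa> * T * ?s^2 < \<gamma>0^2" using s by (simp add: field_simps)
  \<comment> \<open>\<gamma>^2 lies midway between \<open>\<kappa> * T * ?s^2\<close> and
    \<open>\<gamma>0^2\<close>: below \<gamma>0 the moment is finite by assumption, and the gap to
    the lower value is what \<open>exp_mpr_moment\<close> consumes.\<close>
  define \<gamma> where "\<gamma> = sqrt ((\<gamma>0^2 + \<kappa> * T * ?s^2) / 2)"
  have pos: "\<kappa> * T * ?s^2 > 0" using \<open>\<kappa> \<ge> 8\<close> T s by (intro mult_pos_pos) auto
  have \<gamma>sq: "\<gamma>^2 = (\<gamma>0^2 + \<kappa> * T * ?s^2) / 2" using pos by (simp add: \<gamma>_def add_nonneg_nonneg)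
  have \<gamma>: "\<gamma> > 0" using pos lt by (simp add: \<gamma>_def)
  have \<gamma>_gt: "\<kappa> * T * ?s^2 < \<gamma>^2" unfolding \<gamma>sq using lt by (simp add: mult_ac)
  have "\<gamma>^2 < \<gamma>0^2" unfolding \<gamma>sq using lt by simp
  then have "\<gamma> < \<gamma>0" using \<gamma>0(1) by (simp add: power2_less_imp_less)
  then have mom: "(\<integral>\<^sup>+ b. ennreal (exp (\<gamma>^2 * (norm b)^2)) \<partial>P0) < \<infinity>" using \<gamma> \<gamma>0(3) by blast
  note exp_moment = exp_norm_moment[OF \<gamma> mom]
  have "regular_drift_model T r \<alpha> \<beta> \<sigma> P0"
  proof (cases "0 < \<alpha>")
    case True
    then have \<beta>0: "\<beta> \<ge> 0" using \<alpha> \<beta> by simp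
    have "\<kappa>^2 \<ge> (\<beta>^2 - \<beta> + 2) * \<kappa> + 2 * (\<beta>^2 + \<beta>)"
      by (rule quadratic_root_bound) (use \<beta>0 in \<open>auto simp: \<kappa>_def\<close>)
    then show ?thesis
      using regular_nonneg[OF \<beta>0 \<open>\<kappa> \<ge> 8\<close> _ exp_mpr_moment[OF \<gamma>_gt _ mom]] \<open>\<kappa> \<ge> 8\<close> by simp
  next
    case False
    then have "\<beta> \<le> 0" using \<alpha> \<beta> by (simp add: divide_nonpos_pos)
    then show ?thesis by (rule regular_nonpos[OF _ exp_moment])
  qed
  then interpret regular_drift_model T r \<alpha> \<beta> \<sigma> P0 .
  have "0 < \<alpha> \<Longrightarrow> \<beta> \<ge> 0" "\<alpha> < 0 \<Longrightarrow> \<beta> \<le> 0" using \<alpha> \<beta> by (auto simp: divide_nonpos_pos)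
  then show ?thesis
    using inf_expansion[OF \<tau>0] sup_expansion[OF \<tau>0 _ exp_moment] by blast
qed

end
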